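(* Let $\phi\colon\mathbb{T}^2\multimap\mathbb{T}^2$ be a split $2$-valued map of the torus, and let $\widehat\Phi=(f_1,f_2)\colon\mathbb{T}^2\to F_2(\mathbb{T}^2)$ be a lift of $\phi$ such that $\widehat\Phi_{\#}(e_1)=(w^r,(a,b))$ and $\widehat\Phi_{\#}(e_2)=(w^s,(c,d))$, where $(r,s)\in\mathbb{Z}^2\setminus\{(0,0)\}$, $a,b,c,d\in\mathbb{Z}$ and $w\in\mathbb{F}_2(u,v)$. Then the Nielsen number of $\phi$ is given by $$N(\phi)=\left|\det\begin{pmatrix}a-1&c\\ b&d-1\end{pmatrix}\right|+\left|\det\begin{pmatrix}rm+a-1&sm+c\\ rn+b&sn+d-1\end{pmatrix}\right|,$$ where $\mathrm{Ab}(w)=(m,n)\in\mathbb{Z}^2$. If the map $\phi$ can be deformed to a fixed point free $2$-valued map, then both of the maps $f_1$ and $f_2$ can be deformed to fixed point free maps. Furthermore, $f_1$ and $f_2$ can be deformed to fixed point free maps if and only if either: (a) the pairs of integers $(a-1,b)$, $(c,d-1)$ and $(m,n)$ belong to a cyclic subgroup of $\mathbb{Z}^2$, or (b) $s(a-1,b)=r(c,d-1)$.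
   Context: A $2$-valued map $\phi\colon X\multimap Y$ assigns to each $x\in X$ a subset $\phi(x)\subset Y$ of exactly two points, and is continuous: for every open $V\subset Y$ the sets $\{x\mid\phi(x)\subset V\}$ and $\{x\mid\phi(x)\cap V\neq\varnothing\}$ are open and each $\phi(x)$ is closed. It is split if $\phi(x)=\{f_1(x),f_2(x)\}$ for continuous maps $f_1,f_2\colon X\to Y$ (necessarily without coincidences). A homotopy (deformation) of $2$-valued maps is a $2$-valued map $H\colon X\times I\multimap Y$ with the prescribed ends; a single-valued map is deformed by ordinary homotopy. $\phi\colon X\multimap X$ is fixed point free if $x\notin\phi(x)$ for all $x$. $F_2(\mathbb{T}^2)=\{(y_1,y_2)\in\mathbb{T}^2\times\mathbb{T}^2\mid y_1\neq y_2\}$; a lift of a split map $\phi=\{f_1,f_2\}$ is a map $\widehat\Phi=(f_1,f_2)\colon\mathbb{T}^2\to F_2(\mathbb{T}^2)$. $(e_1,e_2)$ is the basis of $\pi_1(\mathbb{T}^2)\cong\mathbb{Z}^2$ given by the meridian and longitude. $P_2(\mathbb{T}^2)=\pi_1(F_2(\mathbb{T}^2))$ is identified with $\mathbb{F}_2(u,v)\times\mathbb{Z}^2$ as follows. Let $p_i\colon F_2(\mathbb{T}^2)\to\mathbb{T}^2$ be the $i$-th projection. $\mathbb{F}_2(u,v)$ is the kernel of $p_{2\#}$, i.e. $\pi_1(\mathbb{T}^2\setminus\{x_2\},x_1)$, which is free on $u,v$, where $p_{1\#}(u)=e_1$, $p_{1\#}(v)=e_2$; the factor $\mathbb{Z}^2$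 is the centre of $P_2(\mathbb{T}^2)$, with basis $x,y$ satisfying $p_{i\#}(x)=e_1$, $p_{i\#}(y)=e_2$ for $i=1,2$ (both points moving together along the meridian, resp. the longitude). The element $w x^ay^b$ is written $(w,(a,b))$. $\mathrm{Ab}\colon\mathbb{F}_2(u,v)\to\mathbb{Z}^2$ is Abelianisation, $u\mapsto(1,0)$, $v\mapsto(0,1)$. Basepoints are suppressed (fundamental groups at different basepoints being identified via paths). The Nielsen number $N(\phi)$ (Schirmer) is the number of fixed point classes of non-zero index. Two fixed points $x_0,x_1$ of $\phi$ are in the same class if there is a path $p$ from $x_0$ to $x_1$ such that, writing $\phi\circ p=\{g_1,g_2\}$ with $g_i$ continuous paths, some $g_j$ runs from $x_0$ to $x_1$ and is homotopic to $p$ rel endpoints. For split $\phi=\{f_1,f_2\}$ each class of $\phi$ is an ordinary fixed point class of one of the maps $f_1,f_2$, its index is the ordinary fixed point index of that map on the class, and $N(\phi)=N(f_1)+N(f_2)$, where $N(f_i)$ is the classical Nielsen number. *)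

theory Defs
  imports "HOL-Analysis.Analysis" "HOL-Homology.Homology"
begin

text \<open>Upper and lower semicontinuity, relative to subsets of topological spaces.\<close>

definition two_valued_map ::
  "'a::topological_space set \<Rightarrow> 'b::topological_space set \<Rightarrow> ('a \<Rightarrow> 'b set) \<Rightarrow> bool" where
  "two_valued_map X Y \<phi> \<longleftrightarrow>
     (\<forall>x\<in>X. \<phi> x \<subseteq> Y \<and> card (\<phi> x) = 2 \<and> closedin (top_of_set Y) (\<phi> x)) \<and>
     (\<forall>V. openin (top_of_set Y) V \<longrightarrow>
        openin (top_of_set X) {x\<in>X. \<phi> x \<subseteq> V} \<and>
        openin (top_of_set X) {x\<in>X. \<phi> x \<inter> V \<noteq> {}})"

definition splitting ::
  "'a::topological_space set \<Rightarrow> 'b::topological_space set \<Rightarrow> ('a \<Rightarrow> 'b set)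
     \<Rightarrow> ('a \<Rightarrow> 'b) \<Rightarrow> ('a \<Rightarrow> 'b) \<Rightarrow> bool" where
  "splitting X Y \<phi> f g \<longleftrightarrow>
     continuous_on X f \<and> f ` X \<subseteq> Y \<and> continuous_on X g \<and> g ` X \<subseteq> Y \<and>
     (\<forall>x\<in>X. \<phi> x = {f x, g x})"

definition split_two_valued_map ::
  "'a::topological_space set \<Rightarrow> 'b::topological_space set \<Rightarrow> ('a \<Rightarrow> 'b set) \<Rightarrow> bool" where
  "split_two_valued_map X Y \<phi> \<longleftrightarrow>
     two_valued_map X Y \<phi> \<and> (\<exists>f g. splitting X Y \<phi> f g)"

definition homotopic_two_valued ::
  "'a::topological_space set \<Rightarrow> 'b::topological_space set \<Rightarrow> ('a \<Rightarrow> 'b set) \<Rightarrow> ('a \<Rightarrow> 'b set) \<Rightarrow> bool" where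
  "homotopic_two_valued X Y \<phi> \<psi> \<longleftrightarrow>
     (\<exists>H. two_valued_map (X \<times> {0..1::real}) Y H \<and>
          (\<forall>x\<in>X. H (x, 0) = \<phi> x \<and> H (x, 1) = \<psi> x))"

definition two_valued_fixpoints :: "'a set \<Rightarrow> ('a \<Rightarrow> 'a set) \<Rightarrow> 'a set" where
  "two_valued_fixpoints X \<phi> = {x\<in>X. x \<in> \<phi> x}"

definition deforms_to_fpf_two_valued :: "'a::topological_space set \<Rightarrow> ('a \<Rightarrow> 'a set) \<Rightarrow> bool" where
  "deforms_to_fpf_two_valued X \<phi> \<longleftrightarrow>
     (\<exists>\<psi>. homotopic_two_valued X X \<phi> \<psi> \<and> (\<forall>x\<in>X. x \<notin> \<psi> x))"

definition deforms_to_fpf :: "'a::topological_space set \<Rightarrow> ('a \<Rightarrow> 'a) \<Rightarrow> bool" where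
  "deforms_to_fpf X f \<longleftrightarrow>
     (\<exists>g. homotopic_with_canon (\<lambda>_. True) X X f g \<and> (\<forall>x\<in>X. g x \<noteq> x))"

definition fixpoint_class_rel :: "'a::topological_space set \<Rightarrow> ('a \<Rightarrow> 'a set) \<Rightarrow> ('a \<times> 'a) set" where
  "fixpoint_class_rel X \<phi> =
     {(x0, x1). x0 \<in> two_valued_fixpoints X \<phi> \<and> x1 \<in> two_valued_fixpoints X \<phi> \<and>
        (\<exists>p g1 g2. path p \<and> path_image p \<subseteq> X \<and> pathstart p = x0 \<and> pathfinish p = x1 \<and>
           path g1 \<and> path_image g1 \<subseteq> X \<and> path g2 \<and> path_image g2 \<subseteq> X \<and>
           (\<forall>t\<in>{0..1}. \<phi> (p t) = {g1 t, g2 t}) \<and>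
           (\<exists>g\<in>{g1, g2}. pathstart g = x0 \<and> pathfinish g = x1 \<and> homotopic_paths X g p))}"

definition fixpoint_classes :: "'a::topological_space set \<Rightarrow> ('a \<Rightarrow> 'a set) \<Rightarrow> 'a set set" where
  "fixpoint_classes X \<phi> = two_valued_fixpoints X \<phi> // fixpoint_class_rel X \<phi>"

definition path_class :: "'a::topological_space set \<Rightarrow> (real \<Rightarrow> 'a) \<Rightarrow> (real \<Rightarrow> 'a) set" where
  "path_class S p = {q. homotopic_paths S p q}"

definition fundamental_group :: "'a::topological_space set \<Rightarrow> 'a \<Rightarrow> (real \<Rightarrow> 'a) set monoid" where
  "fundamental_group S x =
     \<lparr>carrier = path_class S ` {p. path p \<and> path_image p \<subseteq> S \<and> pathstart p = x \<and> pathfinish p = x},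
      monoid.mult = (\<lambda>A B. {r. \<exists>p\<in>A. \<exists>q\<in>B. homotopic_paths S (p +++ q) r}),
      one = path_class S (\<lambda>_. x)\<rparr>"

text \<open>The set argument is the codomain.\<close>

definition pi1_induced ::
  "'b::topological_space set \<Rightarrow> ('a \<Rightarrow> 'b) \<Rightarrow> (real \<Rightarrow> 'a) set \<Rightarrow> (real \<Rightarrow> 'b) set" where
  "pi1_induced S f A = {q. \<exists>p\<in>A. homotopic_paths S (f \<circ> p) q}"

text \<open>For a path \<open>\<gamma>\<close> from \<open>x\<close> to \<open>y\<close>, this is the isomorphism from the fundamental group
  at \<open>y\<close> to the one at \<open>x\<close>.\<close>

definition pi1_change_base ::
  "'a::topological_space set \<Rightarrow> (real \<Rightarrow> 'a) \<Rightarrow> (real \<Rightarrow> 'a) set \<Rightarrow> (real \<Rightarrow> 'a) set" where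
  "pi1_change_base S \<gamma> A = {q. \<exists>p\<in>A. homotopic_paths S (\<gamma> +++ p +++ reversepath \<gamma>) q}"

text \<open>A letter \<open>(g, True)\<close> stands for \<open>g\<close>, a letter \<open>(g, False)\<close> for its inverse.\<close>

definition word_value :: "('a, 'm) monoid_scheme \<Rightarrow> ('a \<times> bool) list \<Rightarrow> 'a" where
  "word_value G ws =
     foldr (\<lambda>(g, e) h. (if e then g else inv\<^bsub>G\<^esub> g) \<otimes>\<^bsub>G\<^esub> h) ws \<one>\<^bsub>G\<^esub>"

definition reduced_word :: "('a \<times> bool) list \<Rightarrow> bool" where
  "reduced_word ws \<longleftrightarrow> successively (\<lambda>x y. \<not> (fst x = fst y \<and> snd x \<noteq> snd y)) ws"

definition free_on :: "('a, 'm) monoid_scheme \<Rightarrow> 'a set \<Rightarrow> bool" where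
  "free_on G S \<longleftrightarrow>
     group G \<and> S \<subseteq> carrier G \<and> generate G S = carrier G \<and>
     (\<forall>ws. ws \<noteq> [] \<and> fst ` set ws \<subseteq> S \<and> reduced_word ws \<longrightarrow> word_value G ws \<noteq> \<one>\<^bsub>G\<^esub>)"

abbreviation Z2 :: "(int \<times> int) monoid" where
  "Z2 \<equiv> integer_group \<times>\<times> integer_group"

type_synonym C2 = "complex \<times> complex"

definition torus :: "C2 set" where
  "torus = sphere 0 1 \<times> sphere 0 1"

definition conf2_torus :: "(C2 \<times> C2) set" where
  "conf2_torus = {(y1, y2). y1 \<in> torus \<and> y2 \<in> torus \<and> y1 \<noteq> y2}"

definition is_lift :: "(C2 \<Rightarrow> C2 set) \<Rightarrow> (C2 \<Rightarrow> C2 \<times> C2) \<Rightarrow> bool" where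
  "is_lift \<phi> \<Phi> \<longleftrightarrow>
     continuous_on torus \<Phi> \<and> \<Phi> ` torus \<subseteq> conf2_torus \<and>
     (\<forall>x\<in>torus. \<phi> x = {fst (\<Phi> x), snd (\<Phi> x)})"

definition meridian :: "C2 \<Rightarrow> real \<Rightarrow> C2" where
  "meridian z t = (fst z * cis (2 * pi * t), snd z)"

definition longitude :: "C2 \<Rightarrow> real \<Rightarrow> C2" where
  "longitude z t = (fst z, snd z * cis (2 * pi * t))"

abbreviation e1 :: "C2 \<Rightarrow> (real \<Rightarrow> C2) set" where
  "e1 z \<equiv> path_class torus (meridian z)"

abbreviation e2 :: "C2 \<Rightarrow> (real \<Rightarrow> C2) set" where
  "e2 z \<equiv> path_class torus (longitude z)"

abbreviation P2 :: "C2 \<Rightarrow> C2 \<Rightarrow> (real \<Rightarrow> C2 \<times> C2) set monoid" where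
  "P2 x1 x2 \<equiv> fundamental_group conf2_torus (x1, x2)"

text \<open>The kernel of the second projection on \<open>P2\<close>, realised as the fundamental group of the
  fibre over \<open>x2\<close>, and its inclusion into \<open>P2\<close>.\<close>

abbreviation fibre_group :: "C2 \<Rightarrow> C2 \<Rightarrow> (real \<Rightarrow> C2) set monoid" where
  "fibre_group x1 x2 \<equiv> fundamental_group (torus - {x2}) x1"

definition fibre_incl :: "C2 \<Rightarrow> (real \<Rightarrow> C2) set \<Rightarrow> (real \<Rightarrow> C2 \<times> C2) set" where
  "fibre_incl x2 = pi1_induced conf2_torus (\<lambda>z. (z, x2))"

definition fibre_basis ::
  "C2 \<Rightarrow> C2 \<Rightarrow> (real \<Rightarrow> C2) set \<Rightarrow> (real \<Rightarrow> C2) set \<Rightarrow> bool" where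
  "fibre_basis x1 x2 u v \<longleftrightarrow>
     u \<noteq> v \<and> free_on (fibre_group x1 x2) {u, v} \<and>
     pi1_induced torus fst (fibre_incl x2 u) = e1 x1 \<and>
     pi1_induced torus fst (fibre_incl x2 v) = e2 x1"

definition central_x :: "C2 \<Rightarrow> C2 \<Rightarrow> (real \<Rightarrow> C2 \<times> C2) set" where
  "central_x x1 x2 = path_class conf2_torus (\<lambda>t. (meridian x1 t, meridian x2 t))"

definition central_y :: "C2 \<Rightarrow> C2 \<Rightarrow> (real \<Rightarrow> C2 \<times> C2) set" where
  "central_y x1 x2 = path_class conf2_torus (\<lambda>t. (longitude x1 t, longitude x2 t))"

text \<open>The element of \<open>P2\<close> written \<open>(w, (a, b))\<close>.\<close>

definition P2_elem ::
  "C2 \<Rightarrow> C2 \<Rightarrow> (real \<Rightarrow> C2) set \<Rightarrow> int \<times> int \<Rightarrow> (real \<Rightarrow> C2 \<times> C2) set" where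
  "P2_elem x1 x2 w ab =
     fibre_incl x2 w \<otimes>\<^bsub>P2 x1 x2\<^esub> central_x x1 x2 [^]\<^bsub>P2 x1 x2\<^esub> fst ab
       \<otimes>\<^bsub>P2 x1 x2\<^esub> central_y x1 x2 [^]\<^bsub>P2 x1 x2\<^esub> snd ab"

definition abelianisation ::
  "C2 \<Rightarrow> C2 \<Rightarrow> (real \<Rightarrow> C2) set \<Rightarrow> (real \<Rightarrow> C2) set
     \<Rightarrow> ((real \<Rightarrow> C2) set \<Rightarrow> int \<times> int) \<Rightarrow> bool" where
  "abelianisation x1 x2 u v Ab \<longleftrightarrow>
     Ab \<in> hom (fibre_group x1 x2) Z2 \<and> Ab u = (1, 0) \<and> Ab v = (0, 1)"

text \<open>Dold's fixed point index of \<open>g\<close> on an open subset \<open>V\<close> of a Euclidean space \<open>E\<close> of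
  dimension \<open>n\<close>, where \<open>K\<close>, the set of fixed points of \<open>g\<close> in \<open>V\<close>, is compact.
  A generator of the homology \<open>H\<^sub>n(E, E - 0)\<close> comes from a class \<open>\<beta>\<close> in \<open>H\<^sub>n(E, E - B)\<close> for a ball
  \<open>B\<close> around the origin that contains \<open>K\<close>; restricting \<open>\<beta>\<close> to \<open>H\<^sub>n(E, E - K)\<close> and excising gives
  the fundamental class \<open>\<kappa>\<close> in \<open>H\<^sub>n(V, V - K)\<close>. The index \<open>k\<close> is determined by the image of
  \<open>\<kappa>\<close> under \<open>x \<mapsto> x - g x\<close>, and does not depend on the choice of the generator.\<close>

definition euclidean_fixpoint_index ::
  "'a::euclidean_space set \<Rightarrow> ('a \<Rightarrow> 'a) \<Rightarrow> int" where
  "euclidean_fixpoint_index V g =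
     (let n = int DIM('a);
          K = {x\<in>V. g x = x};
          G = relative_homology_group n (euclidean :: 'a topology) (- {0})
      in THE k. \<exists>\<omega> R \<beta> \<kappa>.
           \<omega> \<in> carrier G \<and> generate G {\<omega>} = carrier G \<and>
           R > 0 \<and> K \<subseteq> cball 0 R \<and>
           \<beta> \<in> carrier (relative_homology_group n euclidean (- cball 0 R)) \<and>
           hom_induced n euclidean (- cball 0 R) euclidean (- {0}) id \<beta> = \<omega> \<and>
           \<kappa> \<in> carrier (relative_homology_group n (top_of_set V) (V - K)) \<and>
           hom_induced n (top_of_set V) (V - K) euclidean (- K) id \<kappa> =
             hom_induced n euclidean (- cball 0 R) euclidean (- K) id \<beta> \<and>
           hom_induced n (top_of_set V) (V - K) euclidean (- {0}) (\<lambda>x. x - g x) \<kappa> = \<omega> [^]\<^bsub>G\<^esub> k)"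

text \<open>The torus is a retract, via \<open>torus_retraction\<close>, of the open subset \<open>torus_nbhd\<close> of a
  Euclidean space. The index of a map \<open>f\<close> of the torus on a set \<open>C\<close> of fixed points that is open
  and closed in the fixed point set of \<open>f\<close> is the index of \<open>f \<circ> torus_retraction\<close> on an open
  set whose only fixed points are those in \<open>C\<close>.\<close>

definition torus_nbhd :: "C2 set" where
  "torus_nbhd = {(z, w). z \<noteq> 0 \<and> w \<noteq> 0}"

definition torus_retraction :: "C2 \<Rightarrow> C2" where
  "torus_retraction x = (sgn (fst x), sgn (snd x))"

lemma open_torus_nbhd: "open torus_nbhd"
proof -
  have "torus_nbhd = (- {0}) \<times> (- {0})"
    by (auto simp: torus_nbhd_def)
  moreover have "open (- {0::complex})"
    by (rule open_Compl) simp
  ultimately show ?thesis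
    by (metis open_Times)
qed

lemma retraction_torus: "retraction torus_nbhd torus torus_retraction"
  unfolding retraction_def torus_def torus_nbhd_def torus_retraction_def
  by (auto intro!: continuous_intros simp: sgn_eq norm_divide)

definition torus_fixpoint_index :: "(C2 \<Rightarrow> C2) \<Rightarrow> C2 set \<Rightarrow> int" where
  "torus_fixpoint_index f C =
     euclidean_fixpoint_index (torus_nbhd - ({x\<in>torus. f x = x} - C)) (f \<circ> torus_retraction)"

text \<open>A fixed point class of a split map is a set of fixed points of exactly one of the two maps
  of the splitting, and its index is taken with respect to that map.\<close>

definition split_class_index :: "(C2 \<Rightarrow> C2 set) \<Rightarrow> C2 set \<Rightarrow> int" where
  "split_class_index \<phi> C =
     (THE k. \<exists>f g. splitting torus torus \<phi> f g \<and> C \<subseteq> {x\<in>torus. f x = x} \<and>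
                   k = torus_fixpoint_index f C)"

definition Nielsen_number :: "(C2 \<Rightarrow> C2 set) \<Rightarrow> nat" where
  "Nielsen_number \<phi> = card {C \<in> fixpoint_classes torus \<phi>. split_class_index \<phi> C \<noteq> 0}"

end

theory Submission
  imports Defs "HOL-Complex_Analysis.Winding_Numbers"
begin

text \<open>A self-map of the torus lifts to a map \<open>F\<close> of the plane with \<open>F (\<theta> + k) = F \<theta> + A k\<close> for integral
  \<open>k\<close>, where \<open>A\<close> is the matrix of the map on the fundamental group, and its fixed point classes
  correspond to the cosets of \<open>(A - 1) \<int>\<^sup>2\<close> in \<open>\<int>\<^sup>2\<close> via \<open>F \<theta> - \<theta>\<close>. The straight-line homotopy from \<open>F\<close>
  to an affine map with linear part \<open>A\<close> preserves the index of each class. If \<open>det (A - 1)\<close> is not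
  zero, every class of the affine map is a single nondegenerate fixed point, hence of nonzero index;
  otherwise a suitable translate of \<open>A\<close> has no fixed points modulo \<open>\<int>\<^sup>2\<close>. So there are
  \<open>\<bar>det (A - 1)\<bar>\<close> essential classes, and the map deforms to a fixed point free one iff
  this determinant vanishes.

  The two components of \<open>\<phi>\<close> have no coincidences, so the classes of \<open>\<phi>\<close> are those of \<open>f1\<close> and \<open>f2\<close>.
  Projecting the given elements of the pure braid group to the torus yields both matrices; only
  the abelianisation of \<open>w\<close> survives. A deformation of \<open>\<phi>\<close> is a double covering of the cylinder over
  the torus, so it deforms \<open>f1\<close> and \<open>f2\<close> as well.\<close>

subsection \<open>The fixed point index in Euclidean space\<close>

text \<open>The index of a class is read off in a four-dimensional open set:
  \<open>torus_nbhd\<close> with the fixed points outside the class removed. Under a homotopy these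
  removed points move, so homotopy invariance on one fixed domain does not apply; what is needed is
  invariance for a family whose fixed points split into two disjoint compact parts. The Nielsen
  number only asks whether an index vanishes, so no sign is computed: at a nondegenerate fixed point
  the displacement acts isomorphically on local homology, and an index 0 would make a generator of
  an infinite cyclic group trivial. The second obstacle is that angles on the torus come from the
  principal branch of the logarithm and jump along a cut. The jumps are lattice vectors, so every
  construction is arranged to be invariant under them: lifts are equivariant, and sets of
  displacements are unions of cosets of \<open>(A - 1)\<close> applied to the lattice.\<close>

lemma contractible_space_euclidean: "contractible_space (euclidean :: 'a::real_normed_vector topology)"
  using contractible_space_top_of_set[of "UNIV :: 'a set"] contractible_UNIV by simp

text \<open>Euclidean space is contractible, so the boundary map identifies this group with the
  reduced homology of the punctured space one degree lower. That space is homotopy equivalent to the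
  unit sphere, whose reduced homology in its own dimension is infinite cyclic.\<close>

lemma isomorphic_relative_homology_punctured_euclidean:
  "relative_homology_group (int DIM('a)) euclidean (- {0::'a::euclidean_space}) \<cong> integer_group"
proof -
  let ?n = "int DIM('a)"
  have ne: "- {0::'a} \<noteq> {}"
    by (metis Compl_iff empty_iff nonempty_Basis nonzero_Basis singletonD subsetI subset_empty)
  have 1: "relative_homology_group ?n euclidean (- {0::'a}) \<cong>
      reduced_homology_group (?n - 1) (top_of_set (- {0::'a}))"
    using isomorphic_group_relative_homology_of_contractible[OF contractible_space_euclidean, of "- {0::'a}" ?n] ne
    by simp
  have 2: "reduced_homology_group (?n - 1) (top_of_set (- {0::'a})) \<cong>
      reduced_homology_group (?n - 1) (top_of_set (sphere (0::'a) 1))"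
  proof (rule homotopy_equivalent_space_imp_isomorphic_reduced_homology_groups)
    have "top_of_set (rel_frontier (cball (0::'a) 1)) homotopy_equivalent_space
        top_of_set (affine hull cball (0::'a) 1 - {0})"
      by (rule homotopy_eqv_rel_frontier_punctured_affine_hull) (auto simp: rel_interior_nonempty_interior)
    moreover have "affine hull cball (0::'a) 1 = UNIV"
      by (simp add: affine_hull_nonempty_interior)
    moreover have "rel_frontier (cball (0::'a) 1) = sphere 0 1"
      by (simp add: rel_frontier_cball)
    ultimately have "top_of_set (sphere (0::'a) 1) homotopy_equivalent_space top_of_set (UNIV - {0::'a})"
      by simp
    then show "top_of_set (- {0::'a}) homotopy_equivalent_space top_of_set (sphere (0::'a) 1)"
      unfolding Compl_eq_Diff_UNIV by (subst homotopy_equivalent_space_sym)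
  qed
  have 3: "reduced_homology_group (?n - 1) (top_of_set (sphere (0::'a) 1)) \<cong>
      reduced_homology_group (?n - 1) (nsphere (DIM('a) - 1))"
  proof (rule homeomorphic_space_imp_isomorphic_reduced_homology_groups)
    obtain f :: "(nat \<Rightarrow> real) \<Rightarrow> 'a" and g where
      "homeomorphic_maps (nsphere (DIM('a) - 1)) (top_of_set (sphere 0 1 \<inter> span Basis)) f g"
      using homeomorphic_maps_nsphere_euclidean_sphere[where B = "Basis::'a set",
          OF independent_Basis orthogonal_Basis refl _ norm_Basis] by auto
    then have "nsphere (DIM('a) - 1) homeomorphic_space top_of_set (sphere (0::'a) 1)"
      by (auto simp: homeomorphic_space_def)
    then show "top_of_set (sphere (0::'a) 1) homeomorphic_space nsphere (DIM('a) - 1)"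
      by (subst homeomorphic_space_sym)
  qed
  have 4: "reduced_homology_group (?n - 1) (nsphere (DIM('a) - 1)) \<cong> integer_group"
    using reduced_homology_group_nsphere(1)[of "DIM('a) - 1"]
    by (simp add: of_nat_diff Suc_leI)
  show ?thesis
    by (rule iso_trans[OF 1 iso_trans[OF 2 iso_trans[OF 3 4]]])
qed

text \<open>These facts give existence and uniqueness of the exponent \<open>k\<close> in the
  definition of the index. An isomorphism \<open>h\<close> to the integers turns powers of
  \<open>\<omega>\<close> into multiples of \<open>h \<omega>\<close>, which is nonzero because 1
  has a preimage.\<close>

lemma infinite_cyclic_generator:
  assumes "group G" "G \<cong> integer_group"
    and \<omega>: "\<omega> \<in> carrier G" "generate G {\<omega>} = carrier G"
  shows "\<And>x. x \<in> carrier G \<Longrightarrow> \<exists>k::int. x = \<omega> [^]\<^bsub>G\<^esub> k"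
    and "\<And>i j::int. \<omega> [^]\<^bsub>G\<^esub> i = \<omega> [^]\<^bsub>G\<^esub> j \<Longrightarrow> i = j"
proof -
  interpret G: group G by fact
  show pow: "\<exists>k::int. x = \<omega> [^]\<^bsub>G\<^esub> k" if "x \<in> carrier G" for x
    using that G.generate_pow[OF \<omega>(1)] \<omega>(2) by auto
  obtain h where h: "h \<in> iso G integer_group"
    using assms(2) by (auto simp: is_iso_def)
  have hpow: "h (\<omega> [^]\<^bsub>G\<^esub> k) = k * h \<omega>" for k :: int
    using hom_int_pow[of h G integer_group \<omega> k] h \<omega> assms(1)
    by (auto simp: iso_def)
  have "h ` carrier G = UNIV"
    using h by (auto simp: iso_def bij_betw_def)
  then obtain x where "x \<in> carrier G" "h x = 1"
    by (metis UNIV_I imageE)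
  then have "h \<omega> \<noteq> 0"
    using pow hpow by fastforce
  then show "i = j" if "\<omega> [^]\<^bsub>G\<^esub> i = \<omega> [^]\<^bsub>G\<^esub> j" for i j :: int
    using that hpow by (metis mult_right_cancel)
qed

lemma iso_of_commuting_square:
  assumes i: "i \<in> iso A' B'" and a: "a \<in> iso A A'" and b: "b \<in> iso B B'"
    and eq: "b \<circ> f = i \<circ> a" and f: "f \<in> hom A B"
  shows "f \<in> iso A B"
proof -
  have "bij_betw (i \<circ> a) (carrier A) (carrier B')"
    by (rule bij_betw_trans[where B = "carrier A'"]) (use i a in \<open>simp_all add: iso_def\<close>)
  then have "bij_betw (b \<circ> f) (carrier A) (carrier B')"
    by (simp only: eq)
  moreover have "bij_betw b (carrier B) (carrier B')"
    using b by (simp add: iso_def)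
  moreover have "f ` carrier A \<subseteq> carrier B"
    using f by (auto simp: hom_def)
  ultimately have "bij_betw f (carrier A) (carrier B)"
    using bij_betw_comp_iff2 by metis
  with f show ?thesis by (simp add: iso_def)
qed

text \<open>By naturality of the boundary map it is enough that the inclusion of \<open>- S\<close>
  into \<open>- {p}\<close> is a homotopy equivalence. A homotopy inverse pushes all points radially
  away from \<open>p\<close>. Below, \<open>S\<close> is always a ball about the origin, but
  \<open>p\<close> need not be its centre.\<close>

lemma iso_relative_homology_complement_convex:
  fixes S :: "'a::euclidean_space set"
  assumes "convex S" "bounded S" "p \<in> S"
  shows "hom_induced q euclidean (- S) euclidean (- {p}) id
    \<in> iso (relative_homology_group q euclidean (- S)) (relative_homology_group q euclidean (- {p}))"
proof -
  obtain R where R: "\<And>x. x \<in> S \<Longrightarrow> norm (x - p) \<le> R" "R > 0"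
  proof -
    obtain B where "\<And>x. x \<in> S \<Longrightarrow> norm x \<le> B" "B > 0"
      using \<open>bounded S\<close> bounded_pos by metis
    then have "norm (x - p) \<le> B + B" if "x \<in> S" for x
      using norm_triangle_ineq4[of x p] \<open>\<And>x. x \<in> S \<Longrightarrow> norm x \<le> B\<close>[OF that]
        \<open>\<And>x. x \<in> S \<Longrightarrow> norm x \<le> B\<close>[OF assms(3)] by linarith
    then show ?thesis using \<open>B > 0\<close> by (intro that[of "B + B"]) auto
  qed
  have neS: "- S \<noteq> {}"
    using assms(2) by (metis Compl_UNIV_eq double_compl not_bounded_UNIV)
  have nep: "- {p} \<noteq> {}"
  proof -
    obtain x where "x \<in> - S" using neS by (meson ex_in_conv)
    then have "x \<in> - {p}" using assms(3) by auto
    then show ?thesis by (metis empty_iff)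
  qed
  \<comment> \<open>\<open>push t\<close> increases the distance from \<open>p\<close> by
    \<open>2 * R * t\<close>. As \<open>S\<close> lies within distance \<open>R\<close> of
    \<open>p\<close>, time 1 moves every point other than \<open>p\<close> out of
    \<open>S\<close>.\<close>
  define push where "push = (\<lambda>t x. p + (1 + t * (2 * R) / norm (x - p)) *\<^sub>R (x - p))"
  have push_ne: "push t x \<in> - {p}" if "x \<noteq> p" "t \<ge> 0" for t x
  proof -
    have "1 + t * (2 * R) / norm (x - p) > 0"
      using that R by (intro add_pos_nonneg) auto
    then show ?thesis using that by (auto simp: push_def)
  qed
  \<comment> \<open>The point \<open>x\<close> lies on the segment from \<open>p\<close> to
    \<open>push t x\<close>, so by convexity a pushed point inside \<open>S\<close> would force
    \<open>x\<close> into \<open>S\<close>.\<close>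
  have push_S: "push t x \<in> - S" if "x \<notin> S" "t \<ge> 0" for t x
  proof
    assume *: "push t x \<in> S"
    define l where "l = 1 + t * (2 * R) / norm (x - p)"
    have l: "l \<ge> 1" using that R by (auto simp: l_def)
    have "(1/l) *\<^sub>R push t x = (1/l) *\<^sub>R p + (x - p)"
      using l by (simp add: push_def l_def[symmetric] scaleR_right_distrib)
    then have "x = (1 - 1/l) *\<^sub>R p + (1/l) *\<^sub>R push t x"
      by (simp add: algebra_simps)
    moreover have "(1 - 1/l) *\<^sub>R p + (1/l) *\<^sub>R push t x \<in> S"
      using l assms * by (intro convexD) auto
    ultimately show False using that by simp
  qed
  have push1: "push 1 x \<in> - S" if "x \<noteq> p" for x
  proof
    assume "push 1 x \<in> S"
    then have "norm (push 1 x - p) \<le> R" using R by blast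
    moreover have "norm (push 1 x - p) = norm (x - p) + 2 * R"
    proof -
      have "1 + 2 * R / norm (x - p) > 0" using R by (intro add_pos_nonneg) auto
      then have "norm (push 1 x - p) = (1 + 2 * R / norm (x - p)) * norm (x - p)"
        by (simp add: push_def)
      also have "\<dots> = norm (x - p) + 2 * R"
        using that by (simp add: distrib_right)
      finally show ?thesis .
    qed
    ultimately show False using R by (smt (verit) norm_ge_zero)
  qed
  have cont: "continuous_on ({0..1} \<times> (- {p})) (\<lambda>z. push (fst z) (snd z))"
    unfolding push_def by (intro continuous_intros) auto
  have push0: "push 0 x = x" for x by (simp add: push_def)
  have Sp: "- S \<subseteq> - {p}" using assms by auto
  have hom1: "homotopic_with_canon (\<lambda>h. True) (- {p}) (- {p}) id (push 1)"
    unfolding homotopic_with_def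
  proof (intro exI conjI ballI allI)
    show "continuous_map (prod_topology (top_of_set {0..1}) (top_of_set (- {p}))) (top_of_set (- {p}))
        (\<lambda>z. push (fst z) (snd z))"
      using cont push_ne by (simp add: Pi_iff)
  qed (use push0 in auto)
  have hom2: "homotopic_with_canon (\<lambda>h. True) (- S) (- S) id (push 1)"
    unfolding homotopic_with_def
  proof (intro exI conjI ballI allI)
    have "continuous_on ({0..1} \<times> (- S)) (\<lambda>z. push (fst z) (snd z))"
      by (rule continuous_on_subset[OF cont]) (use Sp in auto)
    then show "continuous_map (prod_topology (top_of_set {0..1}) (top_of_set (- S))) (top_of_set (- S))
        (\<lambda>z. push (fst z) (snd z))"
      using push_S by (simp add: Pi_iff)
  qed (use push0 in auto)
  have cp: "continuous_on (- {p}) (push 1)"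
    using homotopic_with_imp_continuous[OF hom1] by simp
  let ?i = "hom_induced (q - 1) (top_of_set (- S)) {} (top_of_set (- {p})) {} id"
  have 1: "?i \<in> iso (reduced_homology_group (q - 1) (top_of_set (- S)))
      (reduced_homology_group (q - 1) (top_of_set (- {p})))"
  proof (rule homotopy_equivalence_reduced_homology_group_isomorphism[where g = "push 1"])
    show "continuous_map (top_of_set (- S)) (top_of_set (- {p})) id"
      using Sp by auto
    show "continuous_map (top_of_set (- {p})) (top_of_set (- S)) (push 1)"
      using cp push1 by (simp add: Pi_iff)
    show "homotopic_with_canon (\<lambda>h. True) (- S) (- S) (push 1 \<circ> id) id"
      using homotopic_with_symD[OF hom2] by simp
    show "homotopic_with_canon (\<lambda>h. True) (- {p}) (- {p}) (id \<circ> push 1) id"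
      using homotopic_with_symD[OF hom1] by simp
  qed
  have 2: "hom_boundary q euclidean (- S) \<in> iso (relative_homology_group q euclidean (- S))
      (reduced_homology_group (q - 1) (top_of_set (- S)))"
    using iso_relative_homology_of_contractible[OF contractible_space_euclidean, of "- S" q] neS
    by simp
  have 3: "hom_boundary q euclidean (- {p}) \<in> iso (relative_homology_group q euclidean (- {p}))
      (reduced_homology_group (q - 1) (top_of_set (- {p})))"
    using iso_relative_homology_of_contractible[OF contractible_space_euclidean, of "- {p}" q] nep
    by simp
  have 4: "hom_boundary q euclidean (- {p}) \<circ> hom_induced q euclidean (- S) euclidean (- {p}) id
      = ?i \<circ> hom_boundary q euclidean (- S)"
    by (rule naturality_hom_induced) (use Sp in \<open>simp_all add: subset_iff Pi_iff\<close>)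
  show ?thesis
    by (rule iso_of_commuting_square[OF 1 2 3 4 hom_induced_hom])
qed

text \<open>Excision of \<open>- V\<close>, a closed set contained in the open set
  \<open>- K\<close>.\<close>

lemma iso_excision_open:
  fixes V K :: "'a::euclidean_space set"
  assumes "open V" "closed K" "K \<subseteq> V"
  shows "hom_induced q (top_of_set V) (V - K) euclidean (- K) id
    \<in> iso (relative_homology_group q (top_of_set V) (V - K)) (relative_homology_group q euclidean (- K))"
proof -
  have "euclidean closure_of (- V) \<subseteq> euclidean interior_of (- K)"
    using assms by (simp add: closure_closed interior_open open_Compl closed_Compl)
  from homology_excision_axiom[OF this, of UNIV q] show ?thesis
    using assms by (simp add: Compl_eq_Diff_UNIV[symmetric] Diff_eq Int_commute)
qed

lemma iso_image_carrier: "f \<in> iso A B \<Longrightarrow> f ` carrier A = carrier B"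
  by (simp add: iso_def bij_betw_def)

lemma iso_inj_on_carrier: "f \<in> iso A B \<Longrightarrow> inj_on f (carrier A)"
  by (simp add: iso_def bij_betw_def)

lemma hom_induced_id_compose:
  "S' \<subseteq> S \<Longrightarrow> S \<subseteq> T \<Longrightarrow>
    hom_induced p X S X T id (hom_induced p X S' X S id x) = hom_induced p X S' X T id x"
  using hom_induced_compose'[of X X id S' S X id T p x] by (simp add: Pi_iff subset_iff)

lemmas punctured_euclidean_generator = infinite_cyclic_generator[OF group_relative_homology_group
  isomorphic_relative_homology_punctured_euclidean]

text \<open>The fundamental class \<open>\<kappa>\<close> along \<open>K\<close> in the definition of the index does not depend on the
  map, only on the set \<open>K\<close>.\<close>

definition fundamental_class ::
  "'a::euclidean_space set \<Rightarrow> 'a set \<Rightarrow> 'a chain set \<Rightarrow> real \<Rightarrow> 'a chain set \<Rightarrow> 'a chain set \<Rightarrow> bool" where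
  "fundamental_class V K \<omega> R \<beta> \<kappa> \<longleftrightarrow>
     (let n = int DIM('a); G = relative_homology_group n (euclidean :: 'a topology) (- {0}) in
       \<omega> \<in> carrier G \<and> generate G {\<omega>} = carrier G \<and>
       R > 0 \<and> K \<subseteq> cball 0 R \<and>
       \<beta> \<in> carrier (relative_homology_group n euclidean (- cball 0 R)) \<and>
       hom_induced n euclidean (- cball 0 R) euclidean (- {0}) id \<beta> = \<omega> \<and>
       \<kappa> \<in> carrier (relative_homology_group n (top_of_set V) (V - K)) \<and>
       hom_induced n (top_of_set V) (V - K) euclidean (- K) id \<kappa> =
         hom_induced n euclidean (- cball 0 R) euclidean (- K) id \<beta>)"

abbreviation displacement_hom :: "'a::euclidean_space set \<Rightarrow> ('a \<Rightarrow> 'a) \<Rightarrow> 'a chain set \<Rightarrow> 'a chain set" where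
  "displacement_hom V g \<equiv>
    hom_induced (int DIM('a)) (top_of_set V) (V - {x\<in>V. g x = x}) euclidean (- {0}) (\<lambda>x. x - g x)"

lemma euclidean_fixpoint_index_eq:
  fixes V :: "'a::euclidean_space set"
  shows "euclidean_fixpoint_index V g = (THE k. \<exists>\<omega> R \<beta> \<kappa>.
     fundamental_class V {x\<in>V. g x = x} \<omega> R \<beta> \<kappa> \<and>
     displacement_hom V g \<kappa> =
       \<omega> [^]\<^bsub>relative_homology_group (int DIM('a)) (euclidean :: 'a topology) (- {0})\<^esub> k)"
  unfolding euclidean_fixpoint_index_def fundamental_class_def Let_def
  by (simp only: conj_assoc)

text \<open>Restriction from \<open>- cball 0 R\<close> to \<open>- {0}\<close> and excision to
  \<open>V\<close> are both isomorphisms, so a generator \<open>\<omega>\<close> has a preimage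
  \<open>\<beta>\<close>, and the image of \<open>\<beta>\<close> along \<open>K\<close> has a
  preimage \<open>\<kappa>\<close>.\<close>

lemma fundamental_class_exists:
  fixes V K :: "'a::euclidean_space set"
  assumes "open V" "compact K" "K \<subseteq> V"
  obtains \<omega> R \<beta> \<kappa> where "fundamental_class V K \<omega> R \<beta> \<kappa>"
proof -
  let ?n = "int DIM('a)"
  let ?G = "relative_homology_group ?n (euclidean :: 'a topology) (- {0})"
  obtain R where R: "R > 0" "K \<subseteq> cball 0 R"
    using compact_imp_bounded[OF assms(2)] bounded_pos by (metis mem_cball_0 subsetI)
  obtain h where h: "h \<in> iso integer_group ?G"
    using group.iso_sym[OF _ isomorphic_relative_homology_punctured_euclidean]
      group_relative_homology_group by (auto simp: is_iso_def)
  define \<omega> where "\<omega> = h 1"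
  have \<omega>: "\<omega> \<in> carrier ?G"
    using h by (auto simp: \<omega>_def iso_def hom_def)
  have "carrier ?G \<subseteq> generate ?G {\<omega>}"
  proof
    fix x assume "x \<in> carrier ?G"
    then obtain k where "x = h k"
      using h by (auto simp: iso_def bij_betw_def)
    also have "h k = \<omega> [^]\<^bsub>?G\<^esub> k"
      using hom_int_pow[of h integer_group ?G 1 k] h by (simp add: \<omega>_def iso_def)
    finally show "x \<in> generate ?G {\<omega>}"
      using group.generate_pow[OF group_relative_homology_group \<omega>] by auto
  qed
  moreover have "generate ?G {\<omega>} \<subseteq> carrier ?G"
    by (rule group.generate_incl[OF group_relative_homology_group]) (use \<omega> in simp)
  ultimately have gen: "generate ?G {\<omega>} = carrier ?G"
    by (rule equalityI[rotated])
  have "hom_induced ?n euclidean (- cball 0 R) euclidean (- {0::'a}) id ` carrier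
      (relative_homology_group ?n euclidean (- cball (0::'a) R)) = carrier ?G"
    by (rule iso_image_carrier[OF iso_relative_homology_complement_convex]) (use R in auto)
  with \<omega> have "\<omega> \<in> hom_induced ?n euclidean (- cball 0 R) euclidean (- {0::'a}) id ` carrier
      (relative_homology_group ?n euclidean (- cball (0::'a) R))"
    by (simp only:)
  then obtain \<beta> where \<beta>: "\<omega> = hom_induced ?n euclidean (- cball 0 R) euclidean (- {0}) id \<beta>"
    "\<beta> \<in> carrier (relative_homology_group ?n euclidean (- cball 0 R))"
    by (rule imageE)
  have "hom_induced ?n euclidean (- cball 0 R) euclidean (- K) id \<beta>
      \<in> hom_induced ?n (top_of_set V) (V - K) euclidean (- K) id `
        carrier (relative_homology_group ?n (top_of_set V) (V - K))"
    unfolding iso_image_carrier[OF iso_excision_open[OF assms(1) compact_imp_closed[OF assms(2)] assms(3)]]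
    by (rule hom_in_carrier[OF hom_induced_hom \<beta>(2)])
  then obtain \<kappa> where \<kappa>: "hom_induced ?n euclidean (- cball 0 R) euclidean (- K) id \<beta> =
      hom_induced ?n (top_of_set V) (V - K) euclidean (- K) id \<kappa>"
    "\<kappa> \<in> carrier (relative_homology_group ?n (top_of_set V) (V - K))"
    by (rule imageE)
  show thesis
    by (rule that[of \<omega> R \<beta> \<kappa>]) (use \<omega> gen R \<beta> \<kappa> in \<open>simp add: fundamental_class_def Let_def\<close>)
qed

text \<open>Two choices of data differ by one exponent \<open>e\<close>, the same for
  \<open>\<omega>\<close> and for \<open>\<kappa>\<close>; this is why the index is independent of
  the choice. Over a common large ball the relation between the generators passes to the classes
  \<open>\<beta>\<close> by injectivity, and from there to \<open>\<kappa>\<close> through excision.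
  That \<open>e\<close> is nonzero is what cancellation of exponents requires.\<close>

lemma fundamental_class_unique:
  fixes V K :: "'a::euclidean_space set"
  assumes "open V" "closed K" "K \<subseteq> V"
    and 1: "fundamental_class V K \<omega>1 R1 \<beta>1 \<kappa>1" and 2: "fundamental_class V K \<omega>2 R2 \<beta>2 \<kappa>2"
  obtains e :: int where "e \<noteq> 0"
    "\<omega>2 = \<omega>1 [^]\<^bsub>relative_homology_group (int DIM('a)) (euclidean :: 'a topology) (- {0})\<^esub> e"
    "\<kappa>2 = \<kappa>1 [^]\<^bsub>relative_homology_group (int DIM('a)) (top_of_set V) (V - K)\<^esub> e"
proof -
  let ?n = "int DIM('a)"
  let ?H = "\<lambda>S. relative_homology_group ?n (euclidean :: 'a topology) S"
  let ?HV = "relative_homology_group ?n (top_of_set V) (V - K)"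
  let ?i = "\<lambda>S T. hom_induced ?n (euclidean :: 'a topology) S euclidean T id"
  let ?iV = "hom_induced ?n (top_of_set V) (V - K) euclidean (- K) id"
  define R where "R = max R1 R2"
  have R: "R1 \<le> R" "R2 \<le> R" "R > 0"
    using 1 by (auto simp: R_def fundamental_class_def Let_def)
  have comp: "?i S T (?i S' S x) = ?i S' T x" if "S' \<subseteq> S" "S \<subseteq> T" for S T S' x
    using that by (rule hom_induced_id_compose)
  have isoR: "?i (- cball 0 R) (- {0}) \<in> iso (?H (- cball 0 R)) (?H (- {0}))"
    by (rule iso_relative_homology_complement_convex) (use R in auto)
  \<comment> \<open>The radius may be enlarged: \<open>\<beta>0\<close> is the restriction of a
    class over the larger ball, because both radii restrict isomorphically to
    \<open>- {0}\<close>.\<close>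
  have *: "\<exists>\<beta>. \<beta> \<in> carrier (?H (- cball 0 R)) \<and> ?i (- cball 0 R) (- {0}) \<beta> = \<omega> \<and>
      ?i (- cball 0 R) (- K) \<beta> = ?iV \<kappa>"
    if fc: "fundamental_class V K \<omega> r \<beta>0 \<kappa>" and "r \<le> R" for \<omega> r \<beta>0 \<kappa>
  proof -
    note fc' = fc[unfolded fundamental_class_def Let_def]
    have "r > 0" and \<beta>0: "\<beta>0 \<in> carrier (?H (- cball 0 r))" using fc' by auto
    have sub: "- cball 0 R \<subseteq> - cball (0::'a) r" "- cball (0::'a) r \<subseteq> - {0}" "- cball (0::'a) r \<subseteq> - K"
      using \<open>r > 0\<close> \<open>r \<le> R\<close> fc' by auto
    have isor: "?i (- cball 0 r) (- {0}) \<in> iso (?H (- cball 0 r)) (?H (- {0}))"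
      by (rule iso_relative_homology_complement_convex) (use \<open>r > 0\<close> in auto)
    have "?i (- cball 0 r) (- {0}) \<beta>0 \<in> ?i (- cball 0 R) (- {0}) ` carrier (?H (- cball 0 R))"
      unfolding iso_image_carrier[OF isoR] by (rule hom_in_carrier[OF hom_induced_hom \<beta>0])
    then obtain \<beta> where \<beta>: "?i (- cball 0 r) (- {0}) \<beta>0 = ?i (- cball 0 R) (- {0}) \<beta>"
      "\<beta> \<in> carrier (?H (- cball 0 R))"
      by (rule imageE)
    have "?i (- cball 0 r) (- {0}) (?i (- cball 0 R) (- cball 0 r) \<beta>) = ?i (- cball 0 r) (- {0}) \<beta>0"
      unfolding \<beta>(1) by (rule comp[OF sub(1,2)])
    then have "?i (- cball 0 R) (- cball 0 r) \<beta> = \<beta>0"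
      by (rule inj_onD[OF iso_inj_on_carrier[OF isor] _ hom_in_carrier[OF hom_induced_hom \<beta>(2)] \<beta>0])
    then show ?thesis
      using comp[OF sub(1,2), of \<beta>] comp[OF sub(1,3), of \<beta>] \<beta>(2) fc' by (intro exI[of _ \<beta>]) simp
  qed
  obtain b1 where b1: "b1 \<in> carrier (?H (- cball 0 R))" "?i (- cball 0 R) (- {0}) b1 = \<omega>1"
      "?i (- cball 0 R) (- K) b1 = ?iV \<kappa>1"
    using *[OF 1 R(1)] by blast
  obtain b2 where b2: "b2 \<in> carrier (?H (- cball 0 R))" "?i (- cball 0 R) (- {0}) b2 = \<omega>2"
      "?i (- cball 0 R) (- K) b2 = ?iV \<kappa>2"
    using *[OF 2 R(2)] by blast
  have g: "\<omega>1 \<in> carrier (?H (- {0}))" "generate (?H (- {0})) {\<omega>1} = carrier (?H (- {0}))"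
    "\<omega>2 \<in> carrier (?H (- {0}))" "generate (?H (- {0})) {\<omega>2} = carrier (?H (- {0}))"
    "\<kappa>1 \<in> carrier ?HV" "\<kappa>2 \<in> carrier ?HV"
    using 1 2 by (auto simp: fundamental_class_def Let_def)
  obtain e where e: "\<omega>2 = \<omega>1 [^]\<^bsub>?H (- {0})\<^esub> (e::int)"
    using punctured_euclidean_generator(1)[OF g(1,2,3)] by blast
  have "e \<noteq> 0"
  proof
    assume "e = 0"
    then have "\<omega>2 [^]\<^bsub>?H (- {0})\<^esub> (1::int) = \<omega>2 [^]\<^bsub>?H (- {0})\<^esub> (0::int)"
      using e g(3) by (simp add: group.int_pow_1)
    then have "(1::int) = 0" by (rule punctured_euclidean_generator(2)[OF g(3,4)])
    then show False by simp
  qed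
  have "?i (- cball 0 R) (- {0}) (b1 [^]\<^bsub>?H (- cball 0 R)\<^esub> e) = ?i (- cball 0 R) (- {0}) b2"
    using e b1 b2 by (simp add: hom_int_pow[OF hom_induced_hom])
  moreover have "inj_on (?i (- cball 0 R) (- {0})) (carrier (?H (- cball 0 R)))"
    using isoR by (rule iso_inj_on_carrier)
  ultimately have b2e: "b2 = b1 [^]\<^bsub>?H (- cball 0 R)\<^esub> e"
    using b1(1) b2(1) by (metis inj_onD group.int_pow_closed group_relative_homology_group)
  have "?iV \<kappa>2 = ?iV \<kappa>1 [^]\<^bsub>?H (- K)\<^esub> e"
    using b1 b2 b2e by (metis hom_int_pow[OF hom_induced_hom] group_relative_homology_group)
  also have "\<dots> = ?iV (\<kappa>1 [^]\<^bsub>?HV\<^esub> e)"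
    using g by (simp add: hom_int_pow[OF hom_induced_hom])
  finally have "?iV \<kappa>2 = ?iV (\<kappa>1 [^]\<^bsub>?HV\<^esub> e)" .
  moreover have "inj_on ?iV (carrier ?HV)"
    using iso_excision_open[OF assms(1,2,3)] by (rule iso_inj_on_carrier)
  ultimately have "\<kappa>2 = \<kappa>1 [^]\<^bsub>?HV\<^esub> e"
    using g by (metis inj_onD group.int_pow_closed group_relative_homology_group)
  with e \<open>e \<noteq> 0\<close> that show thesis by blast
qed

text \<open>Any one choice of the fundamental class computes the index. A second choice replaces
  \<open>\<kappa>\<close> and \<open>\<omega>\<close> by their \<open>e\<close>-th powers, and
  comparing exponents gives \<open>e * l = k * e\<close>.\<close>

lemma euclidean_fixpoint_index_eqI:
  fixes V :: "'a::euclidean_space set"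
  assumes "open V" "closed {x\<in>V. g x = x}"
    and fc: "fundamental_class V {x\<in>V. g x = x} \<omega> R \<beta> \<kappa>"
    and k: "displacement_hom V g \<kappa> =
       \<omega> [^]\<^bsub>relative_homology_group (int DIM('a)) (euclidean :: 'a topology) (- {0})\<^esub> k"
  shows "euclidean_fixpoint_index V g = k"
  unfolding euclidean_fixpoint_index_eq
proof (rule the_equality)
  show "\<exists>\<omega> R \<beta> \<kappa>. fundamental_class V {x\<in>V. g x = x} \<omega> R \<beta> \<kappa> \<and>
     displacement_hom V g \<kappa> =
       \<omega> [^]\<^bsub>relative_homology_group (int DIM('a)) (euclidean :: 'a topology) (- {0})\<^esub> k"
    using fc k by blast
next
  fix l :: int
  let ?G = "relative_homology_group (int DIM('a)) (euclidean :: 'a topology) (- {0})"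
  assume "\<exists>\<omega> R \<beta> \<kappa>. fundamental_class V {x\<in>V. g x = x} \<omega> R \<beta> \<kappa> \<and> displacement_hom V g \<kappa> = \<omega> [^]\<^bsub>?G\<^esub> l"
  then obtain \<omega>' R' \<beta>' \<kappa>' where fc': "fundamental_class V {x\<in>V. g x = x} \<omega>' R' \<beta>' \<kappa>'"
    and l: "displacement_hom V g \<kappa>' = \<omega>' [^]\<^bsub>?G\<^esub> l" by blast
  obtain e where e: "e \<noteq> 0" "\<omega>' = \<omega> [^]\<^bsub>?G\<^esub> (e::int)"
    "\<kappa>' = \<kappa> [^]\<^bsub>relative_homology_group (int DIM('a)) (top_of_set V) (V - {x\<in>V. g x = x})\<^esub> e"
    using fundamental_class_unique[OF assms(1,2) _ fc fc'] by blast
  have c: "\<omega> \<in> carrier ?G" "generate ?G {\<omega>} = carrier ?G"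
    "\<kappa> \<in> carrier (relative_homology_group (int DIM('a)) (top_of_set V) (V - {x\<in>V. g x = x}))"
    using fc by (auto simp: fundamental_class_def Let_def)
  have "\<omega> [^]\<^bsub>?G\<^esub> (e * l) = \<omega>' [^]\<^bsub>?G\<^esub> l"
    using e c by (simp add: group.int_pow_pow)
  also have "\<dots> = displacement_hom V g \<kappa> [^]\<^bsub>?G\<^esub> e"
    using l e c by (simp add: hom_int_pow[OF hom_induced_hom] flip: l)
  also have "\<dots> = \<omega> [^]\<^bsub>?G\<^esub> (k * e)"
    using c by (simp add: k group.int_pow_pow)
  finally have "e * l = k * e"
    by (rule punctured_euclidean_generator(2)[OF c(1,2)])
  then show "l = k" using e by simp
qed

text \<open>The definite description is attained, since every element of the target group is a power
  of \<open>\<omega>\<close>. This turns the definition of the index into an equation that can be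
  transported.\<close>

lemma euclidean_fixpoint_index_value:
  fixes V :: "'a::euclidean_space set"
  assumes "open V" "compact {x\<in>V. g x = x}"
    and fc: "fundamental_class V {x\<in>V. g x = x} \<omega> R \<beta> \<kappa>"
  shows "displacement_hom V g \<kappa> =
    \<omega> [^]\<^bsub>relative_homology_group (int DIM('a)) (euclidean :: 'a topology) (- {0})\<^esub> euclidean_fixpoint_index V g"
proof -
  let ?G = "relative_homology_group (int DIM('a)) (euclidean :: 'a topology) (- {0})"
  have c: "\<omega> \<in> carrier ?G" "generate ?G {\<omega>} = carrier ?G"
    "\<kappa> \<in> carrier (relative_homology_group (int DIM('a)) (top_of_set V) (V - {x\<in>V. g x = x}))"
    using fc by (auto simp: fundamental_class_def Let_def)
  have "displacement_hom V g \<kappa> \<in> carrier ?G"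
    by (rule hom_in_carrier[OF hom_induced_hom c(3)])
  then obtain k where k: "displacement_hom V g \<kappa> = \<omega> [^]\<^bsub>?G\<^esub> (k::int)"
    using punctured_euclidean_generator(1)[OF c(1,2)] by blast
  with euclidean_fixpoint_index_eqI[OF assms(1) compact_imp_closed[OF assms(2)] fc] show ?thesis
    by simp
qed

text \<open>Fundamental classes are compatible with enlarging the open set and shrinking the compact
  set. Hence one class serves all members of a homotopy, although their fixed point sets
  differ.\<close>

lemma fundamental_class_restrict:
  fixes U V :: "'a::euclidean_space set"
  assumes fc: "fundamental_class U K \<omega> R \<beta> \<kappa>" and "U \<subseteq> V" "L \<subseteq> K"
  shows "fundamental_class V L \<omega> R \<beta>
    (hom_induced (int DIM('a)) (top_of_set U) (U - K) (top_of_set V) (V - L) id \<kappa>)"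
proof -
  let ?n = "int DIM('a)"
  have K: "K \<subseteq> cball 0 R"
    using fc by (simp add: fundamental_class_def Let_def)
  let ?E = "euclidean :: 'a topology"
  have "hom_induced ?n (top_of_set V) (V - L) ?E (- L) id
      (hom_induced ?n (top_of_set U) (U - K) (top_of_set V) (V - L) id \<kappa>)
    = hom_induced ?n (top_of_set U) (U - K) ?E (- L) (id \<circ> id) \<kappa>"
    by (rule hom_induced_compose') (use assms in \<open>auto simp: continuous_map_in_subtopology\<close>)
  also have "\<dots> = hom_induced ?n ?E (- K) ?E (- L) id
      (hom_induced ?n (top_of_set U) (U - K) ?E (- K) id \<kappa>)"
    by (rule hom_induced_compose'[symmetric]) (use assms in \<open>auto simp: continuous_map_in_subtopology\<close>)
  also have "\<dots> = hom_induced ?n ?E (- K) ?E (- L) id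
      (hom_induced ?n ?E (- cball 0 R) ?E (- K) id \<beta>)"
    using fc by (simp add: fundamental_class_def Let_def)
  also have "\<dots> = hom_induced ?n ?E (- cball 0 R) ?E (- L) id \<beta>"
    by (rule hom_induced_id_compose) (use K assms in auto)
  finally have "hom_induced ?n (top_of_set V) (V - L) ?E (- L) id
      (hom_induced ?n (top_of_set U) (U - K) (top_of_set V) (V - L) id \<kappa>)
    = hom_induced ?n ?E (- cball 0 R) ?E (- L) id \<beta>" .
  moreover have "hom_induced ?n (top_of_set U) (U - K) (top_of_set V) (V - L) id \<kappa>
      \<in> carrier (relative_homology_group ?n (top_of_set V) (V - L))"
    by (rule hom_in_carrier[OF hom_induced_hom]) (use fc in \<open>simp add: fundamental_class_def Let_def\<close>)
  moreover have "L \<subseteq> cball 0 R" using K assms by auto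
  ultimately show ?thesis
    using fc by (simp add: fundamental_class_def Let_def)
qed

lemma hom_induced_displacement:
  fixes U V :: "'a::euclidean_space set"
  assumes "U \<subseteq> V" "continuous_on V g" "{x\<in>V. g x = x} \<subseteq> K"
  shows "hom_induced q (top_of_set V) (V - {x\<in>V. g x = x}) euclidean (- {0}) (\<lambda>x. x - g x)
      (hom_induced q (top_of_set U) (U - K) (top_of_set V) (V - {x\<in>V. g x = x}) id \<kappa>)
    = hom_induced q (top_of_set U) (U - K) euclidean (- {0}) (\<lambda>x. x - g x) \<kappa>"
proof -
  have "hom_induced q (top_of_set V) (V - {x\<in>V. g x = x}) euclidean (- {0}) (\<lambda>x. x - g x)
      (hom_induced q (top_of_set U) (U - K) (top_of_set V) (V - {x\<in>V. g x = x}) id \<kappa>)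
    = hom_induced q (top_of_set U) (U - K) euclidean (- {0}) ((\<lambda>x. x - g x) \<circ> id) \<kappa>"
    by (rule hom_induced_compose')
      (use assms in \<open>auto simp: continuous_map_in_subtopology intro!: continuous_intros\<close>)
  then show ?thesis by simp
qed

text \<open>Locality of the index: a fundamental class over \<open>U\<close> pushes forward to one
  over \<open>V\<close>, and the two displacements agree after composition with the
  inclusion.\<close>

lemma euclidean_fixpoint_index_restrict:
  fixes U V :: "'a::euclidean_space set"
  assumes "open V" "open U" "U \<subseteq> V" and comp: "compact {x\<in>V. g x = x}"
    and KU: "{x\<in>V. g x = x} \<subseteq> U" and g: "continuous_on V g"
  shows "euclidean_fixpoint_index V g = euclidean_fixpoint_index U g"
proof -
  have K: "{x\<in>U. g x = x} = {x\<in>V. g x = x}" using assms by auto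
  obtain \<omega> R \<beta> \<kappa> where fc: "fundamental_class U {x\<in>V. g x = x} \<omega> R \<beta> \<kappa>"
    by (rule fundamental_class_exists[OF \<open>open U\<close> comp KU])
  note fcV = fundamental_class_restrict[OF fc \<open>U \<subseteq> V\<close> order_refl]
  show ?thesis
    by (rule euclidean_fixpoint_index_eqI[OF \<open>open V\<close> compact_imp_closed[OF comp] fcV],
        subst hom_induced_displacement[OF \<open>U \<subseteq> V\<close> g order_refl])
      (use euclidean_fixpoint_index_value[OF \<open>open U\<close>, of g \<omega> R \<beta> \<kappa>] fc comp K in simp)
qed

text \<open>Without fixed points \<open>\<kappa>\<close> lives in the homology of the pair
  \<open>(V, V)\<close>, which is trivial, so its image is the zeroth power of the
  generator.\<close>

lemma euclidean_fixpoint_index_empty: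
  fixes V :: "'a::euclidean_space set"
  assumes "open V" and empty: "{x\<in>V. g x = x} = {}"
  shows "euclidean_fixpoint_index V g = 0"
proof -
  let ?n = "int DIM('a)"
  let ?G = "relative_homology_group ?n (euclidean :: 'a topology) (- {0})"
  let ?D = "hom_induced ?n (top_of_set V) V euclidean (- {0}) (\<lambda>x. x - g x)"
  obtain \<omega> R \<beta> \<kappa> where fc: "fundamental_class V {} \<omega> R \<beta> \<kappa>"
    by (rule fundamental_class_exists[OF \<open>open V\<close>, of "{}"]) auto
  have \<omega>: "\<omega> \<in> carrier ?G" "\<kappa> \<in> carrier (relative_homology_group ?n (top_of_set V) V)"
    using fc by (simp_all add: fundamental_class_def Let_def)
  have "trivial_group (relative_homology_group ?n (top_of_set V) V)"
    using trivial_relative_homology_group_topspace[of ?n "top_of_set V"] by simp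
  then have "\<kappa> = \<one>\<^bsub>relative_homology_group ?n (top_of_set V) V\<^esub>"
    using \<omega>(2) by (auto simp: trivial_group_def)
  then have "?D \<kappa> = \<one>\<^bsub>?G\<^esub>"
    by (simp only: hom_one[OF hom_induced_hom group_relative_homology_group group_relative_homology_group])
  then have *: "?D \<kappa> = \<omega> [^]\<^bsub>?G\<^esub> (0::int)" by simp
  show ?thesis
    by (rule euclidean_fixpoint_index_eqI[OF \<open>open V\<close>]) (use fc * in \<open>simp_all add: empty\<close>)
qed

text \<open>A single \<open>\<kappa>\<close> along the compact set \<open>K\<close> computes all the
  indices, and the displacements form a homotopy of maps of pairs because none of them vanishes on
  \<open>V - K\<close>.\<close>

lemma euclidean_fixpoint_index_homotopy:
  fixes V :: "'a::euclidean_space set" and g :: "real \<Rightarrow> 'a \<Rightarrow> 'a"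
  assumes "open V" and g: "continuous_on ({0..1} \<times> V) (\<lambda>(t, x). g t x)"
    and K: "compact K" "K \<subseteq> V" "\<And>t x. t \<in> {0..1} \<Longrightarrow> x \<in> V \<Longrightarrow> g t x = x \<Longrightarrow> x \<in> K"
  shows "euclidean_fixpoint_index V (g 0) = euclidean_fixpoint_index V (g 1)"
proof -
  let ?n = "int DIM('a)"
  let ?G = "relative_homology_group ?n (euclidean :: 'a topology) (- {0})"
  let ?D = "\<lambda>t. hom_induced ?n (top_of_set V) (V - K) euclidean (- {0}) (\<lambda>x. x - g t x)"
  obtain \<omega> R \<beta> \<kappa> where fc: "fundamental_class V K \<omega> R \<beta> \<kappa>"
    by (rule fundamental_class_exists[OF \<open>open V\<close> K(1,2)])
  \<comment> \<open>The class along \<open>K\<close> is restricted to the fixed point set of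
    \<open>g t\<close>, which is compact as a closed subset of \<open>K\<close>.\<close>
  have val: "?D t \<kappa> = \<omega> [^]\<^bsub>?G\<^esub> euclidean_fixpoint_index V (g t)" if t: "t \<in> {0..1}" for t
  proof -
    have gt: "continuous_on V (g t)"
      using continuous_on_compose2[OF g, of V "\<lambda>x. (t, x)"] t continuous_on_Pair[of V "\<lambda>x. t" "\<lambda>x. x"]
        by (auto simp: image_subset_iff)
    have eq: "{x\<in>V. g t x = x} = {x\<in>K. g t x = x}"
      using K(2,3) t by auto
    have "continuous_on K (\<lambda>x. g t x - x)"
      by (intro continuous_intros continuous_on_subset[OF gt K(2)])
    then have "closed {x\<in>K. g t x - x = 0}"
      by (rule continuous_closed_preimage_constant) (rule compact_imp_closed[OF K(1)])
    then have "compact (K \<inter> {x\<in>K. g t x - x = 0})"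
      by (rule compact_Int_closed[OF K(1)])
    moreover have "K \<inter> {x\<in>K. g t x - x = 0} = {x\<in>V. g t x = x}"
      unfolding eq by auto
    ultimately have comp: "compact {x\<in>V. g t x = x}"
      by simp
    have sub: "{x\<in>V. g t x = x} \<subseteq> K" using eq by auto
    show ?thesis
      using euclidean_fixpoint_index_value[OF \<open>open V\<close> comp
          fundamental_class_restrict[OF fc order_refl sub]]
      by (simp only: hom_induced_displacement[OF order_refl gt sub])
  qed
  have "?D 0 = ?D 1"
  proof (rule homology_homotopy_axiom)
    show "homotopic_with (\<lambda>h. h \<in> V - K \<rightarrow> - {0}) (top_of_set V) euclidean
        (\<lambda>x. x - g 0 x) (\<lambda>x. x - g 1 x)"
      unfolding homotopic_with_def
    proof (intro exI conjI ballI allI)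
      have "continuous_on ({0..1} \<times> V) (\<lambda>z. snd z - g (fst z) (snd z))"
        using g by (intro continuous_intros) (simp add: case_prod_unfold)
      then show "continuous_map (prod_topology (top_of_set {0..1}) (top_of_set V)) euclidean
          (\<lambda>z. snd z - g (fst z) (snd z))"
        by simp
    qed (use K(3) in force)+
  qed
  with val[of 0] val[of 1] have
    "\<omega> [^]\<^bsub>?G\<^esub> euclidean_fixpoint_index V (g 0) = \<omega> [^]\<^bsub>?G\<^esub> euclidean_fixpoint_index V (g 1)"
    by simp
  then show ?thesis
    by (rule punctured_euclidean_generator(2)[rotated 2])
      (use fc in \<open>simp_all add: fundamental_class_def Let_def\<close>)
qed

text \<open>The domain from which the slice of \<open>O'\<close> is removed varies with the time.
  Near each \<open>t0\<close>, however, one open set \<open>U\<close> contains the slices of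
  \<open>C\<close> and misses those of \<open>O'\<close>, so on \<open>W \<inter> U\<close> homotopy
  invariance applies. The index is thus locally constant in the time, hence constant on the
  connected interval.\<close>

lemma euclidean_fixpoint_index_family:
  fixes W :: "'a::euclidean_space set" and g :: "real \<Rightarrow> 'a \<Rightarrow> 'a"
  assumes "open W" and g: "continuous_on ({0..1} \<times> W) (\<lambda>(t, x). g t x)"
    and CO: "compact C" "compact O'" "C \<inter> O' = {}"
    and fixed: "{(t, x). t \<in> {0..1} \<and> x \<in> W \<and> g t x = x} = C \<union> O'"
  shows "euclidean_fixpoint_index (W - {x. (0, x) \<in> O'}) (g 0) =
    euclidean_fixpoint_index (W - {x. (1, x) \<in> O'}) (g 1)"
proof -
  have mem: "(t, x) \<in> C \<union> O' \<longleftrightarrow> t \<in> {0..1} \<and> x \<in> W \<and> g t x = x" for t x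
    unfolding fixed[symmetric] by simp
  define i where "i t = euclidean_fixpoint_index (W - {x. (t, x) \<in> O'}) (g t)" for t
  have slice: "compact {x. (t, x) \<in> A}" if "compact A" for A :: "(real \<times> 'a) set" and t
  proof -
    have "{x. (t, x) \<in> A} = snd ` (A \<inter> ({t} \<times> UNIV))" by force
    moreover have "compact (A \<inter> ({t} \<times> UNIV))"
      using that by (intro compact_Int_closed closed_Times) auto
    ultimately show ?thesis by (simp add: compact_continuous_image continuous_on_snd)
  qed
  \<comment> \<open>Upper semicontinuity of the slices of a compact set: the times at which a slice
    leaves \<open>U\<close> form a compact set that does not contain \<open>t0\<close>.\<close>
  have near: "\<exists>d>0. \<forall>t. \<bar>t - t0\<bar> < d \<longrightarrow> {x. (t, x) \<in> A} \<subseteq> U"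
    if "compact A" "open U" "{x. (t0, x) \<in> A} \<subseteq> U" for A :: "(real \<times> 'a) set" and U t0
  proof -
    have "compact (A - UNIV \<times> U)"
      using that(1,2) by (metis Diff_eq compact_Int_closed closed_Compl open_Times open_UNIV)
    then have "closed (fst ` (A - UNIV \<times> U))"
      by (intro compact_imp_closed compact_continuous_image) (auto intro: continuous_intros)
    moreover have "t0 \<notin> fst ` (A - UNIV \<times> U)" using that(3) by force
    ultimately obtain d where "d > 0" "ball t0 d \<subseteq> - fst ` (A - UNIV \<times> U)"
      by (metis ComplI open_Compl open_contains_ball)
    then show ?thesis
      by (intro exI[of _ d]) (force simp: dist_real_def abs_minus_commute)
  qed
  have locally_const: "\<exists>d>0. \<forall>t\<in>{0..1}. \<bar>t - t0\<bar> < d \<longrightarrow> i t0 = i t" if t0: "t0 \<in> {0..1}" for t0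
  proof -
    have disj: "{x. (t0, x) \<in> C} \<inter> {x. (t0, x) \<in> O'} = {}" using CO(3) by auto
    obtain U U' where U: "open U" "open U'" "{x. (t0, x) \<in> C} \<subseteq> U" "{x. (t0, x) \<in> O'} \<subseteq> U'" "U \<inter> U' = {}"
      by (rule separation_normal_compact[OF slice[OF CO(1), of t0] compact_imp_closed[OF slice[OF CO(2), of t0]] disj])
        (rule that; assumption)
    obtain d1 where d1: "d1 > 0" "\<And>t. \<bar>t - t0\<bar> < d1 \<Longrightarrow> {x. (t, x) \<in> C} \<subseteq> U"
      using near[OF CO(1) U(1,3)] by blast
    obtain d2 where d2: "d2 > 0" "\<And>t. \<bar>t - t0\<bar> < d2 \<Longrightarrow> {x. (t, x) \<in> O'} \<subseteq> U'"
      using near[OF CO(2) U(2,4)] by blast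
    \<comment> \<open>For times close to \<open>t0\<close> the index can be computed on a domain
      that no longer depends on the time.\<close>
    have restrict: "i t = euclidean_fixpoint_index (W \<inter> U) (g t)"
      if t: "t \<in> {0..1}" "\<bar>t - t0\<bar> < min d1 d2" for t
    proof -
      have eq: "{x \<in> W - {x. (t, x) \<in> O'}. g t x = x} = {x. (t, x) \<in> C}"
      proof (rule Set.set_eqI)
        fix x show "x \<in> {x \<in> W - {x. (t, x) \<in> O'}. g t x = x} \<longleftrightarrow> x \<in> {x. (t, x) \<in> C}"
          using mem[of t x] t(1) CO(3) by auto
      qed
      have "continuous_on W (g t)"
        using continuous_on_compose2[OF g, of W "\<lambda>x. (t, x)"] t continuous_on_Pair[of W "\<lambda>x. t" "\<lambda>x. x"]
        by (auto simp: image_subset_iff)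
      then show ?thesis
        unfolding i_def
      proof (intro euclidean_fixpoint_index_restrict)
        show "open (W - {x. (t, x) \<in> O'})"
          using \<open>open W\<close> slice[OF CO(2)] by (simp add: compact_imp_closed open_Diff)
        show "open (W \<inter> U)" using \<open>open W\<close> U by auto
        show "W \<inter> U \<subseteq> W - {x. (t, x) \<in> O'}" using d2(2) t U(5) by fastforce
        show "{x \<in> W - {x. (t, x) \<in> O'}. g t x = x} \<subseteq> W \<inter> U"
          using eq d1(2)[of t] t by auto
        show "compact {x \<in> W - {x. (t, x) \<in> O'}. g t x = x}"
          unfolding eq by (rule slice[OF CO(1)])
      qed (auto intro: continuous_on_subset)
    qed
    have "i t0 = i t" if t: "t \<in> {0..1}" "\<bar>t - t0\<bar> < min d1 d2" for t
    proof -
      \<comment> \<open>The homotopy lemma runs over the unit interval, so the segment of times from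
        \<open>t0\<close> to \<open>t\<close> is reparametrised.\<close>
      define c where "c = (\<lambda>s. t0 + s * (t - t0))"
      have c: "c s \<in> {0..1}" "\<bar>c s - t0\<bar> < min d1 d2" if "s \<in> {0..1}" for s
      proof -
        have "c s = (1 - s) * t0 + s * t" by (simp add: c_def algebra_simps)
        then show "c s \<in> {0..1}"
          using convexD[of "{0..1}" t0 t "1 - s" s] that t t0 by auto
        have "\<bar>c s - t0\<bar> \<le> 1 * \<bar>t - t0\<bar>"
          unfolding c_def abs_mult add_diff_cancel_left' using that by (intro mult_right_mono) auto
        from order_le_less_trans[OF this] show "\<bar>c s - t0\<bar> < min d1 d2" using t by simp
      qed
      have "euclidean_fixpoint_index (W \<inter> U) (g (c 0)) = euclidean_fixpoint_index (W \<inter> U) (g (c 1))"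
      proof (rule euclidean_fixpoint_index_homotopy[where g = "\<lambda>s. g (c s)"])
        let ?J = "c ` {0..1}"
        have "compact ?J"
          unfolding c_def by (intro compact_continuous_image continuous_intros) auto
        then have "compact (C \<inter> (?J \<times> UNIV))"
          using CO(1) by (intro compact_Int_closed closed_Times) (auto simp: compact_imp_closed)
        then show "compact (snd ` (C \<inter> (?J \<times> UNIV)))"
          by (intro compact_continuous_image) (auto intro: continuous_intros)
        show "snd ` (C \<inter> (?J \<times> UNIV)) \<subseteq> W \<inter> U"
        proof
          fix x assume "x \<in> snd ` (C \<inter> (?J \<times> UNIV))"
          then obtain s where s: "s \<in> {0..1}" "(c s, x) \<in> C" by auto
          then have "x \<in> W" using mem by blast
          moreover have "x \<in> U" using d1(2)[of "c s"] c[OF s(1)] s(2) by auto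
          ultimately show "x \<in> W \<inter> U" by simp
        qed
        show "continuous_on ({0..1} \<times> (W \<inter> U)) (\<lambda>(s, x). g (c s) x)"
          unfolding case_prod_unfold
          by (rule continuous_on_compose2[OF g, of _ "\<lambda>z. (c (fst z), snd z)", simplified])
            (auto simp: c_def intro!: continuous_intros dest: c[unfolded c_def])
        show "x \<in> snd ` (C \<inter> (?J \<times> UNIV))" if s: "s \<in> {0..1}" and x: "x \<in> W \<inter> U" "g (c s) x = x" for s x
        proof -
          have "(c s, x) \<in> C \<union> O'" using mem c(1)[OF s] x by blast
          moreover have "(c s, x) \<notin> O'" using d2(2)[of "c s"] c[OF s] x U(5) by fastforce
          ultimately show ?thesis using s by force
        qed
      qed (use \<open>open W\<close> U in auto)
      then show ?thesis
        using restrict[OF t0] restrict[OF t] d1(1) d2(1) by (simp add: c_def)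
    qed
    then show ?thesis using d1(1) d2(1) by (intro exI[of _ "min d1 d2"]) auto
  qed
  have "i 0 = i 1"
  proof (rule connected_local_const[of "{0..1::real}"])
    show "\<forall>a\<in>{0..1}. \<forall>\<^sub>F b in at a within {0..1}. i a = i b"
    proof
      fix a :: real assume "a \<in> {0..1}"
      then obtain d where "d > 0" "\<And>t. t \<in> {0..1} \<Longrightarrow> \<bar>t - a\<bar> < d \<Longrightarrow> i a = i t"
        using locally_const by blast
      then show "\<forall>\<^sub>F b in at a within {0..1}. i a = i b"
        unfolding eventually_at by (auto simp: dist_real_def)
    qed
  qed auto
  then show ?thesis by (simp add: i_def)
qed

text \<open>Near \<open>p\<close> the displacement can be deformed linearly to
  \<open>L (x - p)\<close> without new zeros: the error is at most half of the lower bound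
  \<open>B * norm (x - p)\<close> for the linear part. The affine displacement is a homeomorphism
  and therefore induces an isomorphism on the local homology, which excludes the value 0.\<close>

lemma euclidean_fixpoint_index_nondegenerate:
  fixes V :: "'a::euclidean_space set" and g :: "'a \<Rightarrow> 'a"
  assumes "open V" and g: "continuous_on V g" and p: "{x\<in>V. g x = x} = {p}"
    and L: "((\<lambda>x. x - g x) has_derivative L) (at p)" "inj L"
  shows "euclidean_fixpoint_index V g \<noteq> 0"
proof -
  have lin: "linear L" using L(1) by (rule has_derivative_linear)
  obtain B where B: "B > 0" "\<And>x. B * norm x \<le> norm (L x)"
    using linear_inj_bounded_below_pos[OF lin L(2)] by blast
  have "p \<in> V" "g p = p" using p by auto
  obtain d1 where d1: "d1 > 0" "ball p d1 \<subseteq> V"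
    using \<open>open V\<close> \<open>p \<in> V\<close> open_contains_ball by blast
  obtain d2 where d2: "d2 > 0"
    "\<And>y. norm (y - p) < d2 \<Longrightarrow> norm ((y - g y) - (p - g p) - L (y - p)) \<le> B / 2 * norm (y - p)"
    using L(1) B(1) unfolding has_derivative_at_alt by (metis half_gt_zero)
  define U where "U = ball p (min d1 d2)"
  have U: "open U" "p \<in> U" "U \<subseteq> V" using d1 d2 by (auto simp: U_def)
  \<comment> \<open>The displacement of \<open>h t\<close> is the convex combination of the
    displacement of \<open>g\<close> and its linearisation.\<close>
  define h where "h = (\<lambda>t x. x - ((1 - t) *\<^sub>R (x - g x) + t *\<^sub>R L (x - p)))"
  have h0: "h 0 = g" and h1: "h 1 = (\<lambda>x. x - L (x - p))" by (auto simp: h_def)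
  have fp: "{x \<in> UNIV. h 1 x = x} = {p}"
    using linear_0[OF lin] L(2) by (auto simp: h1 dest: injD[of L _ 0])
  have "euclidean_fixpoint_index V g = euclidean_fixpoint_index U g"
    by (rule euclidean_fixpoint_index_restrict) (use U \<open>open V\<close> g p in auto)
  also have "\<dots> = euclidean_fixpoint_index U (h 1)"
    unfolding h0[symmetric]
  proof (rule euclidean_fixpoint_index_homotopy[of U h "{p}"])
    show "continuous_on ({0..1} \<times> U) (\<lambda>(t, x). h t x)"
      unfolding h_def case_prod_unfold
      by (intro continuous_intros continuous_on_compose2[OF g] linear_continuous_on_compose[OF _ lin])
        (use U in auto)
    show "x \<in> {p}" if t: "t \<in> {0..1}" and x: "x \<in> U" "h t x = x" for t x
    proof -
      define y where "y = (1 - t) *\<^sub>R (x - g x) + t *\<^sub>R L (x - p)"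
      have "x - y = x" using x(2) by (simp only: h_def y_def)
      then have "(1 - t) *\<^sub>R (x - g x) + t *\<^sub>R L (x - p) = 0" by (simp add: y_def[symmetric])
      moreover have "- ((1 - t) *\<^sub>R (x - g x - L (x - p))) =
          L (x - p) - ((1 - t) *\<^sub>R (x - g x) + t *\<^sub>R L (x - p))"
        by (simp add: algebra_simps)
      ultimately have "L (x - p) = - ((1 - t) *\<^sub>R (x - g x - L (x - p)))"
        by simp
      then have "norm (L (x - p)) = norm ((1 - t) *\<^sub>R (x - g x - L (x - p)))"
        using norm_minus_cancel by metis
      then have "norm (L (x - p)) = (1 - t) * norm (x - g x - L (x - p))"
        using t by simp
      also have "\<dots> \<le> 1 * norm (x - g x - L (x - p))"
        using t by (intro mult_right_mono) auto
      also have "\<dots> \<le> B / 2 * norm (x - p)"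
        using d2(2)[of x] x(1) \<open>g p = p\<close> by (simp add: U_def dist_norm norm_minus_commute)
      finally have "B * norm (x - p) \<le> B / 2 * norm (x - p)" using B(2)[of "x - p"] by linarith
      then have "norm (x - p) \<le> 0" using B(1) by (simp add: field_simps)
      then show ?thesis by simp
    qed
  qed (use U in auto)
  also have "\<dots> = euclidean_fixpoint_index UNIV (h 1)"
  proof (rule euclidean_fixpoint_index_restrict[symmetric])
    show "compact {x \<in> UNIV. h 1 x = x}" "{x \<in> UNIV. h 1 x = x} \<subseteq> U" using U fp by auto
    show "continuous_on UNIV (h 1)"
      unfolding h1 by (intro continuous_intros linear_continuous_on_compose[OF _ lin])
  qed (use U in auto)
  also have "\<dots> \<noteq> 0"
  proof
    let ?n = "int DIM('a)"
    let ?E = "euclidean :: 'a topology"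
    let ?G = "relative_homology_group ?n ?E (- {0})"
    let ?P = "relative_homology_group ?n ?E (- {p})"
    \<comment> \<open>Triviality is traced backwards: the affine displacement is injective on
      homology, so \<open>\<kappa>\<close> is trivial; restriction from the ball is injective, so
      \<open>\<beta>\<close> is trivial; then so is its image, the generator
      \<open>\<omega>\<close>.\<close>
    assume 0: "euclidean_fixpoint_index UNIV (h 1) = 0"
    obtain \<omega> R \<beta> \<kappa> where fc: "fundamental_class UNIV {p} \<omega> R \<beta> \<kappa>"
      by (rule fundamental_class_exists[OF open_UNIV, of "{p}"]) auto
    have fc': "fundamental_class UNIV {x \<in> UNIV. h 1 x = x} \<omega> R \<beta> \<kappa>" using fc unfolding fp .
    have cc: "\<omega> \<in> carrier ?G" "generate ?G {\<omega>} = carrier ?G" "\<kappa> \<in> carrier ?P"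
        "p \<in> cball 0 R" "\<beta> \<in> carrier (relative_homology_group ?n ?E (- cball 0 R))"
        "hom_induced ?n ?E (- cball 0 R) ?E (- {0}) id \<beta> = \<omega>" "R > 0"
        "\<kappa> = hom_induced ?n ?E (- cball 0 R) ?E (- {p}) id \<beta>"
      using fc by (auto simp: fundamental_class_def Let_def Compl_eq_Diff_UNIV[symmetric] hom_induced_id)
    have "hom_induced ?n ?E (- {p}) ?E (- {0}) (\<lambda>x. x - h 1 x) \<kappa> = \<omega> [^]\<^bsub>?G\<^esub> (0::int)"
      using euclidean_fixpoint_index_value[OF open_UNIV _ fc'] fp 0
      by (simp add: Compl_eq_Diff_UNIV[symmetric])
    also have "(\<lambda>x. x - h 1 x) = (\<lambda>x. L (x - p))" by (simp add: h1)
    finally have D1: "hom_induced ?n ?E (- {p}) ?E (- {0}) (\<lambda>x. L (x - p)) \<kappa> = \<one>\<^bsub>?G\<^esub>" by simp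
    have "homeomorphic_map ?E ?E (\<lambda>x. L (x - p))"
    proof -
      obtain M where M: "linear M" "\<And>x. M (L x) = x" "\<And>x. L (M x) = x"
        using linear_injective_isomorphism[OF lin L(2)] by blast
      have "homeomorphic_maps ?E ?E (\<lambda>x. L (x - p)) (\<lambda>y. M y + p)"
        unfolding homeomorphic_maps_def
        by (auto simp: M(2,3) intro!: continuous_intros linear_continuous_on_compose[OF _ lin]
            linear_continuous_on_compose[OF _ M(1)])
      then show ?thesis by (auto simp: homeomorphic_map_maps)
    qed
    moreover have "(\<lambda>x. L (x - p)) ` (- {p}) = - {0}"
    proof -
      have "surj L" using lin L(2) by (simp add: linear_injective_imp_surjective)
      have "y \<in> (\<lambda>x. L (x - p)) ` (- {p})" if "y \<noteq> 0" for y
      proof -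
        obtain x where "y = L x" using \<open>surj L\<close> by (metis surjD)
        then show ?thesis using that linear_0[OF lin] by (intro image_eqI[of _ _ "x + p"]) auto
      qed
      moreover have "L (x - p) \<noteq> 0" if "x \<noteq> p" for x
        using that injD[OF L(2), of "x - p" 0] linear_0[OF lin] by auto
      ultimately show ?thesis by auto
    qed
    ultimately have "hom_induced ?n ?E (- {p}) ?E (- {0}) (\<lambda>x. L (x - p)) \<in> iso ?P ?G"
      by (intro homeomorphic_map_relative_homology_iso) auto
    from iso_inj_on_carrier[OF this] have "\<kappa> = \<one>\<^bsub>?P\<^esub>"
    proof (rule inj_onD)
      show "hom_induced ?n ?E (- {p}) ?E (- {0}) (\<lambda>x. L (x - p)) \<kappa> =
          hom_induced ?n ?E (- {p}) ?E (- {0}) (\<lambda>x. L (x - p)) \<one>\<^bsub>?P\<^esub>"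
        unfolding D1 by (rule hom_one[symmetric, OF hom_induced_hom]) auto
    qed (fact cc(3), rule monoid.one_closed[OF group.is_monoid[OF group_relative_homology_group]])
    then have \<beta>1: "hom_induced ?n ?E (- cball 0 R) ?E (- {p}) id \<beta> = \<one>\<^bsub>?P\<^esub>"
      by (simp only: cc(8))
    have "inj_on (hom_induced ?n ?E (- cball 0 R) ?E (- {p}) id)
        (carrier (relative_homology_group ?n ?E (- cball 0 R)))"
      by (rule iso_inj_on_carrier[OF iso_relative_homology_complement_convex]) (use cc(4) in auto)
    then have "\<beta> = \<one>\<^bsub>relative_homology_group ?n ?E (- cball 0 R)\<^esub>"
    proof (rule inj_onD)
      show "hom_induced ?n ?E (- cball 0 R) ?E (- {p}) id \<beta> = hom_induced ?n ?E (- cball 0 R) ?E (- {p}) id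
          \<one>\<^bsub>relative_homology_group ?n ?E (- cball 0 R)\<^esub>"
        unfolding \<beta>1 by (rule hom_one[symmetric, OF hom_induced_hom]) auto
    qed (fact cc(5), rule monoid.one_closed[OF group.is_monoid[OF group_relative_homology_group]])
    have "\<omega> = \<one>\<^bsub>?G\<^esub>"
      unfolding cc(6)[symmetric] \<open>\<beta> = _\<close>
      by (rule hom_one[OF hom_induced_hom group_relative_homology_group group_relative_homology_group])
    then have "\<omega> [^]\<^bsub>?G\<^esub> (1::int) = \<omega> [^]\<^bsub>?G\<^esub> (0::int)"
      using cc(1) by (simp add: group.int_pow_1)
    then have "(1::int) = 0"
      by (rule punctured_euclidean_generator(2)[OF cc(1,2)])
    then show False by simp
  qed
  finally show ?thesis .
qed

subsection \<open>The universal covering of the torus\<close>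

definition lat :: "(real \<times> real) set" where "lat = \<int> \<times> \<int>"

lemma mem_lat: "k \<in> lat \<longleftrightarrow> fst k \<in> \<int> \<and> snd k \<in> \<int>"
  by (cases k) (auto simp: lat_def)

definition tor :: "real \<times> real \<Rightarrow> C2" where
  "tor \<theta> = (cis (2 * pi * fst \<theta>), cis (2 * pi * snd \<theta>))"

text \<open>On the torus this is a section of \<open>tor\<close>, discontinuous along the branch cut
  of \<open>Ln\<close>. It also assigns angles to all points of \<open>torus_nbhd\<close>, so that
  maps given in angles extend to a neighbourhood of the torus.\<close>

definition tang :: "C2 \<Rightarrow> real \<times> real" where
  "tang x = (Im (Ln (fst x)) / (2 * pi), Im (Ln (snd x)) / (2 * pi))"

definition tmul :: "C2 \<Rightarrow> C2 \<Rightarrow> C2" where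
  "tmul x y = (fst x * fst y, snd x * snd y)"

definition tdiv :: "C2 \<Rightarrow> C2 \<Rightarrow> C2" where
  "tdiv x y = (fst x / fst y, snd x / snd y)"

lemma lat_add: "a \<in> lat \<Longrightarrow> b \<in> lat \<Longrightarrow> a + b \<in> lat"
  and lat_diff: "a \<in> lat \<Longrightarrow> b \<in> lat \<Longrightarrow> a - b \<in> lat"
  and lat_uminus: "a \<in> lat \<Longrightarrow> - a \<in> lat"
  and lat_0: "0 \<in> lat"
  by (auto simp: mem_lat)

text \<open>Distinct lattice points are at distance at least 1. Arbitrary subsets are allowed
  because fixed point classes, and unions of them, are preimages of such sets.\<close>

lemma closed_subset_lat:
  assumes "Q \<subseteq> lat"
  shows "closed Q"
proof (rule discrete_imp_closed[of 1], simp, intro ballI impI)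
  fix x y assume "x \<in> Q" "y \<in> Q" "dist y x < 1"
  then have "fst x \<in> \<int>" "fst y \<in> \<int>" "snd x \<in> \<int>" "snd y \<in> \<int>"
      "\<bar>fst y - fst x\<bar> < 1" "\<bar>snd y - snd x\<bar> < 1"
    using subsetD[OF assms \<open>x \<in> Q\<close>] subsetD[OF assms \<open>y \<in> Q\<close>] dist_fst_le[of y x] dist_snd_le[of y x]
    by (auto simp: dist_real_def mem_lat)
  then have "fst y = fst x" "snd y = snd x"
    using Ints_eq_abs_less1 by blast+
  then show "y = x" by (simp add: prod_eq_iff)
qed

lemma tor_in_torus [simp]: "tor \<theta> \<in> torus"
  by (simp add: tor_def torus_def)

lemma torus_subset_nbhd: "torus \<subseteq> torus_nbhd"
  by (auto simp: torus_def torus_nbhd_def)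

lemma torus_retraction_torus: "x \<in> torus \<Longrightarrow> torus_retraction x = x"
  by (cases x) (auto simp: torus_def torus_retraction_def sgn_eq)

lemma torus_retraction_in_torus: "x \<in> torus_nbhd \<Longrightarrow> torus_retraction x \<in> torus"
  using retraction_torus by (auto simp: retraction_def Pi_iff)

lemma tor_tang: "x \<in> torus_nbhd \<Longrightarrow> tor (tang x) = torus_retraction x"
  by (cases x) (auto simp: tor_def tang_def torus_nbhd_def torus_retraction_def cis_Arg
      simp flip: Arg_eq_Im_Ln)

lemma tor_tang_torus: "x \<in> torus \<Longrightarrow> tor (tang x) = x"
  using tor_tang torus_subset_nbhd torus_retraction_torus by fastforce

lemma cis_eq_iff: "cis (2 * pi * s) = cis (2 * pi * t) \<longleftrightarrow> s - t \<in> \<int>"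
proof -
  have "cis (2 * pi * s) = cis (2 * pi * t) \<longleftrightarrow>
      (\<exists>n::int. \<i> * of_real (2 * pi * s) = \<i> * of_real (2 * pi * t) + of_int (2 * n) * of_real pi * \<i>)"
    by (simp only: cis_conv_exp exp_eq of_real_mult of_real_of_int_eq)
  also have "\<dots> \<longleftrightarrow> (\<exists>n::int. s = t + of_int n)"
  proof (rule ex_cong1)
    fix n :: int
    have "\<i> * of_real (2 * pi * s) = \<i> * of_real (2 * pi * t) + of_int (2 * n) * of_real pi * \<i> \<longleftrightarrow>
        \<i> * of_real (2 * pi * s) = \<i> * of_real (2 * pi * (t + of_int n))"
      by (simp add: algebra_simps)
    also have "\<dots> \<longleftrightarrow> s = t + of_int n"
      by (simp only: mult_cancel_left of_real_eq_iff) auto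
    finally show "\<i> * of_real (2 * pi * s) = \<i> * of_real (2 * pi * t) + of_int (2 * n) * of_real pi * \<i>
      \<longleftrightarrow> s = t + of_int n" .
  qed
  also have "\<dots> \<longleftrightarrow> s - t \<in> \<int>"
    by (metis Ints_cases Ints_of_int add_diff_cancel_left' diff_add_cancel add.commute)
  finally show ?thesis .
qed

lemma tor_eq_iff: "tor \<eta> = tor \<theta> \<longleftrightarrow> \<eta> - \<theta> \<in> lat"
  by (auto simp: tor_def cis_eq_iff mem_lat)

lemma tor_add_lat: "k \<in> lat \<Longrightarrow> tor (\<theta> + k) = tor \<theta>"
  by (simp add: tor_eq_iff)

lemma tor_add: "tor (\<theta> + \<eta>) = tmul (tor \<theta>) (tor \<eta>)"
  by (simp add: tor_def tmul_def cis_mult distrib_left)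

lemma continuous_on_tor [continuous_intros]:
  "continuous_on S f \<Longrightarrow> continuous_on S (\<lambda>x. tor (f x))"
  unfolding tor_def by (intro continuous_intros)

lemma torus_eq_tor_image: "torus = tor ` ({0..1} \<times> {0..1})"
proof
  show "torus \<subseteq> tor ` ({0..1} \<times> {0..1})"
  proof
    fix z assume "z \<in> torus"
    have "z = tor (tang z)" by (simp add: tor_tang_torus \<open>z \<in> torus\<close>)
    also have "\<dots> = tor (frac (fst (tang z)), frac (snd (tang z)))"
      unfolding tor_eq_iff by (auto simp: frac_def mem_lat)
    finally show "z \<in> tor ` ({0..1} \<times> {0..1})"
      by (rule image_eqI) (auto simp: less_imp_le frac_lt_1)
  qed
qed auto

lemma tang_tor: "tang (tor \<theta>) - \<theta> \<in> lat"
  using tor_tang_torus[of "tor \<theta>"] by (simp add: tor_eq_iff)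

text \<open>This gives a second angle for \<open>x\<close>, equal to \<open>tang x\<close> up to a
  lattice vector. Unlike \<open>tang x\<close> it is continuous at \<open>x = y\<close>, because the
  quotient is then close to 1 and away from the branch cut.\<close>

lemma tor_tang_shift:
  assumes "x \<in> torus_nbhd" "y \<in> torus_nbhd"
  shows "tor (tang y + tang (tdiv x y)) = tor (tang x)"
proof -
  have "tdiv x y \<in> torus_nbhd" using assms by (auto simp: tdiv_def torus_nbhd_def)
  then have "tor (tang y + tang (tdiv x y)) = tmul (torus_retraction y) (torus_retraction (tdiv x y))"
    using assms by (simp add: tor_add tor_tang)
  also have "\<dots> = torus_retraction x"
  proof -
    have "sgn w * sgn (z / w) = sgn z" if "w \<noteq> 0" for w z :: complex
      using sgn_mult[of w "z / w"] that by simp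
    then show ?thesis
      using assms by (auto simp: tmul_def tdiv_def torus_retraction_def torus_nbhd_def sgn_zero_iff)
  qed
  finally show ?thesis using assms by (simp add: tor_tang)
qed

lemma tendsto_tang_tdiv:
  assumes "y \<in> torus_nbhd" "(f \<longlongrightarrow> y) F"
  shows "((\<lambda>x. tang (tdiv (f x) y)) \<longlongrightarrow> 0) F"
proof -
  have y: "fst y \<noteq> 0" "snd y \<noteq> 0" using assms(1) by (auto simp: torus_nbhd_def)
  have "((\<lambda>x. fst (f x) / fst y) \<longlongrightarrow> fst y / fst y) F" "((\<lambda>x. snd (f x) / snd y) \<longlongrightarrow> snd y / snd y) F"
    by (intro tendsto_intros assms(2) y)+
  then have "((\<lambda>x. fst (f x) / fst y) \<longlongrightarrow> 1) F" "((\<lambda>x. snd (f x) / snd y) \<longlongrightarrow> 1) F"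
    using y by simp_all
  from this[THEN tendsto_Ln] have
    "((\<lambda>x. Ln (fst (f x) / fst y)) \<longlongrightarrow> Ln 1) F" "((\<lambda>x. Ln (snd (f x) / snd y)) \<longlongrightarrow> Ln 1) F"
    by simp_all
  then have "((\<lambda>x. (Im (Ln (fst (f x) / fst y)) / (2 * pi), Im (Ln (snd (f x) / snd y)) / (2 * pi))) \<longlongrightarrow>
      (Im (Ln 1) / (2 * pi), Im (Ln 1) / (2 * pi))) F"
    by (intro tendsto_Pair tendsto_divide tendsto_Im tendsto_const) auto
  then show ?thesis by (simp add: tang_def tdiv_def zero_prod_def)
qed

subsection \<open>Self-maps of the torus in coordinates\<close>

locale lattice_linear =
  fixes A :: "real \<times> real \<Rightarrow> real \<times> real"
  assumes lin: "linear A" and lat: "\<And>k. k \<in> lat \<Longrightarrow> A k \<in> lat"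
begin

definition equivariant :: "(real \<times> real \<Rightarrow> real \<times> real) \<Rightarrow> bool" where
  "equivariant F \<longleftrightarrow> continuous_on UNIV F \<and> (\<forall>\<theta>. \<forall>k\<in>lat. F (\<theta> + k) = F \<theta> + A k)"

lemma equivariantD: "equivariant F \<Longrightarrow> k \<in> lat \<Longrightarrow> F (\<theta> + k) = F \<theta> + A k"
  unfolding equivariant_def by blast

lemma equivariant_continuous_on: "equivariant F \<Longrightarrow> continuous_on S F"
  unfolding equivariant_def using continuous_on_subset by blast

text \<open>Replacing \<open>\<theta>\<close> by \<open>\<theta> + k\<close> changes
  \<open>F \<theta> - \<theta>\<close> by \<open>A k - k\<close>. Saturated sets are thus those for
  which membership of the displacement depends only on the point
  \<open>tor \<theta>\<close>.\<close>

definition saturated :: "(real \<times> real) set \<Rightarrow> bool" where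
  "saturated Q \<longleftrightarrow> Q \<subseteq> lat \<and> (\<forall>q\<in>Q. \<forall>k\<in>lat. q + (A k - k) \<in> Q)"

end

text \<open>For an equivariant \<open>F\<close> the lattice jumps of \<open>tang\<close> cancel
  under \<open>tor\<close>, so this is the continuous torus map lifted by \<open>F\<close>, already
  extended to \<open>torus_nbhd\<close>.\<close>

definition descend :: "(real \<times> real \<Rightarrow> real \<times> real) \<Rightarrow> C2 \<Rightarrow> C2" where
  "descend F z = tor (F (tang z))"

text \<open>The fixed points whose lifted displacement lies in \<open>Q\<close>: all of them when
  \<open>Q\<close> is \<open>lat\<close>, and a Nielsen class (or nothing) when \<open>Q\<close> is
  a coset.\<close>

definition fpc :: "(real \<times> real \<Rightarrow> real \<times> real) \<Rightarrow> (real \<times> real) set \<Rightarrow> C2 set" where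
  "fpc F Q = {z \<in> torus. F (tang z) - tang z \<in> Q}"

lemma descend_in_torus [simp]: "descend F z \<in> torus"
  by (simp add: descend_def)

lemma descend_fixed: "{z \<in> torus. descend F z = z} = fpc F lat"
proof -
  have "descend F z = z \<longleftrightarrow> F (tang z) - tang z \<in> lat" if "z \<in> torus" for z
    unfolding descend_def tor_eq_iff[symmetric] tor_tang_torus[OF that] ..
  then show ?thesis by (auto simp: fpc_def)
qed

context lattice_linear
begin

lemma equivariant_tor:
  assumes "equivariant F" "tor \<eta> = tor \<theta>"
  shows "tor (F \<eta>) = tor (F \<theta>)"
proof -
  have k: "\<eta> - \<theta> \<in> lat" using assms(2) by (simp add: tor_eq_iff)
  then have "F (\<theta> + (\<eta> - \<theta>)) = F \<theta> + A (\<eta> - \<theta>)"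
    using assms(1) by (rule equivariantD[rotated])
  then show ?thesis using lat[OF k] by (simp add: tor_add_lat)
qed

lemma descend_tor: "equivariant F \<Longrightarrow> descend F (tor \<theta>) = tor (F \<theta>)"
  unfolding descend_def by (rule equivariant_tor) (simp_all add: tor_tang_torus)

lemma descend_retraction:
  assumes "equivariant F" "x \<in> torus_nbhd"
  shows "descend F (torus_retraction x) = descend F x"
  using assms by (metis descend_def descend_tor tor_tang)

text \<open>Saturation allows any lift \<open>\<theta>\<close> of the point in place of the
  principal one, in both directions since \<open>k\<close> may be replaced by
  \<open>- k\<close>.\<close>

lemma tor_in_fpc:
  assumes F: "equivariant F" and Q: "saturated Q"
  shows "tor \<theta> \<in> fpc F Q \<longleftrightarrow> F \<theta> - \<theta> \<in> Q"
proof -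
  define k where "k = tang (tor \<theta>) - \<theta>"
  have k: "k \<in> lat" "tang (tor \<theta>) = \<theta> + k" using tang_tor by (simp_all add: k_def)
  have Fk: "F (\<theta> + k) = F \<theta> + A k" using F k(1) by (rule equivariantD)
  have F1: "F (tang (tor \<theta>)) - tang (tor \<theta>) = (F \<theta> - \<theta>) + (A k - k)"
    unfolding k(2) Fk by simp
  have F2: "(F \<theta> - \<theta>) = ((F \<theta> - \<theta>) + (A k - k)) + (A (- k) - (- k))"
    using linear_neg[OF lin, of k] by simp
  have "(F \<theta> - \<theta>) + (A k - k) \<in> Q \<longleftrightarrow> F \<theta> - \<theta> \<in> Q"
    using Q k(1) lat_uminus[OF k(1)] F2 unfolding saturated_def by metis
  then show ?thesis
    unfolding fpc_def by (simp only: mem_Collect_eq F1 tor_in_torus simp_thms)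
qed

text \<open>At a base point \<open>y\<close> the angle \<open>tang x\<close> is replaced by
  \<open>tang y + tang (tdiv x y)\<close>, which tends to \<open>tang y\<close>. By equivariance the
  descended value is the same for both angles.\<close>

lemma continuous_on_descend:
  fixes H :: "'p::t2_space \<Rightarrow> real \<times> real \<Rightarrow> real \<times> real"
  assumes H: "continuous_on (P \<times> UNIV) (\<lambda>(t, \<theta>). H t \<theta>)" and eqv: "\<And>t. t \<in> P \<Longrightarrow> equivariant (H t)"
  shows "continuous_on (P \<times> torus_nbhd) (\<lambda>(t, x). descend (H t) x)"
  unfolding continuous_on_def
proof
  fix z assume "z \<in> P \<times> torus_nbhd"
  then obtain t0 y where z_eq: "z = (t0, y)" and t0: "t0 \<in> P" and y: "y \<in> torus_nbhd" by auto
  let ?W = "at (t0, y) within P \<times> torus_nbhd"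
  have ev: "\<forall>\<^sub>F z in ?W. z \<in> P \<times> torus_nbhd"
    unfolding eventually_at_topological by blast
  have id: "((\<lambda>z. z) \<longlongrightarrow> (t0, y)) ?W" by (rule tendsto_ident_at)
  have "((\<lambda>z. (fst z, tang y + tang (tdiv (snd z) y))) \<longlongrightarrow> (t0, tang y + 0)) ?W"
    using tendsto_fst[OF id] tendsto_tang_tdiv[OF y tendsto_snd[OF id, simplified]]
    by (intro tendsto_Pair tendsto_add tendsto_const) auto
  then have lim: "((\<lambda>z. (fst z, tang y + tang (tdiv (snd z) y))) \<longlongrightarrow> (t0, tang y)) ?W" by simp
  have cont: "continuous_on (P \<times> UNIV) (\<lambda>z. tor (H (fst z) (snd z)))"
    using H by (intro continuous_intros) (simp add: case_prod_unfold)
  have "((\<lambda>z. (\<lambda>z. tor (H (fst z) (snd z))) (fst z, tang y + tang (tdiv (snd z) y)))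
      \<longlongrightarrow> (\<lambda>z. tor (H (fst z) (snd z))) (t0, tang y)) ?W"
    by (rule continuous_on_tendsto_compose[OF cont lim])
      (use t0 in \<open>auto intro: eventually_mono[OF ev]\<close>)
  then have lim2: "((\<lambda>z. tor (H (fst z) (tang y + tang (tdiv (snd z) y)))) \<longlongrightarrow> tor (H t0 (tang y))) ?W"
    by simp
  have shift: "tor (H (fst z) (tang y + tang (tdiv (snd z) y))) = (\<lambda>(t, x). descend (H t) x) z"
    if z: "z \<in> P \<times> torus_nbhd" for z
  proof -
    have P: "fst z \<in> P" "snd z \<in> torus_nbhd" using z by (simp_all only: mem_Times_iff)
    have "tor (H (fst z) (tang y + tang (tdiv (snd z) y))) = tor (H (fst z) (tang (snd z)))"
      by (rule equivariant_tor[OF eqv[OF P(1)] tor_tang_shift[OF P(2) y]])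
    then show ?thesis
      by (simp only: descend_def case_prod_unfold)
  qed
  have ev2: "\<forall>\<^sub>F z in ?W. tor (H (fst z) (tang y + tang (tdiv (snd z) y))) = (\<lambda>(t, x). descend (H t) x) z"
    using ev by (rule eventually_mono) (rule shift)
  show "((\<lambda>(t, x). descend (H t) x) \<longlongrightarrow> (case z of (t, x) \<Rightarrow> descend (H t) x)) (at z within P \<times> torus_nbhd)"
    unfolding z_eq case_prod_conv descend_def[of "H t0" y]
    by (rule Lim_transform_eventually[OF lim2 ev2])
qed

lemma continuous_on_descend_single:
  assumes "equivariant F"
  shows "continuous_on torus_nbhd (descend F)"
proof -
  define D where "D = (\<lambda>(t::real, x). descend F x)"
  have F: "continuous_on ({0::real} \<times> UNIV) (\<lambda>(t, \<theta>). F \<theta>)"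
    unfolding case_prod_unfold
    by (rule continuous_on_compose2[OF equivariant_continuous_on[OF assms, of UNIV]
          continuous_on_snd[OF continuous_on_id]]) (rule subset_UNIV)
  have D: "continuous_on ({0::real} \<times> torus_nbhd) D"
    unfolding D_def using F by (rule continuous_on_descend) (rule assms)
  have "continuous_on torus_nbhd (\<lambda>x. D (0, x))"
    by (rule continuous_on_compose2[of "{0::real} \<times> torus_nbhd" D torus_nbhd "\<lambda>x. (0, x)",
          OF D continuous_on_Pair[OF continuous_on_const continuous_on_id]]) blast
  then show ?thesis by (simp only: D_def case_prod_conv)
qed

text \<open>The family is the image of a closed subset of a compact box, as every point of the torus
  has a lift in the closed unit square. Closedness comes from \<open>Q\<close> being a subset of the
  lattice.\<close>

lemma compact_fpc_family:
  fixes H :: "real \<Rightarrow> real \<times> real \<Rightarrow> real \<times> real"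
  assumes H: "continuous_on ({0..1} \<times> UNIV) (\<lambda>(t, \<theta>). H t \<theta>)"
    and eqv: "\<And>t. t \<in> {0..1} \<Longrightarrow> equivariant (H t)" and Q: "saturated Q"
  shows "compact {(t, z). t \<in> {0..1} \<and> z \<in> fpc (H t) Q}"
proof -
  let ?D = "{0..1::real} \<times> ({0..1::real} \<times> {0..1::real})"
  define D where "D = {z \<in> ?D. H (fst z) (snd z) - snd z \<in> Q}"
  have "continuous_on ?D (\<lambda>z. H (fst z) (snd z) - snd z)"
    by (intro continuous_intros continuous_on_subset[OF H[unfolded case_prod_unfold]]) auto
  moreover have "closed Q"
  proof (rule closed_subset_lat)
    show "Q \<subseteq> lat" using Q by (simp add: saturated_def)
  qed
  ultimately have "closed D"
    using continuous_closed_preimage[of ?D "\<lambda>z. H (fst z) (snd z) - snd z" Q]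
    by (auto simp: D_def vimage_def Int_def intro!: closed_Times)
  moreover have "compact ?D" by (intro compact_Times) auto
  ultimately have "compact D"
    unfolding D_def by (metis (no_types, lifting) compact_eq_bounded_closed bounded_subset mem_Collect_eq subsetI)
  then have "compact ((\<lambda>z. (fst z, tor (snd z))) ` D)"
    by (intro compact_continuous_image continuous_intros)
  moreover have "(\<lambda>z. (fst z, tor (snd z))) ` D = {(t, z). t \<in> {0..1} \<and> z \<in> fpc (H t) Q}"
  proof (rule equalityI; rule subsetI)
    fix x assume "x \<in> (\<lambda>z. (fst z, tor (snd z))) ` D"
    then obtain z where z: "z \<in> ?D" "H (fst z) (snd z) - snd z \<in> Q" "x = (fst z, tor (snd z))"
      unfolding D_def by blast
    then have t: "fst z \<in> {0..1}" by auto
    have "tor (snd z) \<in> fpc (H (fst z)) Q"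
      unfolding tor_in_fpc[OF eqv[OF t] Q] by (rule z(2))
    with t show "x \<in> {(t, z). t \<in> {0..1} \<and> z \<in> fpc (H t) Q}"
      by (simp add: z(3))
  next
    fix x assume "x \<in> {(t, z). t \<in> {0..1} \<and> z \<in> fpc (H t) Q}"
    obtain t z where x: "x = (t, z)" by (cases x)
    have t: "t \<in> {0..1}" and z: "z \<in> fpc (H t) Q"
      using \<open>x \<in> _\<close> by (simp_all only: x mem_Collect_eq case_prod_conv)
    have "z \<in> torus" using z by (simp only: fpc_def mem_Collect_eq)
    then have "z \<in> tor ` ({0..1} \<times> {0..1})"
      by (simp only: torus_eq_tor_image[symmetric])
    then obtain \<theta> where \<theta>: "z = tor \<theta>" "\<theta> \<in> {0..1} \<times> {0..1}" by (rule imageE)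
    have "tor \<theta> \<in> fpc (H t) Q" using z by (simp only: \<theta>(1))
    then have "H t \<theta> - \<theta> \<in> Q"
      by (simp only: tor_in_fpc[OF eqv[OF t] Q])
    then have "(t, \<theta>) \<in> D"
      using t \<theta>(2) by (simp add: D_def)
    then show "x \<in> (\<lambda>z. (fst z, tor (snd z))) ` D"
      unfolding x \<theta>(1) by (rule rev_image_eqI) simp
  qed
  ultimately show ?thesis by simp
qed

end

subsection \<open>The index of a fixed point class\<close>

lemma euclidean_fixpoint_index_cong:
  assumes "\<And>x. x \<in> V \<Longrightarrow> f x = g x"
  shows "euclidean_fixpoint_index V f = euclidean_fixpoint_index V g"
proof -
  have K: "{x\<in>V. f x = x} = {x\<in>V. g x = x}" using assms by auto
  have "hom_induced n (top_of_set V) S euclidean T (\<lambda>x. x - f x) =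
      hom_induced n (top_of_set V) S euclidean T (\<lambda>x. x - g x)" for n S T
    by (rule hom_induced_eq) (use assms in simp)
  then show ?thesis
    unfolding euclidean_fixpoint_index_def Let_def K by (simp only:)
qed

text \<open>A given map and its descended lift agree only on the torus. This is enough because the
  index precomposes with the retraction, whose values lie on the torus.\<close>

lemma torus_fixpoint_index_cong:
  assumes "\<And>x. x \<in> torus \<Longrightarrow> f x = g x"
  shows "torus_fixpoint_index f C = torus_fixpoint_index g C"
proof -
  have K: "{x\<in>torus. f x = x} = {x\<in>torus. g x = x}" using assms by auto
  show ?thesis
    unfolding torus_fixpoint_index_def K
    by (rule euclidean_fixpoint_index_cong) (simp add: assms torus_retraction_in_torus)
qed

context lattice_linear
begin

lemma saturated_lat: "saturated lat"
  unfolding saturated_def using lat lat_add lat_diff by blast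

text \<open>The remaining classes together are again given by a saturated set, so they form the
  second compact part required in \<open>euclidean_fixpoint_index_family\<close>.\<close>

lemma saturated_Compl: "saturated Q \<Longrightarrow> saturated (lat - Q)"
proof -
  assume Q: "saturated Q"
  have "q + (A k - k) \<in> lat - Q" if q: "q \<in> lat - Q" and k: "k \<in> lat" for q k
  proof -
    have "q = (q + (A k - k)) + (A (- k) - (- k))"
      using linear_neg[OF lin, of k] by simp
    then have "q + (A k - k) \<notin> Q"
      using Q q lat_uminus[OF k] unfolding saturated_def by (metis DiffD2)
    then show ?thesis using q k lat lat_add lat_diff by blast
  qed
  then show ?thesis by (auto simp: saturated_def)
qed

definition coset :: "real \<times> real \<Rightarrow> (real \<times> real) set" where
  "coset q = {q + (A k - k) |k. k \<in> lat}"

lemma saturated_coset: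
  assumes "q \<in> lat"
  shows "saturated (coset q)"
  unfolding saturated_def
proof (intro conjI ballI subsetI)
  fix x k assume "x \<in> coset q" "k \<in> lat"
  then obtain l where "x = q + (A l - l)" "l \<in> lat" unfolding coset_def by blast
  then have "x + (A k - k) = q + (A (l + k) - (l + k))" "l + k \<in> lat"
    using lat_add \<open>k \<in> lat\<close> by (simp_all add: linear_add[OF lin])
  then show "x + (A k - k) \<in> coset q" unfolding coset_def by blast
next
  fix x assume "x \<in> coset q"
  then show "x \<in> lat" using assms lat lat_add lat_diff unfolding coset_def by blast
qed

lemma compact_fpc:
  assumes "equivariant F" "saturated Q"
  shows "compact (fpc F Q)"
proof -
  have "compact {(t, z). t \<in> {0..1::real} \<and> z \<in> fpc F Q}"
    using continuous_on_compose2[OF equivariant_continuous_on[OF assms(1), of UNIV] continuous_on_snd[OF continuous_on_id]]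
    by (intro compact_fpc_family assms) (simp add: case_prod_unfold)
  then have "compact (snd ` {(t, z). t \<in> {0..1::real} \<and> z \<in> fpc F Q})"
    by (intro compact_continuous_image continuous_intros)
  moreover have "snd ` {(t, z). t \<in> {0..1::real} \<and> z \<in> fpc F Q} = fpc F Q"
    by (force intro: image_eqI[of _ _ "(0, _)"])
  ultimately show ?thesis by simp
qed

text \<open>The displacements in \<open>Q\<close> and those in \<open>lat - Q\<close> split the
  fixed points of the whole homotopy into two disjoint compact families, and the index of the first
  is constant.\<close>

lemma torus_fixpoint_index_homotopy:
  fixes H :: "real \<Rightarrow> real \<times> real \<Rightarrow> real \<times> real"
  assumes H: "continuous_on ({0..1} \<times> UNIV) (\<lambda>(t, \<theta>). H t \<theta>)"
    and eqv: "\<And>t. t \<in> {0..1} \<Longrightarrow> equivariant (H t)" and Q: "saturated Q"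
  shows "torus_fixpoint_index (descend (H 0)) (fpc (H 0) Q) = torus_fixpoint_index (descend (H 1)) (fpc (H 1) Q)"
proof -
  let ?C = "{(t, z). t \<in> {0..1} \<and> z \<in> fpc (H t) Q}"
  let ?O = "{(t, z). t \<in> {0..1} \<and> z \<in> fpc (H t) (lat - Q)}"
  have sub: "Q \<subseteq> lat" using Q by (simp add: saturated_def)
  have cont: "continuous_on ({0..1} \<times> torus_nbhd) (\<lambda>(t, x). (descend (H t) \<circ> torus_retraction) x)"
    by (rule continuous_on_eq[OF continuous_on_descend[OF H eqv]])
      (auto simp: descend_retraction eqv)
  \<comment> \<open>A point of the neighbourhood fixed by the composite lies on the torus, since all
    values do; the extension creates no fixed points.\<close>
  have fixed: "x \<in> torus_nbhd \<and> (descend F \<circ> torus_retraction) x = x \<longleftrightarrow> x \<in> fpc F lat" for F x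
    using torus_subset_nbhd descend_fixed[of F] torus_retraction_torus descend_in_torus
    by (metis (mono_tags, lifting) comp_apply mem_Collect_eq subsetD)
  have split: "x \<in> fpc F lat \<longleftrightarrow> x \<in> fpc F Q \<or> x \<in> fpc F (lat - Q)" for F x
    using sub by (auto simp: fpc_def)
  have idx: "torus_fixpoint_index (descend (H t)) (fpc (H t) Q) =
      euclidean_fixpoint_index (torus_nbhd - {x. (t, x) \<in> ?O}) (descend (H t) \<circ> torus_retraction)"
    if "t \<in> {0..1}" for t
  proof -
    have "{x \<in> torus. descend (H t) x = x} - fpc (H t) Q = {x. (t, x) \<in> ?O}"
      unfolding descend_fixed using that sub by (auto simp: fpc_def)
    then show ?thesis by (simp only: torus_fixpoint_index_def)
  qed
  have "euclidean_fixpoint_index (torus_nbhd - {x. (0, x) \<in> ?O}) (descend (H 0) \<circ> torus_retraction) =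
    euclidean_fixpoint_index (torus_nbhd - {x. (1, x) \<in> ?O}) (descend (H 1) \<circ> torus_retraction)"
  proof (rule euclidean_fixpoint_index_family[OF open_torus_nbhd cont])
    show "compact ?C" by (rule compact_fpc_family[OF H eqv Q])
    show "compact ?O" by (rule compact_fpc_family[OF H eqv saturated_Compl[OF Q]])
    show "?C \<inter> ?O = {}" by (auto simp: fpc_def)
    show "{(t, x). t \<in> {0..1} \<and> x \<in> torus_nbhd \<and> (descend (H t) \<circ> torus_retraction) x = x} = ?C \<union> ?O"
      unfolding fixed split by auto
  qed
  then show ?thesis by (simp only: idx atLeastAtMost_iff order_refl zero_le_one simp_thms)
qed

lemma equivariant_affine: "equivariant (\<lambda>\<theta>. A \<theta> + v)"
  unfolding equivariant_def
  by (auto intro!: continuous_intros linear_continuous_on_compose[OF _ lin] simp: linear_add[OF lin])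

lemma equivariant_convex:
  assumes "equivariant F" "equivariant G"
  shows "equivariant (\<lambda>\<theta>. (1 - t) *\<^sub>R F \<theta> + t *\<^sub>R G \<theta>)"
  unfolding equivariant_def
proof (intro conjI allI ballI)
  show "continuous_on UNIV (\<lambda>\<theta>. (1 - t) *\<^sub>R F \<theta> + t *\<^sub>R G \<theta>)"
    by (intro continuous_intros equivariant_continuous_on assms)
  show "(1 - t) *\<^sub>R F (\<theta> + k) + t *\<^sub>R G (\<theta> + k) = (1 - t) *\<^sub>R F \<theta> + t *\<^sub>R G \<theta> + A k" if "k \<in> lat" for \<theta> k
    unfolding equivariantD[OF assms(1) that] equivariantD[OF assms(2) that] by (simp add: algebra_simps)
qed

lemma continuous_on_straight_line:
  assumes "equivariant F" "equivariant G"
  shows "continuous_on ({0..1} \<times> UNIV) (\<lambda>(t, \<theta>). (1 - t) *\<^sub>R F \<theta> + t *\<^sub>R G \<theta>)"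
  unfolding case_prod_unfold
  by (intro continuous_intros continuous_on_compose2[OF equivariant_continuous_on[OF assms(1), of UNIV]]
      continuous_on_compose2[OF equivariant_continuous_on[OF assms(2), of UNIV]]) auto

text \<open>Convex combinations of lifts with the same \<open>A\<close> are again such lifts. The
  index of a class therefore depends only on \<open>A\<close> and \<open>Q\<close>.\<close>

lemma torus_fixpoint_index_equivariant_eq:
  assumes "equivariant F" "equivariant G" "saturated Q"
  shows "torus_fixpoint_index (descend F) (fpc F Q) = torus_fixpoint_index (descend G) (fpc G Q)"
  using torus_fixpoint_index_homotopy[OF continuous_on_straight_line[OF assms(1,2)] equivariant_convex[OF assms(1,2)] assms(3)]
  by simp

lemma descend_homotopic:
  assumes "equivariant F" "equivariant G"
  shows "homotopic_with_canon (\<lambda>_. True) torus torus (descend F) (descend G)"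
  unfolding homotopic_with_def
proof (intro exI conjI ballI allI)
  let ?H = "\<lambda>t \<theta>. (1 - t) *\<^sub>R F \<theta> + t *\<^sub>R G \<theta>"
  have "continuous_on ({0..1} \<times> torus) (\<lambda>z. descend (?H (fst z)) (snd z))"
    using continuous_on_subset[OF continuous_on_descend[OF continuous_on_straight_line[OF assms] equivariant_convex[OF assms]],
        of "{0..1} \<times> torus"] torus_subset_nbhd
    by (auto simp: case_prod_unfold)
  then show "continuous_map (prod_topology (top_of_set {0..1}) (top_of_set torus)) (top_of_set torus)
      (\<lambda>z. descend (?H (fst z)) (snd z))"
    by auto
qed auto

text \<open>The affine map with translation \<open>v\<close> has no fixed points at all, so every
  class of \<open>F\<close> has the index of an empty set.\<close>

lemma torus_fixpoint_index_degenerate: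
  assumes F: "equivariant F" and Q: "saturated Q" and v: "\<And>\<theta>. A \<theta> + v - \<theta> \<notin> lat"
  shows "torus_fixpoint_index (descend F) (fpc F Q) = 0"
proof -
  let ?G = "\<lambda>\<theta>. A \<theta> + v"
  have empty: "fpc ?G lat = {}" using v by (auto simp: fpc_def)
  have "torus_fixpoint_index (descend F) (fpc F Q) = torus_fixpoint_index (descend ?G) (fpc ?G Q)"
    by (rule torus_fixpoint_index_equivariant_eq[OF F equivariant_affine Q])
  also have "\<dots> = euclidean_fixpoint_index torus_nbhd (descend ?G \<circ> torus_retraction)"
    unfolding torus_fixpoint_index_def descend_fixed empty by simp
  also have "\<dots> = 0"
  proof (rule euclidean_fixpoint_index_empty[OF open_torus_nbhd])
    have False if "x \<in> torus_nbhd" "(descend ?G \<circ> torus_retraction) x = x" for x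
    proof -
      have "x \<in> torus" using that(2) descend_in_torus by (metis comp_apply)
      then have "x \<in> fpc ?G lat"
        using that(2) descend_fixed[of ?G] torus_retraction_torus by auto
      then show False using empty by simp
    qed
    then show "{x \<in> torus_nbhd. (descend ?G \<circ> torus_retraction) x = x} = {}" by blast
  qed
  finally show ?thesis .
qed

text \<open>Division by \<open>\<pi> p\<close> moves the base point to 1, where \<open>Ln\<close>
  has derivative 1. No branch cut interferes, even if \<open>\<pi> p\<close> itself lies on
  it.\<close>

lemma has_derivative_Ln_divide:
  fixes p :: C2
  assumes "\<pi> = fst \<or> \<pi> = snd" "\<pi> p \<noteq> 0"
  shows "((\<lambda>x. Im (Ln (\<pi> x / \<pi> p))) has_derivative (\<lambda>h. Im (\<pi> h / \<pi> p))) (at p)"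
proof -
  have \<pi>: "bounded_linear \<pi>"
    using assms(1) bounded_linear_fst bounded_linear_snd by auto
  have "((\<lambda>x. \<pi> x / \<pi> p) has_derivative (\<lambda>h. \<pi> h / \<pi> p)) (at p)"
    by (rule bounded_linear.has_derivative[OF bounded_linear_divide])
      (rule bounded_linear_imp_has_derivative[OF \<pi>])
  moreover have "(Ln has_derivative (*) 1) (at (\<pi> p / \<pi> p))"
    using has_field_derivative_Ln[of 1] assms(2) by (simp add: has_field_derivative_def)
  ultimately have "((\<lambda>x. Ln (\<pi> x / \<pi> p)) has_derivative (\<lambda>h. 1 * (\<pi> h / \<pi> p))) (at p)"
    by (rule has_derivative_compose)
  then have "((\<lambda>x. Im (Ln (\<pi> x / \<pi> p))) has_derivative (\<lambda>h. Im (1 * (\<pi> h / \<pi> p)))) (at p)"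
    by (rule bounded_linear.has_derivative[OF bounded_linear_Im])
  then show ?thesis by simp
qed

lemma has_derivative_cis_compose:
  fixes \<tau> :: "C2 \<Rightarrow> real"
  assumes "(\<tau> has_derivative \<tau>') (at p)" "\<tau> p = 0"
  shows "((\<lambda>x. c * cis (\<tau> x)) has_derivative (\<lambda>h. c * (\<i> * of_real (\<tau>' h)))) (at p)"
proof -
  have "((\<lambda>x. \<i> * of_real (\<tau> x)) has_derivative (\<lambda>h. \<i> * of_real (\<tau>' h))) (at p)"
    using bounded_linear.has_derivative[OF bounded_linear_of_real assms(1), where 'a1 = complex]
    by (intro has_derivative_mult_right)
  moreover have "(exp has_derivative (*) 1) (at (\<i> * of_real (\<tau> p)))"
    using DERIV_exp[of "0::complex"] assms(2) by (simp add: has_field_derivative_def)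
  ultimately have "((\<lambda>x. exp (\<i> * of_real (\<tau> x))) has_derivative (\<lambda>h. 1 * (\<i> * of_real (\<tau>' h)))) (at p)"
    by (rule has_derivative_compose)
  then show ?thesis
    unfolding cis_conv_exp by (intro has_derivative_mult_right) simp
qed

text \<open>For the linear lift \<open>A\<close> the class of \<open>q\<close> is the single point
  \<open>tor \<theta>0\<close> with \<open>A \<theta>0 - \<theta>0 = q\<close>. The displacement
  must be nondegenerate in all four real directions: the retraction kills the two radial ones, where
  the derivative of the displacement is the identity, and on the two angular ones it is
  \<open>1 - A\<close>.\<close>

lemma torus_fixpoint_index_nondegenerate:
  assumes F: "equivariant F" and inj: "inj (\<lambda>\<theta>. A \<theta> - \<theta>)" and q: "q \<in> lat"
  shows "torus_fixpoint_index (descend F) (fpc F (coset q)) \<noteq> 0"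
proof -
  let ?Q = "coset q"
  have linB: "linear (\<lambda>\<theta>. A \<theta> - \<theta>)" using lin by (intro linear_compose_sub linear_id[unfolded id_def])
  obtain \<theta>0 where "q = A \<theta>0 - \<theta>0"
    by (rule surjE[OF linear_injective_imp_surjective[OF linB inj]]) auto
  then have \<theta>0: "A \<theta>0 - \<theta>0 = q" by (rule sym)
  have sat: "saturated ?Q" by (rule saturated_coset[OF q])
  define p where "p = tor \<theta>0"
  have p: "p \<in> torus" "p \<in> torus_nbhd" using torus_subset_nbhd by (auto simp: p_def)
  have p0: "fst p \<noteq> 0" "snd p \<noteq> 0" using p(2) by (auto simp: torus_nbhd_def)
  have eqv: "equivariant A" using equivariant_affine[of 0] by simp
  have fpcQ: "fpc A ?Q = {p}"
  proof (rule Set.set_eqI)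
    fix z show "z \<in> fpc A ?Q \<longleftrightarrow> z \<in> {p}"
    proof (cases "z \<in> torus")
      case True
      define \<theta> where "\<theta> = tang z"
      have z: "z = tor \<theta>" using True by (simp add: \<theta>_def tor_tang_torus)
      have "z \<in> fpc A ?Q \<longleftrightarrow> (\<exists>k\<in>lat. A \<theta> - \<theta> = q + (A k - k))"
        unfolding z tor_in_fpc[OF eqv sat] by (auto simp: coset_def)
      also have "\<dots> \<longleftrightarrow> (\<exists>k\<in>lat. A \<theta> - \<theta> = A (\<theta>0 + k) - (\<theta>0 + k))"
        by (simp add: linear_add[OF lin] \<theta>0[symmetric] algebra_simps)
      also have "\<dots> \<longleftrightarrow> (\<exists>k\<in>lat. \<theta> = \<theta>0 + k)"
        using injD[OF inj] by blast
      also have "\<dots> \<longleftrightarrow> \<theta> - \<theta>0 \<in> lat" by (auto intro: bexI[of _ "\<theta> - \<theta>0"])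
      also have "\<dots> \<longleftrightarrow> z \<in> {p}" by (simp add: z p_def tor_eq_iff)
      finally show ?thesis .
    qed (use p in \<open>auto simp: fpc_def\<close>)
  qed
  let ?g = "descend A \<circ> torus_retraction"
  let ?V = "torus_nbhd - ({x \<in> torus. descend A x = x} - fpc A ?Q)"
  have "torus_fixpoint_index (descend F) (fpc F ?Q) = torus_fixpoint_index (descend A) (fpc A ?Q)"
    by (rule torus_fixpoint_index_equivariant_eq[OF F eqv sat])
  also have "\<dots> = euclidean_fixpoint_index ?V ?g"
    by (simp only: torus_fixpoint_index_def)
  also have "\<dots> \<noteq> 0"
  proof (rule euclidean_fixpoint_index_nondegenerate)
    have O: "{x \<in> torus. descend A x = x} - fpc A ?Q = fpc A (lat - ?Q)"
      unfolding descend_fixed by (auto simp: fpc_def)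
    show "open ?V"
      unfolding O by (intro open_Diff open_torus_nbhd compact_imp_closed compact_fpc eqv saturated_Compl sat)
    have gd: "?g x = descend A x" if "x \<in> torus_nbhd" for x
      using descend_retraction[OF eqv that] by simp
    show "continuous_on ?V ?g"
      by (rule continuous_on_eq[OF continuous_on_subset[OF continuous_on_descend_single[OF eqv]]]) (auto simp: gd[simplified])
    show "{x \<in> ?V. ?g x = x} = {p}"
    proof -
      have "x \<in> torus" if "x \<in> torus_nbhd" "?g x = x" for x
        using that descend_in_torus by (metis comp_apply)
      moreover have "x \<in> torus_nbhd" "?g x = descend A x" if "x \<in> torus" for x
        using that torus_subset_nbhd torus_retraction_torus by auto
      ultimately have "x \<in> torus_nbhd \<and> ?g x = x \<longleftrightarrow> x \<in> torus \<and> descend A x = x" for x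
        by metis
      then have "{x \<in> ?V. ?g x = x} = {x \<in> torus. descend A x = x} - fpc A (lat - ?Q)"
        unfolding O by blast
      also have "\<dots> = fpc A ?Q"
        using sat unfolding descend_fixed by (auto simp only: fpc_def saturated_def)
      finally show ?thesis using fpcQ by simp
    qed
    \<comment> \<open>\<open>T h\<close> applies \<open>A\<close> to the angular components of
      \<open>h\<close> at \<open>p\<close>; \<open>L\<close> is the resulting derivative of the
      displacement.\<close>
    define T where "T = (\<lambda>h :: C2. A (Im (fst h / fst p), Im (snd h / snd p)))"
    define L where "L = (\<lambda>h. h - (fst p * (\<i> * of_real (fst (T h))), snd p * (\<i> * of_real (snd (T h)))))"
    \<comment> \<open>Angles of the image in radians relative to \<open>p\<close>. Working with the
      quotient by \<open>p\<close> keeps them differentiable at \<open>p\<close>.\<close>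
    define a where "a = (\<lambda>x. A (2 * pi * fst (tang (tdiv x p)), 2 * pi * snd (tang (tdiv x p))))"
    have g_eq: "?g x = (fst p * cis (fst (a x)), snd p * cis (snd (a x)))" if "x \<in> torus_nbhd" for x
    proof -
      have "?g x = tor (A (\<theta>0 + tang (tdiv x p)))"
      proof -
        have "tor (tang x) = tor (\<theta>0 + tang (tdiv x p))"
          unfolding tor_tang_shift[OF that p(2), symmetric] tor_add using tor_tang_torus[OF p(1)] by (simp add: p_def)
        then show ?thesis unfolding gd[OF that] descend_def by (rule equivariant_tor[OF eqv])
      qed
      also have "\<dots> = tor (\<theta>0 + q + A (tang (tdiv x p)))"
        using \<theta>0 by (simp add: linear_add[OF lin] algebra_simps)
      also have "\<dots> = tmul p (tor (A (tang (tdiv x p))))"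
        by (simp only: tor_add[of "\<theta>0 + q"] tor_add_lat[OF q] p_def)
      also have "2 * pi * fst (A (tang (tdiv x p))) = fst (a x)" "2 * pi * snd (A (tang (tdiv x p))) = snd (a x)"
        using linear_scale[OF lin, of "2 * pi" "tang (tdiv x p)"] by (auto simp: a_def scaleR_prod_def)
      then have "tmul p (tor (A (tang (tdiv x p)))) = (fst p * cis (fst (a x)), snd p * cis (snd (a x)))"
        by (simp add: tmul_def tor_def)
      finally show ?thesis .
    qed
    have a': "(a has_derivative T) (at p)"
    proof -
      have "((\<lambda>x. (Im (Ln (fst x / fst p)), Im (Ln (snd x / snd p)))) has_derivative
          (\<lambda>h. (Im (fst h / fst p), Im (snd h / snd p)))) (at p)"
        by (intro has_derivative_Pair has_derivative_Ln_divide) (use p0 in auto)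
      from bounded_linear.has_derivative[OF linear_conv_bounded_linear[THEN iffD1, OF lin] this]
      show ?thesis by (simp add: a_def T_def tang_def tdiv_def)
    qed
    have ap: "a p = 0"
      using p0 linear_0[OF lin] by (simp add: a_def tang_def tdiv_def zero_prod_def)
    have D: "((\<lambda>x. x - (fst p * cis (fst (a x)), snd p * cis (snd (a x)))) has_derivative L) (at p)"
      unfolding L_def
      by (intro has_derivative_diff has_derivative_ident has_derivative_Pair has_derivative_cis_compose
          has_derivative_fst has_derivative_snd a') (simp_all add: ap)
    show "((\<lambda>x. x - ?g x) has_derivative L) (at p)"
      by (rule has_derivative_transform_within_open[OF D open_torus_nbhd p(2)]) (simp only: g_eq)
    show "inj L"
    proof (rule linear_injective_0[THEN iffD2, OF has_derivative_linear[OF D]], intro allI impI)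
      fix h assume "L h = 0"
      define y where "y = (fst h / fst p, snd h / snd p)"
      \<comment> \<open>A vector in the kernel has purely imaginary quotient by \<open>p\<close>,
        hence no radial part, and its angular part is fixed by \<open>A\<close>.\<close>
      have "fst h = fst p * (\<i> * of_real (fst (T h)))" "snd h = snd p * (\<i> * of_real (snd (T h)))"
        using \<open>L h = 0\<close> by (auto simp: L_def prod_eq_iff)
      then have y: "fst h / fst p = \<i> * of_real (fst (T h))" "snd h / snd p = \<i> * of_real (snd (T h))"
        using p0 by simp_all
      define \<eta> where "\<eta> = (Im (fst h / fst p), Im (snd h / snd p))"
      have "\<eta> = T h" unfolding \<eta>_def y by simp
      then have "A \<eta> - \<eta> = A 0 - 0" by (simp add: T_def \<eta>_def linear_0[OF lin])
      then have "\<eta> = 0" using injD[OF inj] by blast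
      then have "T h = 0" using \<open>\<eta> = T h\<close> by simp
      then show "h = 0" using \<open>L h = 0\<close> by (simp add: L_def prod_eq_iff)
    qed
  qed
  finally show ?thesis .
qed

end

section \<open>Lifting maps from contractible domains to the universal covering\<close>

text \<open>Both components have continuous logarithms on a contractible set. Their moduli are 1, so
  the imaginary parts alone determine the point.\<close>

lemma torus_lift_exists:
  fixes h :: "'a::real_normed_vector \<Rightarrow> C2"
  assumes "continuous_on S h" "contractible S" "h ` S \<subseteq> torus"
  obtains F where "continuous_on S F" "\<And>x. x \<in> S \<Longrightarrow> h x = tor (F x)"
proof -
  have t: "cmod (fst (h x)) = 1" "cmod (snd (h x)) = 1" if "x \<in> S" for x
    using assms(3) that by (auto simp: torus_def)
  have ne: "fst (h x) \<noteq> 0" "snd (h x) \<noteq> 0" if "x \<in> S" for x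
    using t[OF that] by auto
  obtain g1 where g1: "continuous_on S g1" "\<And>x. x \<in> S \<Longrightarrow> fst (h x) = exp (g1 x)"
    by (rule continuous_logarithm_on_contractible[OF continuous_on_fst[OF assms(1)] assms(2) ne(1)]) (assumption, rule that)
  obtain g2 where g2: "continuous_on S g2" "\<And>x. x \<in> S \<Longrightarrow> snd (h x) = exp (g2 x)"
    by (rule continuous_logarithm_on_contractible[OF continuous_on_snd[OF assms(1)] assms(2) ne(2)]) (assumption, rule that)
  have cis: "exp z = cis (Im z)" if "cmod (exp z) = 1" for z
    using that by (simp add: exp_eq_polar norm_mult)
  have "h x = tor (Im (g1 x) / (2 * pi), Im (g2 x) / (2 * pi))" if "x \<in> S" for x
  proof (rule prod_eqI)
    show "fst (h x) = fst (tor (Im (g1 x) / (2 * pi), Im (g2 x) / (2 * pi)))"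
      using cis[of "g1 x"] g1(2)[OF that] t(1)[OF that] by (simp add: tor_def)
    show "snd (h x) = snd (tor (Im (g1 x) / (2 * pi), Im (g2 x) / (2 * pi)))"
      using cis[of "g2 x"] g2(2)[OF that] t(2)[OF that] by (simp add: tor_def)
  qed
  moreover have "continuous_on S (\<lambda>x. (Im (g1 x) / (2 * pi), Im (g2 x) / (2 * pi)))"
    by (intro continuous_intros g1 g2) auto
  ultimately show thesis by (intro that)
qed

subsection \<open>The degree of a path on the torus\<close>

text \<open>For paths on the torus the winding numbers are real, as the moduli are constantly 1, so
  \<open>Re\<close> loses nothing. For a loop this is its class in the first homology of the torus;
  for a general path it is the displacement of a lift.\<close>

definition tdeg :: "(real \<Rightarrow> C2) \<Rightarrow> real \<times> real" where
  "tdeg p = (Re (winding_number (fst \<circ> p) 0), Re (winding_number (snd \<circ> p) 0))"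

lemma continuous_torus_component:
  assumes "\<pi> = fst \<or> \<pi> = snd"
  shows "continuous_on torus \<pi>" "\<pi> \<in> torus \<rightarrow> - {0 :: complex}"
  using assms by (auto simp: torus_def intro: continuous_intros)

lemma path_torus_component:
  assumes "\<pi> = fst \<or> \<pi> = snd" "path p" "path_image p \<subseteq> torus"
  shows "path (\<pi> \<circ> p)" "0 \<notin> path_image (\<pi> \<circ> p)"
proof -
  show "path (\<pi> \<circ> p)"
    using path_continuous_image[OF assms(2)] continuous_torus_component(1)[OF assms(1)] assms(3)
      continuous_on_subset by blast
  show "0 \<notin> path_image (\<pi> \<circ> p)"
    using continuous_torus_component(2)[OF assms(1)] assms(3) by (auto simp: path_image_compose)
qed

lemma tdeg_homotopic:
  assumes "homotopic_paths torus p q"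
  shows "tdeg p = tdeg q"
proof -
  have "winding_number (\<pi> \<circ> p) 0 = winding_number (\<pi> \<circ> q) 0" if "\<pi> = fst \<or> \<pi> = snd" for \<pi>
    by (rule winding_number_homotopic_paths, rule homotopic_paths_continuous_image[OF assms])
      (use continuous_torus_component[OF that] in auto)
  then show ?thesis by (simp add: tdeg_def)
qed

lemma tdeg_join:
  assumes "path p" "path_image p \<subseteq> torus" "path q" "path_image q \<subseteq> torus" "pathfinish p = pathstart q"
  shows "tdeg (p +++ q) = tdeg p + tdeg q"
proof -
  have "winding_number (\<pi> \<circ> (p +++ q)) 0 = winding_number (\<pi> \<circ> p) 0 + winding_number (\<pi> \<circ> q) 0"
    if "\<pi> = fst \<or> \<pi> = snd" for \<pi>
    unfolding path_compose_join
    by (rule winding_number_join)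
      (use path_torus_component[OF that] assms in \<open>auto simp: pathfinish_compose pathstart_compose\<close>)
  then show ?thesis by (simp add: tdeg_def)
qed

lemma tdeg_reversepath:
  assumes "path p" "path_image p \<subseteq> torus"
  shows "tdeg (reversepath p) = - tdeg p"
proof -
  have "winding_number (\<pi> \<circ> reversepath p) 0 = - winding_number (\<pi> \<circ> p) 0"
    if "\<pi> = fst \<or> \<pi> = snd" for \<pi>
    unfolding path_compose_reversepath
    by (rule winding_number_reversepath) (use path_torus_component[OF that assms] in auto)
  then show ?thesis by (simp add: tdeg_def)
qed

lemma tdeg_in_lat:
  assumes "path p" "path_image p \<subseteq> torus" "pathfinish p = pathstart p"
  shows "tdeg p \<in> lat"
proof -
  have "Re (winding_number (\<pi> \<circ> p) 0) \<in> \<int>" if "\<pi> = fst \<or> \<pi> = snd" for \<pi>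
  proof -
    have "winding_number (\<pi> \<circ> p) 0 \<in> \<int>"
      by (rule integer_winding_number)
        (use path_torus_component[OF that assms(1,2)] assms(3) in \<open>auto simp: pathfinish_compose pathstart_compose\<close>)
    then show ?thesis by (auto elim!: Ints_cases)
  qed
  then show ?thesis by (simp add: tdeg_def mem_lat)
qed

text \<open>Each component is the exponential of \<open>2 * pi * \<i>\<close> times a coordinate of
  the lift, and the winding number of an exponential is read off from the endpoints of the
  exponent.\<close>

lemma tdeg_lift:
  assumes P: "path P" and p: "\<And>t. t \<in> {0..1} \<Longrightarrow> p t = tor (P t)"
  shows "tdeg p = P 1 - P 0"
proof -
  have "winding_number (\<pi> \<circ> p) 0 = of_real (\<rho> (P 1) - \<rho> (P 0))"
    if \<pi>: "\<pi> = fst \<and> \<rho> = fst \<or> \<pi> = snd \<and> \<rho> = snd"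
    for \<pi> :: "C2 \<Rightarrow> complex" and \<rho> :: "real \<times> real \<Rightarrow> real"
  proof -
    let ?Q = "\<lambda>t. 2 * of_real pi * \<i> * of_real (\<rho> (P t))"
    have Q: "path ?Q"
      using P \<pi> unfolding path_def by (auto intro!: continuous_intros)
    have eq: "(\<pi> \<circ> p) t = (exp \<circ> ?Q) t" if "t \<in> {0..1}" for t
      using p[OF that] \<pi> by (auto simp: tor_def cis_conv_exp mult_ac)
    have pQ: "path (exp \<circ> ?Q)"
      using Q by (intro path_continuous_image) (auto intro: continuous_intros)
    have "homotopic_paths (- {0}) (exp \<circ> ?Q) (\<pi> \<circ> p)"
      by (rule homotopic_paths_eq) (use pQ eq in \<open>auto simp: path_image_def\<close>)
    then have "winding_number (\<pi> \<circ> p) 0 = winding_number (exp \<circ> ?Q) 0"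
      by (rule winding_number_homotopic_paths[symmetric])
    also have "\<dots> = (pathfinish ?Q - pathstart ?Q) / (2 * of_real pi * \<i>)"
      by (rule winding_number_compose_exp[OF Q])
    also have "\<dots> = of_real (\<rho> (P 1) - \<rho> (P 0))"
      by (simp add: pathfinish_def pathstart_def field_simps)
    finally show ?thesis .
  qed
  from this[of fst fst] this[of snd snd] show ?thesis
    by (simp add: tdeg_def prod_eq_iff)
qed

lemma torus_path_lift:
  assumes "path p" "path_image p \<subseteq> torus"
  obtains P where "path P" "\<And>t. t \<in> {0..1} \<Longrightarrow> p t = tor (P t)"
  by (rule torus_lift_exists[of "{0..1}" p])
    (use assms in \<open>auto simp: path_def path_image_def intro: convex_imp_contractible\<close>)

lemma meridian_tor: "meridian (tor \<theta>) t = tor (\<theta> + (t, 0))"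
  and longitude_tor: "longitude (tor \<theta>) t = tor (\<theta> + (0, t))"
  by (simp_all add: meridian_def longitude_def tor_def cis_mult distrib_left)

lemma meridian_longitude_loop:
  assumes "z \<in> torus"
  shows "path (meridian z)" "path_image (meridian z) \<subseteq> torus" "pathstart (meridian z) = z" "pathfinish (meridian z) = z"
    "path (longitude z)" "path_image (longitude z) \<subseteq> torus" "pathstart (longitude z) = z" "pathfinish (longitude z) = z"
proof -
  have z: "z = tor (tang z)" using tor_tang_torus[OF assms] by simp
  show "path (meridian z)" "path (longitude z)"
    by (auto simp: path_def meridian_def longitude_def intro!: continuous_intros)
  show "path_image (meridian z) \<subseteq> torus" "path_image (longitude z) \<subseteq> torus"
    by (subst z, auto simp: path_image_def meridian_tor longitude_tor)+
  show "pathstart (meridian z) = z" "pathfinish (meridian z) = z" "pathstart (longitude z) = z" "pathfinish (longitude z) = z"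
    by (simp_all add: pathstart_def pathfinish_def meridian_def longitude_def)
qed

lemma tdeg_image_meridian_longitude:
  assumes "continuous_on UNIV F" "\<And>\<theta>. f (tor \<theta>) = tor (F \<theta>)"
  shows "tdeg (f \<circ> meridian (tor \<theta>)) = F (\<theta> + (1, 0)) - F \<theta>"
    "tdeg (f \<circ> longitude (tor \<theta>)) = F (\<theta> + (0, 1)) - F \<theta>"
proof -
  have "path (\<lambda>t. F (\<theta> + (t, 0)))" "path (\<lambda>t. F (\<theta> + (0, t)))"
    unfolding path_def by (intro continuous_on_compose2[OF assms(1)] continuous_intros subset_UNIV)+
  from this[THEN tdeg_lift] show
    "tdeg (f \<circ> meridian (tor \<theta>)) = F (\<theta> + (1, 0)) - F \<theta>"
    "tdeg (f \<circ> longitude (tor \<theta>)) = F (\<theta> + (0, 1)) - F \<theta>"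
    by (simp_all add: meridian_tor longitude_tor assms(2) flip: zero_prod_def)
qed

section \<open>Lifts of self-maps and their integral matrices\<close>

lemma continuous_Ints_constant:
  fixes f :: "'a::topological_space \<Rightarrow> real"
  assumes "connected S" "continuous_on S f" "\<And>x. x \<in> S \<Longrightarrow> f x \<in> \<int>" "x \<in> S" "y \<in> S"
  shows "f x = f y"
proof -
  have "f constant_on S"
  proof (rule continuous_discrete_range_constant[OF assms(1,2)])
    show "\<exists>e>0. \<forall>y. y \<in> S \<and> f y \<noteq> f x \<longrightarrow> e \<le> norm (f y - f x)" if "x \<in> S" for x
      using Ints_nonzero_abs_ge1[of "f _ - f x"] assms(3) that by (intro exI[of _ 1]) auto
  qed
  then show ?thesis using assms(4,5) by (auto simp: constant_on_def)
qed

lemma continuous_lat_constant: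
  assumes "connected S" "continuous_on S f" "\<And>x. x \<in> S \<Longrightarrow> f x \<in> lat" "x \<in> S" "y \<in> S"
  shows "f x = f y"
  using continuous_Ints_constant[OF assms(1) continuous_on_fst[OF assms(2)], of x y]
    continuous_Ints_constant[OF assms(1) continuous_on_snd[OF assms(2)], of x y] assms(3-5)
  by (simp add: mem_lat prod_eq_iff)

text \<open>The entries are listed by rows, so the images of the basis vectors are
  \<open>(a, c)\<close> and \<open>(b, d)\<close>. In \<open>proposition5\<close>, in contrast,
  \<open>(a, b)\<close> and \<open>(c, d)\<close> are the columns.\<close>

definition lin2 :: "int \<Rightarrow> int \<Rightarrow> int \<Rightarrow> int \<Rightarrow> real \<times> real \<Rightarrow> real \<times> real" where
  "lin2 a b c d \<theta> = (of_int a * fst \<theta> + of_int b * snd \<theta>, of_int c * fst \<theta> + of_int d * snd \<theta>)"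

lemma lattice_linear_lin2: "lattice_linear (lin2 a b c d)"
proof (rule lattice_linear.intro)
  show "linear (lin2 a b c d)"
    by (rule linearI) (auto simp: lin2_def algebra_simps)
  show "lin2 a b c d k \<in> lat" if "k \<in> lat" for k
    using that by (auto simp: mem_lat lin2_def)
qed

text \<open>For a lattice vector \<open>k\<close> the difference
  \<open>F (\<theta> + k) - F \<theta>\<close> is continuous and lattice valued, hence independent
  of \<open>\<theta>\<close>. At a lift of \<open>z\<close> and a unit vector it is the degree of
  the image of the meridian or the longitude.\<close>

lemma lift_equivariant:
  assumes F: "continuous_on UNIV F" "\<And>\<theta>. f (tor \<theta>) = tor (F \<theta>)"
    and m: "tdeg (f \<circ> meridian z) = (of_int a, of_int c)" and l: "tdeg (f \<circ> longitude z) = (of_int b, of_int d)"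
    and z: "z \<in> torus"
  shows "lattice_linear.equivariant (lin2 a b c d) F"
proof -
  have step: "F (\<theta> + k) - F \<theta> = F (\<eta> + k) - F \<eta>" if k: "k \<in> lat" for k \<theta> \<eta>
  proof -
    have "F (\<theta> + k) - F \<theta> \<in> lat" for \<theta>
      using F(2)[of "\<theta> + k"] F(2)[of \<theta>] k by (simp add: tor_add_lat flip: tor_eq_iff)
    moreover have "continuous_on UNIV (\<lambda>\<theta>. F (\<theta> + k) - F \<theta>)"
      by (intro continuous_intros continuous_on_compose2[OF F(1)]) auto
    ultimately show ?thesis
      using continuous_lat_constant[OF connected_UNIV, of "\<lambda>\<theta>. F (\<theta> + k) - F \<theta>"] by blast
  qed
  define \<zeta> where "\<zeta> = tang z"
  have z': "z = tor \<zeta>" using tor_tang_torus[OF z] by (simp add: \<zeta>_def)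
  have e1: "F (\<theta> + (1, 0)) = F \<theta> + (of_int a, of_int c)" for \<theta>
  proof -
    have "F (\<theta> + (1, 0)) - F \<theta> = F (\<zeta> + (1, 0)) - F \<zeta>"
      by (rule step) (simp add: mem_lat)
    also have "\<dots> = (of_int a, of_int c)"
      using tdeg_image_meridian_longitude(1)[of F f \<zeta>, OF F] m z' by simp
    finally show ?thesis by (simp add: diff_eq_eq add.commute)
  qed
  have e2: "F (\<theta> + (0, 1)) = F \<theta> + (of_int b, of_int d)" for \<theta>
  proof -
    have "F (\<theta> + (0, 1)) - F \<theta> = F (\<zeta> + (0, 1)) - F \<zeta>"
      by (rule step) (simp add: mem_lat)
    also have "\<dots> = (of_int b, of_int d)"
      using tdeg_image_meridian_longitude(2)[of F f \<zeta>, OF F] l z' by simp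
    finally show ?thesis by (simp add: diff_eq_eq add.commute)
  qed
  have iter: "F (\<theta> + of_int i *\<^sub>R e) = F \<theta> + of_int i *\<^sub>R v"
    if "\<And>\<theta>. F (\<theta> + e) = F \<theta> + v" for e v \<theta> and i :: int
  proof (induction i rule: int_induct[of _ 0])
    case (step1 i)
    then show ?case using that[of "\<theta> + of_int i *\<^sub>R e"] by (simp add: algebra_simps)
  next
    case (step2 i)
    then show ?case using that[of "\<theta> + of_int (i - 1) *\<^sub>R e"] by (simp add: algebra_simps)
  qed simp
  interpret lattice_linear "lin2 a b c d" by (rule lattice_linear_lin2)
  show ?thesis
    unfolding equivariant_def
  proof (intro conjI allI ballI F(1))
    fix \<theta> k :: "real \<times> real" assume "k \<in> lat"
    then obtain i j where k: "k = (of_int i, of_int j)"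
      by (cases k) (auto simp: mem_lat elim!: Ints_cases)
    have "F (\<theta> + k) = F (\<theta> + of_int i *\<^sub>R (1, 0) + of_int j *\<^sub>R (0, 1))"
      by (cases \<theta>) (simp add: k)
    also have "\<dots> = F \<theta> + of_int i *\<^sub>R (of_int a, of_int c) + of_int j *\<^sub>R (of_int b, of_int d)"
      by (simp only: iter[OF e1] iter[OF e2])
    also have "\<dots> = F \<theta> + lin2 a b c d k"
      by (simp add: lin2_def k mult.commute)
    finally show "F (\<theta> + k) = F \<theta> + lin2 a b c d k" .
  qed
qed

subsection \<open>Lattices in the plane\<close>

lemma det2: "det (vector [vector [p, q], vector [r, s]] :: int ^ 2 ^ 2) = p * s - q * r"
  by (simp add: det_2 vector_2)

lemma Z2_int_pow: "(x :: int \<times> int) [^]\<^bsub>Z2\<^esub> (k::int) = (k * fst x, k * snd x)"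
proof -
  have "group Z2" by (intro DirProd_group) auto
  moreover have "fst \<in> hom Z2 integer_group" "snd \<in> hom Z2 integer_group"
    by (auto simp: hom_def)
  ultimately have "fst (x [^]\<^bsub>Z2\<^esub> k) = k * fst x" "snd (x [^]\<^bsub>Z2\<^esub> k) = k * snd x"
    using hom_int_pow[of _ Z2 integer_group x k] by auto
  then show ?thesis by (simp add: prod_eq_iff)
qed

text \<open>Here \<open>g\<close> is \<open>z\<close> divided by the gcd of its coordinates. As the
  coordinates of \<open>g\<close> are coprime, an integral vector parallel to \<open>z\<close> is an
  integral multiple of \<open>g\<close>.\<close>

lemma primitive_multiple:
  fixes z :: "int \<times> int"
  assumes "z \<noteq> (0, 0)"
  obtains g where "\<And>x. fst x * snd z = snd x * fst z \<Longrightarrow> \<exists>k. x = (k * fst g, k * snd g)"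
proof -
  define h where "h = gcd (fst z) (snd z)"
  have h: "h \<noteq> 0" using assms by (cases z) (auto simp: h_def)
  define g where "g = (fst z div h, snd z div h)"
  have z: "fst z = h * fst g" "snd z = h * snd g" by (simp_all add: g_def h_def)
  have cop: "coprime (fst g) (snd g)"
    using assms by (cases z) (auto simp: g_def h_def intro: div_gcd_coprime)
  have "\<exists>k. x = (k * fst g, k * snd g)" if "fst x * snd z = snd x * fst z" for x
  proof -
    have eq: "fst x * snd g = snd x * fst g" using that h by (simp add: z algebra_simps)
    then have "fst g dvd fst x"
      using cop by (metis coprime_dvd_mult_left_iff dvd_triv_right)
    then obtain k where k: "fst x = k * fst g" by (metis dvdE mult.commute)
    show ?thesis
    proof (cases "fst g = 0")
      case True
      \<comment> \<open>In this case \<open>snd g\<close> is a sign, hence its own inverse, which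
        explains the factor \<open>snd x * snd g\<close>.\<close>
      then have "\<bar>snd g\<bar> = 1" using cop by simp
      moreover have "fst x = 0" using k True by simp
      ultimately show ?thesis using True
        by (intro exI[of _ "snd x * snd g"]) (auto simp: prod_eq_iff abs_if split: if_splits)
    next
      case False
      have "snd x * fst g = fst x * snd g" by (rule eq[symmetric])
      also have "\<dots> = (k * snd g) * fst g" by (simp only: k ac_simps)
      finally have "snd x * fst g = (k * snd g) * fst g" .
      then have "snd x = k * snd g" by (rule mult_right_cancel[OF False, THEN iffD1])
      then show ?thesis using k by (metis prod.collapse)
    qed
  qed
  then show thesis by (rule that)
qed

text \<open>Put \<open>p = (a - 1, b)\<close>, \<open>q = (c, d - 1)\<close> and
  \<open>z = r q - s p\<close>. The second determinant equals the first plus the determinant of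
  \<open>(m, n)\<close> and \<open>z\<close>. If both vanish, then \<open>p\<close>,
  \<open>q\<close> and \<open>(m, n)\<close> are all parallel to \<open>z\<close>: either
  \<open>z\<close> is nonzero and they are multiples of one primitive vector, or
  \<open>z = 0\<close>, which is the second alternative.\<close>

lemma fixed_point_free_conditions:
  fixes r s a b c d m n :: int
  assumes rs: "(r, s) \<noteq> (0, 0)"
  shows "(a - 1) * (d - 1) - c * b = 0 \<and> (r * m + a - 1) * (s * n + d - 1) - (s * m + c) * (r * n + b) = 0 \<longleftrightarrow>
    (\<exists>g. {(a - 1, b), (c, d - 1), (m, n)} \<subseteq> carrier (subgroup_generated Z2 {g})) \<or>
    (s * (a - 1), s * b) = (r * c, r * (d - 1))"
    (is "?L \<longleftrightarrow> ?A \<or> ?B")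
proof -
  define p1 p2 q1 q2 where "p1 = a - 1" "p2 = b" "q1 = c" "q2 = d - 1"
  note defs = p1_p2_q1_q2_def
  have expand: "(r * m + a - 1) * (s * n + d - 1) - (s * m + c) * (r * n + b) =
      (p1 * q2 - q1 * p2) + m * (r * q2 - s * p2) - n * (r * q1 - s * p1)"
    by (simp add: defs algebra_simps)
  have L: "?L \<longleftrightarrow> p1 * q2 = q1 * p2 \<and> m * (r * q2 - s * p2) = n * (r * q1 - s * p1)"
    unfolding expand by (auto simp: defs)
  have carrier: "x \<in> carrier (subgroup_generated Z2 {g}) \<longleftrightarrow> (\<exists>k. x = (k * fst g, k * snd g))" for x g
  proof -
    have "group Z2" by (intro DirProd_group) auto
    then have "carrier (subgroup_generated Z2 {g}) = range (\<lambda>k::int. g [^]\<^bsub>Z2\<^esub> k)"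
      by (intro group.carrier_subgroup_generated_by_singleton) (auto simp: DirProd_def)
    then show ?thesis by (auto simp: Z2_int_pow)
  qed
  show ?thesis
  proof
    assume ?L
    with L have "p1 * q2 = q1 * p2 \<and> m * (r * q2 - s * p2) = n * (r * q1 - s * p1)"
      by (rule iffD1)
    then have 1: "p1 * q2 = q1 * p2" and 2: "m * (r * q2 - s * p2) = n * (r * q1 - s * p1)"
      by simp_all
    define z where "z = (r * q1 - s * p1, r * q2 - s * p2)"
    show "?A \<or> ?B"
    proof (cases "z = (0, 0)")
      case True
      then have ?B by (auto simp: z_def defs)
      then show ?thesis ..
    next
      case False
      then obtain g where g: "\<And>x. fst x * snd z = snd x * fst z \<Longrightarrow> \<exists>k. x = (k * fst g, k * snd g)"
        using primitive_multiple by blast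
      have "p1 * snd z = p2 * fst z" "q1 * snd z = q2 * fst z" "m * snd z = n * fst z"
        using 1 2 by (auto simp: z_def algebra_simps)
      then have "{(p1, p2), (q1, q2), (m, n)} \<subseteq> carrier (subgroup_generated Z2 {g})"
        using g[of "(p1, p2)"] g[of "(q1, q2)"] g[of "(m, n)"] by (simp add: carrier)
      then have ?A unfolding defs by blast
      then show ?thesis ..
    qed
  next
    assume "?A \<or> ?B"
    then show ?L
    proof
      assume ?A
      then obtain g where "{(p1, p2), (q1, q2), (m, n)} \<subseteq> carrier (subgroup_generated Z2 {g})"
        by (auto simp: defs)
      then obtain i j k where "p1 = i * fst g" "p2 = i * snd g" "q1 = j * fst g" "q2 = j * snd g"
        "m = k * fst g" "n = k * snd g"
        by (auto simp: carrier)
      then show ?L unfolding L by (simp add: algebra_simps)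
    next
      assume ?B
      then have B: "s * p1 = r * q1" "s * p2 = r * q2" by (simp_all add: defs)
      \<comment> \<open>Since \<open>(r, s)\<close> is nonzero, the relation
        \<open>s p = r q\<close> makes \<open>p\<close> and \<open>q\<close> parallel.\<close>
      then have "p1 * q2 = p2 * q1"
      proof (cases "r = 0")
        case True
        then show ?thesis using B rs by auto
      next
        case False
        have "r * (p1 * q2) = p1 * (r * q2)" by (simp only: ac_simps)
        also have "\<dots> = p1 * (s * p2)" by (simp only: B(2))
        also have "\<dots> = p2 * (s * p1)" by (simp only: ac_simps)
        also have "\<dots> = p2 * (r * q1)" by (simp only: B(1))
        also have "\<dots> = r * (p2 * q1)" by (simp only: ac_simps)
        finally show ?thesis using False by simp
      qed
      then show ?L unfolding L using B by (simp add: mult.commute)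
    qed
  qed
qed

text \<open>The columns \<open>(p, r)\<close> and \<open>(q, s)\<close> are replaced by \<open>(\<alpha>, g)\<close> and \<open>(\<beta>, 0)\<close> with \<open>g = gcd r s\<close>;
  the box \<open>[0, \<bar>\<beta>\<bar>) \<times> [0, g)\<close> is then a system of representatives.\<close>

lemma lattice_representatives:
  fixes p q r s :: int
  defines "L \<equiv> {(p * i + q * j, r * i + s * j) |i j. True}"
  assumes det: "p * s - q * r \<noteq> 0"
  obtains B where "card B = nat \<bar>p * s - q * r\<bar>"
    "\<forall>v. \<exists>w\<in>B. v - w \<in> L" "\<forall>v\<in>B. \<forall>w\<in>B. v - w \<in> L \<longrightarrow> v = w"
proof -
  define g where "g = gcd r s"
  have g: "g > 0" using det by (auto simp: g_def)
  obtain x y where bez: "x * r + y * s = g" using bezout_int g_def by blast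
  obtain r' s' where rs: "r = g * r'" "s = g * s'" by (metis g_def gcd_dvd1 gcd_dvd2 dvdE)
  have unimod: "x * r' + y * s' = 1"
  proof -
    have "g * (x * r' + y * s') = g * 1" using bez rs by (simp add: algebra_simps)
    then show ?thesis using g by (simp only: mult_cancel_left) auto
  qed
  \<comment> \<open>The new columns are \<open>x (p, r) + y (q, s)\<close> and
    \<open>s' (p, r) - r' (q, s)\<close>. This change of basis has determinant -1 by
    \<open>unimod\<close>, so the lattice is unchanged.\<close>
  define \<alpha> where "\<alpha> = p * x + q * y"
  define \<beta> where "\<beta> = p * s' - q * r'"
  have \<beta>: "g * \<beta> = p * s - q * r" by (simp add: \<beta>_def rs algebra_simps)
  then have "\<beta> \<noteq> 0" using det by auto
  have L: "L = {(i * \<alpha> + j * \<beta>, i * g) |i j. True}"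
  proof (rule equalityI; rule subsetI)
    fix z assume "z \<in> L"
    then obtain i j where z: "z = (p * i + q * j, r * i + s * j)" by (auto simp: L_def)
    \<comment> \<open>\<open>k\<close> and \<open>l\<close> are the coordinates of
      \<open>(i, j)\<close> in the new basis, found by inverting the unimodular matrix.\<close>
    define k where "k = r' * i + s' * j"
    define l where "l = y * i - x * j"
    have i: "i = k * x + l * s'"
    proof -
      have "k * x + l * s' = i * (x * r' + y * s')" by (simp add: k_def l_def algebra_simps)
      then show ?thesis by (simp add: unimod)
    qed
    have j: "j = k * y - l * r'"
    proof -
      have "k * y - l * r' = j * (x * r' + y * s')" by (simp add: k_def l_def algebra_simps)
      then show ?thesis by (simp add: unimod)
    qed
    have "p * i + q * j = k * \<alpha> + l * \<beta>"
      by (subst i, subst j) (simp add: \<alpha>_def \<beta>_def algebra_simps)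
    moreover have "r * i + s * j = k * g" by (simp add: rs k_def algebra_simps)
    ultimately show "z \<in> {(i * \<alpha> + j * \<beta>, i * g) |i j. True}" using z by auto
  next
    fix z assume "z \<in> {(i * \<alpha> + j * \<beta>, i * g) |i j. True}"
    then obtain k l where z: "z = (k * \<alpha> + l * \<beta>, k * g)" by auto
    have "k * \<alpha> + l * \<beta> = p * (k * x + l * s') + q * (k * y - l * r')"
      by (simp add: \<alpha>_def \<beta>_def algebra_simps)
    moreover have "k * g = r * (k * x + l * s') + s * (k * y - l * r')"
      by (subst bez[symmetric]) (simp add: rs algebra_simps)
    ultimately show "z \<in> L" unfolding L_def z by blast
  qed
  let ?B = "{0..<\<bar>\<beta>\<bar>} \<times> {0..<g}"
  show thesis
  proof (rule that[of ?B]; (intro allI ballI impI)?)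
    have "card ?B = nat \<bar>\<beta>\<bar> * nat g" by (simp add: card_cartesian_product)
    also have "\<dots> = nat \<bar>g * \<beta>\<bar>" using g by (simp add: abs_mult nat_mult_distrib ac_simps)
    finally show "card ?B = nat \<bar>p * s - q * r\<bar>" by (simp only: \<beta>)
  next
    fix v w assume v: "v \<in> ?B" and w: "w \<in> ?B" and "v - w \<in> L"
    then obtain i j where ij: "v - w = (i * \<alpha> + j * \<beta>, i * g)" unfolding L by auto
    have "\<bar>i * g\<bar> < g"
      using ij v w by (auto simp: prod_eq_iff)
    then have "i = 0" using g by (simp add: abs_mult)
    then have "\<bar>j * \<beta>\<bar> < \<bar>\<beta>\<bar>" using ij v w by (auto simp: prod_eq_iff)
    then have "j = 0" using \<open>\<beta> \<noteq> 0\<close> by (simp add: abs_mult)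
    then show "v = w" using ij \<open>i = 0\<close> by (simp add: prod_eq_iff)
  next
    fix v :: "int \<times> int"
    define i where "i = snd v div g"
    define v' where "v' = v - (i * \<alpha>, i * g)"
    \<comment> \<open>The second coordinate is reduced modulo \<open>g\<close> before the first. The
      sign compensates for dividing by the absolute value of \<open>\<beta>\<close>.\<close>
    define j where "j = sgn \<beta> * (fst v' div \<bar>\<beta>\<bar>)"
    define w where "w = v' - (j * \<beta>, 0)"
    have "snd w = snd v mod g" by (simp add: w_def v'_def i_def minus_div_mult_eq_mod)
    moreover have "fst w = fst v' mod \<bar>\<beta>\<bar>"
    proof -
      have "j * \<beta> = (fst v' div \<bar>\<beta>\<bar>) * \<bar>\<beta>\<bar>" by (simp add: j_def abs_sgn ac_simps)
      then show ?thesis by (simp add: w_def minus_div_mult_eq_mod)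
    qed
    ultimately have "w \<in> ?B" using g \<open>\<beta> \<noteq> 0\<close> by (cases w) auto
    moreover have "v - w = (i * \<alpha> + j * \<beta>, i * g)" by (simp add: w_def v'_def prod_eq_iff)
    then have "v - w \<in> L" unfolding L by blast
    ultimately show "\<exists>w\<in>?B. v - w \<in> L" by blast
  qed
qed

subsection \<open>Fixed point classes of self-maps of the torus\<close>

lemma tdeg_homotopic_loops:
  assumes "homotopic_loops torus p q"
  shows "tdeg p = tdeg q"
proof -
  have "winding_number (\<pi> \<circ> p) 0 = winding_number (\<pi> \<circ> q) 0" if "\<pi> = fst \<or> \<pi> = snd" for \<pi>
    by (rule winding_number_homotopic_loops, rule homotopic_loops_continuous_image[OF assms])
      (use continuous_torus_component[OF that] in auto)
  then show ?thesis by (simp add: tdeg_def)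
qed

text \<open>A homotopy of maps moves the base point, so it yields only a free homotopy of the image
  loops; winding numbers are invariant under these as well.\<close>

lemma tdeg_homotopic_maps:
  assumes hom: "homotopic_with_canon (\<lambda>_. True) torus torus f g"
    and p: "path p" "path_image p \<subseteq> torus" "pathfinish p = pathstart p"
  shows "tdeg (f \<circ> p) = tdeg (g \<circ> p)"
proof (rule tdeg_homotopic_loops)
  have "homotopic_with_canon (\<lambda>h. pathfinish (h \<circ> p) = pathstart (h \<circ> p)) torus torus f g"
    by (rule homotopic_with_mono[OF hom]) (simp add: pathfinish_compose pathstart_compose p)
  then show "homotopic_loops torus (f \<circ> p) (g \<circ> p)"
    unfolding homotopic_loops_def
    by (rule homotopic_with_compose_continuous_right)
      (use p in \<open>auto simp: path_def path_image_def\<close>)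
qed

lemma degree_lift:
  assumes f: "continuous_on torus f" "f ` torus \<subseteq> torus" and z: "z \<in> torus"
    and "tdeg (f \<circ> meridian z) = (of_int a, of_int c)" "tdeg (f \<circ> longitude z) = (of_int b, of_int d)"
  obtains F where "lattice_linear.equivariant (lin2 a b c d) F" "\<And>x. x \<in> torus \<Longrightarrow> f x = descend F x"
proof -
  have "continuous_on UNIV (\<lambda>\<theta>. f (tor \<theta>))"
    by (rule continuous_on_compose2[OF f(1)]) (auto intro: continuous_intros)
  moreover have "(\<lambda>\<theta>. f (tor \<theta>)) ` UNIV \<subseteq> torus" using f(2) by auto
  ultimately obtain F where F: "continuous_on UNIV F" "\<And>\<theta>. \<theta> \<in> UNIV \<Longrightarrow> f (tor \<theta>) = tor (F \<theta>)"
    using torus_lift_exists[OF _ contractible_UNIV] by metis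
  have "lattice_linear.equivariant (lin2 a b c d) F"
    by (rule lift_equivariant[OF F(1) _ assms(4,5) z]) (simp add: F(2))
  moreover have "f x = descend F x" if "x \<in> torus" for x
    using F(2)[of "tang x"] tor_tang_torus[OF that] by (simp add: descend_def)
  ultimately show thesis by (rule that)
qed

definition homotopic_to_image :: "(C2 \<Rightarrow> C2) \<Rightarrow> C2 \<Rightarrow> C2 \<Rightarrow> (real \<Rightarrow> C2) \<Rightarrow> bool" where
  "homotopic_to_image f x y p \<longleftrightarrow> path p \<and> path_image p \<subseteq> torus \<and> pathstart p = x \<and> pathfinish p = y \<and>
    homotopic_paths torus (f \<circ> p) p"

context lattice_linear
begin

lemma mem_coset: "x \<in> coset q \<longleftrightarrow> (\<exists>k\<in>lat. x = q + (A k - k))"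
  by (auto simp: coset_def)

lemma coset_self: "q \<in> coset q"
  unfolding mem_coset using lat_0 linear_0[OF lin] by (intro bexI[of _ 0]) auto

lemma coset_sym: "x \<in> coset q \<Longrightarrow> q \<in> coset x"
proof -
  assume "x \<in> coset q"
  then obtain k where "k \<in> lat" "x = q + (A k - k)" by (auto simp: mem_coset)
  then have "q = x + (A (- k) - (- k))" by (simp add: linear_neg[OF lin])
  then show ?thesis unfolding mem_coset using lat_uminus[OF \<open>k \<in> lat\<close>] by blast
qed

lemma coset_trans: "x \<in> coset y \<Longrightarrow> y \<in> coset z \<Longrightarrow> x \<in> coset z"
proof -
  assume "x \<in> coset y" "y \<in> coset z"
  then obtain k l where k: "k \<in> lat" "x = y + (A k - k)" and l: "l \<in> lat" "y = z + (A l - l)"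
    by (auto simp: mem_coset)
  then have "x = z + (A (k + l) - (k + l))" by (simp add: linear_add[OF lin])
  then show ?thesis unfolding mem_coset using lat_add[OF k(1) l(1)] by blast
qed

lemma coset_eq: "x \<in> coset q \<Longrightarrow> coset x = coset q"
  using coset_sym coset_trans by blast

lemma coset_lat: "q \<in> lat \<Longrightarrow> coset q \<subseteq> lat"
  using saturated_coset by (auto simp: saturated_def)

lemma fpc_coset_unique:
  assumes "z \<in> fpc F (coset q)"
  shows "coset q = coset (F (tang z) - tang z)"
proof -
  have "F (tang z) - tang z \<in> coset q" using assms by (simp add: fpc_def)
  then show ?thesis by (rule coset_eq[symmetric])
qed

text \<open>Equality of the degrees of \<open>p\<close> and \<open>f \<circ> p\<close> says that the
  displacement \<open>F - id\<close> is equal at both ends of a lift of \<open>p\<close>.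
  Conversely, two lifts with equal displacement are joined by a segment in the plane, and the plane
  provides the homotopy.\<close>

lemma same_class_iff:
  assumes F: "equivariant F" and f: "\<And>x. x \<in> torus \<Longrightarrow> f x = descend F x"
  shows "(\<exists>p. homotopic_to_image f x0 x1 p) \<longleftrightarrow> (\<exists>q\<in>lat. x0 \<in> fpc F (coset q) \<and> x1 \<in> fpc F (coset q))"
proof
  assume "\<exists>p. homotopic_to_image f x0 x1 p"
  then obtain p where p: "path p" "path_image p \<subseteq> torus" "pathstart p = x0" "pathfinish p = x1"
    and hom: "homotopic_paths torus (f \<circ> p) p" unfolding homotopic_to_image_def by blast
  obtain P where P: "path P" "\<And>t. t \<in> {0..1} \<Longrightarrow> p t = tor (P t)"
    using torus_path_lift[OF p(1,2)] by blast
  have x: "x0 = tor (P 0)" "x1 = tor (P 1)"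
    using P(2)[of 0] P(2)[of 1] p by (auto simp: pathstart_def pathfinish_def)
  have fp: "(f \<circ> p) t = tor (F (P t))" if "t \<in> {0..1}" for t
    using P(2)[OF that] by (simp add: f descend_tor[OF F])
  define q where "q = F (P 0) - P 0"
  have "pathstart (f \<circ> p) = x0" using homotopic_paths_imp_pathstart[OF hom] p by simp
  then have "tor (F (P 0)) = tor (P 0)" using fp[of 0] x by (simp add: pathstart_def)
  then have q: "q \<in> lat" by (simp add: q_def tor_eq_iff)
  have "path (F \<circ> P)"
    by (rule path_continuous_image[OF P(1)]) (rule equivariant_continuous_on[OF F])
  then have "tdeg (f \<circ> p) = F (P 1) - F (P 0)"
    using tdeg_lift[of "F \<circ> P" "f \<circ> p"] fp by simp
  moreover have "tdeg p = P 1 - P 0" by (rule tdeg_lift[OF P])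
  ultimately have q1: "F (P 1) - P 1 = q"
    using tdeg_homotopic[OF hom] by (simp add: q_def algebra_simps)
  have "x0 \<in> fpc F (coset q)" "x1 \<in> fpc F (coset q)"
    unfolding x tor_in_fpc[OF F saturated_coset[OF q]] q1 q_def[symmetric] by (rule coset_self)+
  then show "\<exists>q\<in>lat. x0 \<in> fpc F (coset q) \<and> x1 \<in> fpc F (coset q)" using q by blast
next
  assume "\<exists>q\<in>lat. x0 \<in> fpc F (coset q) \<and> x1 \<in> fpc F (coset q)"
  then obtain q where q: "q \<in> lat" "x0 \<in> fpc F (coset q)" "x1 \<in> fpc F (coset q)" by blast
  then have x: "x0 \<in> torus" "x1 \<in> torus" by (auto simp: fpc_def)
  define \<theta>0 where "\<theta>0 = tang x0"
  define q0 where "q0 = F \<theta>0 - \<theta>0"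
  have "q0 \<in> coset q" "F (tang x1) - tang x1 \<in> coset q"
    using q by (auto simp: fpc_def q0_def \<theta>0_def)
  then have "q0 \<in> coset (F (tang x1) - tang x1)" using coset_sym coset_trans by blast
  then obtain l where l: "l \<in> lat" "q0 = F (tang x1) - tang x1 + (A l - l)" by (auto simp: mem_coset)
  \<comment> \<open>The principal angle of \<open>x1\<close> is shifted by a lattice vector, so that
    its displacement equals \<open>q0\<close> exactly and not only modulo the coset
    relation.\<close>
  define \<theta>1 where "\<theta>1 = tang x1 + l"
  have q1: "F \<theta>1 = \<theta>1 + q0"
    using equivariantD[OF F l(1), of "tang x1"] l(2) by (simp add: \<theta>1_def algebra_simps)
  have x01: "x0 = tor \<theta>0" "x1 = tor \<theta>1"
    using x by (simp_all add: \<theta>0_def \<theta>1_def tor_add_lat[OF l(1)] tor_tang_torus)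
  have "q0 \<in> lat" using \<open>q0 \<in> coset q\<close> coset_lat[OF q(1)] by blast
  define P where "P = linepath \<theta>0 \<theta>1"
  define p where "p = tor \<circ> P"
  have path_p: "path p" unfolding p_def P_def by (intro path_continuous_image path_linepath continuous_intros)
  \<comment> \<open>The endpoints agree because both have displacement \<open>q0\<close>; the
    translation by \<open>q0\<close> disappears under \<open>tor\<close>.\<close>
  have "homotopic_paths UNIV (F \<circ> P) (\<lambda>t. P t + q0)"
  proof (rule homotopic_paths_linear)
    show "path (F \<circ> P)"
      unfolding P_def by (intro path_continuous_image path_linepath equivariant_continuous_on[OF F])
    show "path (\<lambda>t. P t + q0)"
      using path_linepath[of \<theta>0 \<theta>1] unfolding P_def path_def by (intro continuous_intros)
    show "pathstart (\<lambda>t. P t + q0) = pathstart (F \<circ> P)" "pathfinish (\<lambda>t. P t + q0) = pathfinish (F \<circ> P)"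
      using q1 by (simp_all add: pathstart_def pathfinish_def P_def linepath_def q0_def)
  qed auto
  then have "homotopic_paths torus (tor \<circ> (F \<circ> P)) (tor \<circ> (\<lambda>t. P t + q0))"
    by (rule homotopic_paths_continuous_image) (auto intro: continuous_intros)
  moreover have "tor \<circ> (F \<circ> P) = f \<circ> p"
    by (auto simp: p_def f descend_tor[OF F])
  moreover have "tor \<circ> (\<lambda>t. P t + q0) = p"
    by (auto simp: p_def tor_add_lat[OF \<open>q0 \<in> lat\<close>])
  ultimately have "homotopic_paths torus (f \<circ> p) p" by simp
  moreover have "pathstart p = x0" "pathfinish p = x1"
    by (simp_all add: p_def P_def x01 pathstart_compose pathfinish_compose)
  moreover have "path_image p \<subseteq> torus" by (auto simp: path_image_def p_def)
  ultimately show "\<exists>p. homotopic_to_image f x0 x1 p" unfolding homotopic_to_image_def using path_p by blast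
qed

text \<open>A coset may belong to no fixed point. Its index is then 0, so counting cosets of nonzero
  index counts only actual classes.\<close>

lemma torus_fixpoint_index_empty:
  assumes "equivariant F"
  shows "torus_fixpoint_index (descend F) {} = 0"
  unfolding torus_fixpoint_index_def
proof (rule euclidean_fixpoint_index_empty)
  show "open (torus_nbhd - ({x \<in> torus. descend F x = x} - {}))"
    unfolding descend_fixed
    by (simp add: open_Diff open_torus_nbhd compact_imp_closed compact_fpc assms saturated_lat)
  have False if "x \<in> torus_nbhd" "(descend F \<circ> torus_retraction) x = x" "x \<notin> {x \<in> torus. descend F x = x}" for x
  proof -
    have "x \<in> torus" using that(2) descend_in_torus by (metis comp_apply)
    then show False using that torus_retraction_torus by simp
  qed
  then show "{x \<in> torus_nbhd - ({x \<in> torus. descend F x = x} - {}). (descend F \<circ> torus_retraction) x = x} = {}"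
    by blast
qed

end

section \<open>Affine representatives, the number of essential classes and fixed point free
  deformations\<close>

lemma lin2_fixed:
  "lin2 a b c d \<theta> - \<theta> = (of_int (a - 1) * fst \<theta> + of_int b * snd \<theta>, of_int c * fst \<theta> + of_int (d - 1) * snd \<theta>)"
  by (cases \<theta>) (simp add: lin2_def algebra_simps)

lemma inj_lin2_fixed:
  assumes det: "(a - 1) * (d - 1) - b * c \<noteq> 0"
  shows "inj (\<lambda>\<theta>. lin2 a b c d \<theta> - \<theta>)"
proof (rule injI)
  fix \<theta> \<eta> assume eq: "lin2 a b c d \<theta> - \<theta> = lin2 a b c d \<eta> - \<eta>"
  define s t where "s = fst \<theta> - fst \<eta>" "t = snd \<theta> - snd \<eta>"
  define a' b' c' d' where "a' = real_of_int (a - 1)" "b' = real_of_int b" "c' = real_of_int c" "d' = real_of_int (d - 1)"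
  note defs = s_t_def a'_b'_c'_d'_def
  have 1: "a' * s + b' * t = 0" and 2: "c' * s + d' * t = 0"
    using eq unfolding lin2_fixed by (simp_all add: defs algebra_simps)
  have "a' * d' - b' * c' = real_of_int ((a - 1) * (d - 1) - b * c)" by (simp add: defs)
  then have det': "a' * d' - b' * c' \<noteq> 0" using det by (metis of_int_eq_0_iff)
  have "(a' * d' - b' * c') * s = d' * (a' * s + b' * t) - b' * (c' * s + d' * t)" by (simp add: algebra_simps)
  then have "s = 0" using 1 2 det' by simp
  have "(a' * d' - b' * c') * t = a' * (c' * s + d' * t) - c' * (a' * s + b' * t)" by (simp add: algebra_simps)
  then have "t = 0" using 1 2 det' by simp
  then show "\<theta> = \<eta>" using \<open>s = 0\<close> by (simp add: defs prod_eq_iff)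
qed

text \<open>A nonzero integral row vector \<open>(x, y)\<close> annihilates \<open>A - 1\<close>.
  The vector \<open>v\<close> is chosen so that this row takes the value 1/2 on
  \<open>A \<theta> + v - \<theta>\<close> for every \<open>\<theta>\<close>, whereas it is integral
  on the lattice.\<close>

lemma lin2_translation_free:
  assumes det: "(a - 1) * (d - 1) - b * c = 0"
  obtains v where "\<And>\<theta>. lin2 a b c d \<theta> + v - \<theta> \<notin> lat"
proof -
  \<comment> \<open>The row is orthogonal to the first column of \<open>A - 1\<close>, or to the
    second if the first is zero; singularity takes care of the other column.\<close>
  obtain x y where xy: "(x, y) \<noteq> (0, 0)" "x * (a - 1) + y * c = 0" "x * b + y * (d - 1) = 0"
  proof (cases "(c, a - 1) = (0, 0)")
    case False
    then show ?thesis using det that[of c "- (a - 1)"] by (auto simp: algebra_simps)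
  next
    case True
    show ?thesis
    proof (cases "(d - 1, b) = (0, 0)")
      case False
      then show ?thesis using True that[of "d - 1" "- b"] by (auto simp: algebra_simps)
    next
      case b: True
      then show ?thesis using True that[of 1 0] by auto
    qed
  qed
  define v :: "real \<times> real" where "v = (if x \<noteq> 0 then (1 / (2 * of_int x), 0) else (0, 1 / (2 * of_int y)))"
  have v: "of_int x * fst v + of_int y * snd v = 1 / 2"
    using xy(1) by (auto simp: v_def)
  have "lin2 a b c d \<theta> + v - \<theta> \<notin> lat" for \<theta>
  proof
    define w where "w = lin2 a b c d \<theta> + v - \<theta>"
    assume "lin2 a b c d \<theta> + v - \<theta> \<in> lat"
    then have "fst w \<in> \<int>" "snd w \<in> \<int>" by (simp_all add: w_def mem_lat)
    then have int: "of_int x * fst w + of_int y * snd w \<in> \<int>" by simp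
    have w: "w = (lin2 a b c d \<theta> - \<theta>) + v" by (simp add: w_def)
    have "of_int x * fst w + of_int y * snd w =
        of_int (x * (a - 1) + y * c) * fst \<theta> + of_int (x * b + y * (d - 1)) * snd \<theta> +
        (of_int x * fst v + of_int y * snd v)"
      unfolding w lin2_fixed by (simp add: algebra_simps)
    then have "of_int x * fst w + of_int y * snd w = 1 / 2" using xy v by simp
    with int have "(1 / 2 :: real) \<in> \<int>" by simp
    then obtain i :: int where "(1 / 2 :: real) = of_int i" by (rule Ints_cases)
    then have "real_of_int (2 * i) = real_of_int 1" by simp
    then have "2 * i = 1" by (simp only: of_int_eq_iff)
    then show False by presburger
  qed
  then show thesis by (rule that)
qed

text \<open>The index of the sublattice \<open>(A - 1)\<close> applied to the lattice. Real lattice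
  points are translated into integer pairs by \<open>\<rho>\<close>, where
  \<open>lattice_representatives\<close> applies.\<close>

lemma card_cosets_lin2:
  assumes det: "(a - 1) * (d - 1) - b * c \<noteq> 0"
  shows "card (lattice_linear.coset (lin2 a b c d) ` lat) = nat \<bar>(a - 1) * (d - 1) - b * c\<bar>"
proof -
  interpret lattice_linear "lin2 a b c d" by (rule lattice_linear_lin2)
  define L where "L = {((a - 1) * i + b * j, c * i + (d - 1) * j) |i j. True}"
  obtain B where B: "card B = nat \<bar>(a - 1) * (d - 1) - b * c\<bar>"
    "\<forall>v. \<exists>w\<in>B. v - w \<in> L" "\<forall>v\<in>B. \<forall>w\<in>B. v - w \<in> L \<longrightarrow> v = w"
    unfolding L_def by (rule lattice_representatives[OF det])
  define \<rho> where "\<rho> = (\<lambda>x :: int \<times> int. (of_int (fst x), of_int (snd x)) :: real \<times> real)"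
  have lat: "k \<in> lat \<longleftrightarrow> (\<exists>i. k = \<rho> i)" for k
    by (cases k) (auto simp: mem_lat \<rho>_def elim!: Ints_cases)
  have coset: "coset (\<rho> x) = coset (\<rho> y) \<longleftrightarrow> x - y \<in> L" for x y
  proof -
    have "coset (\<rho> x) = coset (\<rho> y) \<longleftrightarrow> \<rho> x \<in> coset (\<rho> y)"
      using coset_eq coset_self by metis
    also have "\<dots> \<longleftrightarrow> (\<exists>i. \<rho> x = \<rho> y + (lin2 a b c d (\<rho> i) - \<rho> i))"
      unfolding mem_coset Bex_def lat by blast
    also have "\<dots> \<longleftrightarrow> (\<exists>i. \<rho> x = \<rho> (y + ((a - 1) * fst i + b * snd i, c * fst i + (d - 1) * snd i)))"
      unfolding lin2_fixed by (simp add: \<rho>_def)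
    also have "\<dots> \<longleftrightarrow> (\<exists>i. x - y = ((a - 1) * fst i + b * snd i, c * fst i + (d - 1) * snd i))"
      unfolding \<rho>_def prod_eq_iff of_int_eq_iff fst_conv snd_conv by (auto simp: algebra_simps)
    also have "\<dots> \<longleftrightarrow> x - y \<in> L" by (auto simp: L_def)
    finally show ?thesis .
  qed
  have "coset ` lat = (\<lambda>x. coset (\<rho> x)) ` B"
  proof (rule equalityI; rule subsetI)
    fix C assume "C \<in> coset ` lat"
    then obtain v where "C = coset (\<rho> v)" by (auto simp: lat)
    then show "C \<in> (\<lambda>x. coset (\<rho> x)) ` B" using B(2) coset by blast
  next
    fix C assume "C \<in> (\<lambda>x. coset (\<rho> x)) ` B"
    then obtain x where "C = coset (\<rho> x)" by blast
    moreover have "\<rho> x \<in> lat" unfolding lat by blast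
    ultimately show "C \<in> coset ` lat" by blast
  qed
  moreover have "inj_on (\<lambda>x. coset (\<rho> x)) B"
    unfolding inj_on_def coset using B(3) by blast
  ultimately show ?thesis by (simp add: card_image B(1))
qed

lemma card_essential_classes:
  fixes a b c d :: int
  defines "\<E> F \<equiv> {C. (\<exists>q\<in>lat. C = fpc F (lattice_linear.coset (lin2 a b c d) q)) \<and>
    torus_fixpoint_index (descend F) C \<noteq> 0}"
  assumes F: "lattice_linear.equivariant (lin2 a b c d) F"
  shows "finite (\<E> F)" "int (card (\<E> F)) = \<bar>(a - 1) * (d - 1) - b * c\<bar>" "{} \<notin> \<E> F"
proof -
  interpret lattice_linear "lin2 a b c d" by (rule lattice_linear_lin2)
  show ne: "{} \<notin> \<E> F" using torus_fixpoint_index_empty[OF F] by (simp add: \<E>_def)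
  have "finite (\<E> F) \<and> int (card (\<E> F)) = \<bar>(a - 1) * (d - 1) - b * c\<bar>"
  proof (cases "(a - 1) * (d - 1) - b * c = 0")
    case True
    then obtain v where "\<And>\<theta>. lin2 a b c d \<theta> + v - \<theta> \<notin> lat" using lin2_translation_free by blast
    then have "\<E> F = {}"
      unfolding \<E>_def using torus_fixpoint_index_degenerate[OF F saturated_coset] by blast
    then show ?thesis using True by simp
  next
    case False
    have idx: "torus_fixpoint_index (descend F) (fpc F (coset q)) \<noteq> 0" if "q \<in> lat" for q
      by (rule torus_fixpoint_index_nondegenerate[OF F inj_lin2_fixed[OF False] that])
    then have E: "\<E> F = fpc F ` (coset ` lat)" by (auto simp: \<E>_def)
    \<comment> \<open>Every class is nonempty, having nonzero index, and the displacement of any of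
      its points recovers the coset.\<close>
    have "inj_on (fpc F) (coset ` lat)"
    proof (rule inj_onI, clarify)
      fix q r assume q: "q \<in> lat" and "r \<in> lat" and eq: "fpc F (coset q) = fpc F (coset r)"
      have "fpc F (coset q) \<noteq> {}" using idx[OF q] torus_fixpoint_index_empty[OF F] by auto
      then obtain z where "z \<in> fpc F (coset q)" by blast
      then show "coset q = coset r" using eq fpc_coset_unique by metis
    qed
    then have card: "card (\<E> F) = nat \<bar>(a - 1) * (d - 1) - b * c\<bar>"
      unfolding E by (simp add: card_image card_cosets_lin2[OF False])
    \<comment> \<open>Infinite sets have cardinality 0 by convention, so a nonzero cardinality
      yields finiteness.\<close>
    then have "card (\<E> F) \<noteq> 0" using False by simp
    then show ?thesis using card card.infinite by fastforce
  qed
  then show "finite (\<E> F)" "int (card (\<E> F)) = \<bar>(a - 1) * (d - 1) - b * c\<bar>" by auto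
qed

text \<open>A deformation keeps the degrees, so the deformed map has a lift with the same matrix. If
  the determinant is nonzero, the class of the coset of 0 has nonzero index and cannot be empty. If
  it vanishes, the affine model with a suitable translation is fixed point free.\<close>

lemma deforms_to_fpf_iff:
  assumes f: "continuous_on torus f" "f ` torus \<subseteq> torus" and z: "z \<in> torus"
    and deg: "tdeg (f \<circ> meridian z) = (of_int a, of_int c)" "tdeg (f \<circ> longitude z) = (of_int b, of_int d)"
  shows "deforms_to_fpf torus f \<longleftrightarrow> (a - 1) * (d - 1) - b * c = 0"
proof
  interpret lattice_linear "lin2 a b c d" by (rule lattice_linear_lin2)
  assume 0: "(a - 1) * (d - 1) - b * c = 0"
  obtain F where F: "equivariant F" "\<And>x. x \<in> torus \<Longrightarrow> f x = descend F x"
    using degree_lift[OF f z deg] by blast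
  obtain v where v: "\<And>\<theta>. lin2 a b c d \<theta> + v - \<theta> \<notin> lat" using lin2_translation_free[OF 0] by blast
  let ?g = "descend (\<lambda>\<theta>. lin2 a b c d \<theta> + v)"
  have "homotopic_with_canon (\<lambda>_. True) torus torus f ?g"
    by (rule homotopic_with_eq[OF descend_homotopic[OF F(1) equivariant_affine]]) (auto simp: F(2))
  moreover have "?g x \<noteq> x" if "x \<in> torus" for x
  proof
    assume "?g x = x"
    with that have "x \<in> {z \<in> torus. ?g z = z}" by simp
    then have "x \<in> fpc (\<lambda>\<theta>. lin2 a b c d \<theta> + v) lat" by (simp only: descend_fixed)
    then show False using v by (simp add: fpc_def)
  qed
  ultimately show "deforms_to_fpf torus f" unfolding deforms_to_fpf_def by blast
next
  interpret lattice_linear "lin2 a b c d" by (rule lattice_linear_lin2)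
  assume "deforms_to_fpf torus f"
  then obtain g where hom: "homotopic_with_canon (\<lambda>_. True) torus torus f g" and fpf: "\<And>x. x \<in> torus \<Longrightarrow> g x \<noteq> x"
    unfolding deforms_to_fpf_def by blast
  have g: "continuous_on torus g" "g ` torus \<subseteq> torus"
    using homotopic_with_imp_continuous[OF hom] homotopic_with_imp_subset2[OF hom] by auto
  note loops = meridian_longitude_loop[OF z]
  have "tdeg (g \<circ> meridian z) = (of_int a, of_int c)" "tdeg (g \<circ> longitude z) = (of_int b, of_int d)"
    using tdeg_homotopic_maps[OF hom loops(1,2)] tdeg_homotopic_maps[OF hom loops(5,6)] loops deg by simp_all
  then obtain G where G: "equivariant G" "\<And>x. x \<in> torus \<Longrightarrow> g x = descend G x"
    using degree_lift[OF g z] by blast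
  show "(a - 1) * (d - 1) - b * c = 0"
  proof (rule ccontr)
    assume "(a - 1) * (d - 1) - b * c \<noteq> 0"
    then have "torus_fixpoint_index (descend G) (fpc G (coset 0)) \<noteq> 0"
      by (intro torus_fixpoint_index_nondegenerate[OF G(1)] inj_lin2_fixed lat_0)
    moreover have "descend G z \<noteq> z" if "z \<in> torus" for z using G(2)[OF that] fpf[OF that] by simp
    then have "fpc G lat = {}" unfolding descend_fixed[symmetric] by blast
    then have "fpc G (coset 0) = {}" using coset_lat[OF lat_0] by (auto simp: fpc_def)
    ultimately show False using torus_fixpoint_index_empty[OF G(1)] by simp
  qed
qed

subsection \<open>Fundamental groups\<close>

definition loop_at :: "'a::topological_space set \<Rightarrow> 'a \<Rightarrow> (real \<Rightarrow> 'a) \<Rightarrow> bool" where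
  "loop_at S x p \<longleftrightarrow> path p \<and> path_image p \<subseteq> S \<and> pathstart p = x \<and> pathfinish p = x"

lemma carrier_fundamental_group:
  "carrier (fundamental_group S x) = path_class S ` {p. loop_at S x p}"
  by (simp add: fundamental_group_def loop_at_def)

lemma one_fundamental_group: "\<one>\<^bsub>fundamental_group S x\<^esub> = path_class S (\<lambda>_. x)"
  by (simp add: fundamental_group_def)

lemma path_class_eq:
  assumes "homotopic_paths S p q"
  shows "path_class S p = path_class S q"
  unfolding path_class_def using assms homotopic_paths_trans homotopic_paths_sym by blast

lemma path_class_eqD:
  assumes "path_class S p = path_class S q" "path q" "path_image q \<subseteq> S"
  shows "homotopic_paths S p q"
proof -
  have "q \<in> path_class S q" using assms(2,3) by (simp add: path_class_def)
  then show ?thesis unfolding assms(1)[symmetric] by (simp add: path_class_def)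
qed

lemma path_class_self: "path p \<Longrightarrow> path_image p \<subseteq> S \<Longrightarrow> p \<in> path_class S p"
  by (simp add: path_class_def)

lemma loop_at_join: "loop_at S x p \<Longrightarrow> loop_at S x q \<Longrightarrow> loop_at S x (p +++ q)"
  by (auto simp: loop_at_def path_image_join)

lemma loop_at_const: "x \<in> S \<Longrightarrow> loop_at S x (\<lambda>_. x)"
  by (auto simp: loop_at_def path_def path_image_def pathstart_def pathfinish_def)

lemma path_image_compose_subset:
  assumes f: "continuous_on S f" "f \<in> S \<rightarrow> T" and p: "path p" "path_image p \<subseteq> S"
  shows "path (f \<circ> p)" "path_image (f \<circ> p) \<subseteq> T"
proof -
  show "path (f \<circ> p)" by (rule path_continuous_image[OF p(1) continuous_on_subset[OF f(1) p(2)]])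
  show "path_image (f \<circ> p) \<subseteq> T" using f(2) p(2) unfolding path_image_compose by blast
qed

lemma loop_at_compose:
  assumes f: "continuous_on S f" "f \<in> S \<rightarrow> T" and p: "loop_at S x p"
  shows "loop_at T (f x) (f \<circ> p)"
  using path_image_compose_subset[OF f, of p] p
  by (simp add: loop_at_def pathfinish_compose pathstart_compose)

text \<open>The operations on classes are defined as sets over all representatives. For a path
  operation that respects homotopy, one representative determines the result.\<close>

lemma path_class_image:
  assumes hom: "\<And>p'. homotopic_paths S p p' \<Longrightarrow> homotopic_paths T (f p) (f p')"
    and p: "path p" "path_image p \<subseteq> S"
  shows "{q. \<exists>p'\<in>path_class S p. homotopic_paths T (f p') q} = path_class T (f p)"
proof (rule equalityI; rule subsetI)
  fix q assume "q \<in> {q. \<exists>p'\<in>path_class S p. homotopic_paths T (f p') q}"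
  then obtain p' where "homotopic_paths S p p'" and q: "homotopic_paths T (f p') q"
    by (auto simp: path_class_def)
  from homotopic_paths_trans[OF hom[OF this(1)] q] show "q \<in> path_class T (f p)"
    by (simp add: path_class_def)
next
  fix q assume "q \<in> path_class T (f p)"
  then have "homotopic_paths T (f p) q" by (simp add: path_class_def)
  then show "q \<in> {q. \<exists>p'\<in>path_class S p. homotopic_paths T (f p') q}"
    using path_class_self[OF p] by blast
qed

lemma mult_fundamental_group:
  assumes "loop_at S x p" "loop_at S x q"
  shows "path_class S p \<otimes>\<^bsub>fundamental_group S x\<^esub> path_class S q = path_class S (p +++ q)"
proof -
  note loops = assms[unfolded loop_at_def]
  have "path_class S p \<otimes>\<^bsub>fundamental_group S x\<^esub> path_class S q =
      {r. \<exists>p'\<in>path_class S p. \<exists>q'\<in>path_class S q. homotopic_paths S (p' +++ q') r}"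
    by (simp add: fundamental_group_def)
  \<comment> \<open>The two representatives are eliminated one after the other.\<close>
  also have "\<dots> = {r. \<exists>p'\<in>path_class S p. homotopic_paths S (p' +++ q) r}"
  proof -
    have eq: "{r. \<exists>q'\<in>path_class S q. homotopic_paths S (p' +++ q') r} = path_class S (p' +++ q)"
      if "p' \<in> path_class S p" for p'
    proof (rule path_class_image)
      have p': "homotopic_paths S p p'" using that by (simp add: path_class_def)
      show "homotopic_paths S (p' +++ q) (p' +++ q')" if "homotopic_paths S q q'" for q'
        using homotopic_paths_imp_path[OF p'] homotopic_paths_imp_subset[OF p']
          homotopic_paths_imp_pathfinish[OF p'] loops that
        by (intro homotopic_paths_join) auto
    qed (use loops in auto)
    have "(\<exists>q'\<in>path_class S q. homotopic_paths S (p' +++ q') r) \<longleftrightarrow> homotopic_paths S (p' +++ q) r"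
      if "p' \<in> path_class S p" for p' r
    proof -
      have "(\<exists>q'\<in>path_class S q. homotopic_paths S (p' +++ q') r) \<longleftrightarrow>
          r \<in> {r. \<exists>q'\<in>path_class S q. homotopic_paths S (p' +++ q') r}" by simp
      also have "\<dots> \<longleftrightarrow> homotopic_paths S (p' +++ q) r"
        unfolding eq[OF that] by (simp add: path_class_def)
      finally show ?thesis .
    qed
    then show ?thesis by (simp cong: bex_cong)
  qed
  also have "\<dots> = path_class S (p +++ q)"
    by (rule path_class_image, rule homotopic_paths_join) (use loops in auto)
  finally show ?thesis .
qed

lemma group_fundamental_group:
  fixes x :: "'a::real_normed_vector"
  assumes "x \<in> S"
  shows "group (fundamental_group S x)"
proof (rule groupI)
  let ?G = "fundamental_group S x"
  \<comment> \<open>The homotopies for the unit and inverse laws end in the degenerate segment,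
    whereas \<open>one\<close> is given by a constant function.\<close>
  have lin: "(\<lambda>_. x) = linepath x x" by (auto simp: linepath_def algebra_simps)
  show "\<one>\<^bsub>?G\<^esub> \<in> carrier ?G"
    using loop_at_const[OF assms] by (auto simp: carrier_fundamental_group one_fundamental_group)
  fix A assume "A \<in> carrier ?G"
  then obtain p where A: "A = path_class S p" and p: "loop_at S x p" by (auto simp: carrier_fundamental_group)
  note p' = p[unfolded loop_at_def]
  show "\<one>\<^bsub>?G\<^esub> \<otimes>\<^bsub>?G\<^esub> A = A"
    unfolding A one_fundamental_group mult_fundamental_group[OF loop_at_const[OF assms] p]
    by (rule path_class_eq) (use homotopic_paths_lid[of p S] p' lin in auto)
  show "\<exists>B\<in>carrier ?G. B \<otimes>\<^bsub>?G\<^esub> A = \<one>\<^bsub>?G\<^esub>"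
  proof
    have r: "loop_at S x (reversepath p)" using p' by (simp add: loop_at_def)
    then show "path_class S (reversepath p) \<in> carrier ?G" by (auto simp: carrier_fundamental_group)
    show "path_class S (reversepath p) \<otimes>\<^bsub>?G\<^esub> A = \<one>\<^bsub>?G\<^esub>"
      unfolding A one_fundamental_group mult_fundamental_group[OF r p]
      by (rule path_class_eq) (use homotopic_paths_linv[of p S] p' lin in auto)
  qed
  fix B assume "B \<in> carrier ?G"
  then obtain q where B: "B = path_class S q" and q: "loop_at S x q" by (auto simp: carrier_fundamental_group)
  show "A \<otimes>\<^bsub>?G\<^esub> B \<in> carrier ?G"
    unfolding A B mult_fundamental_group[OF p q] using loop_at_join[OF p q] by (auto simp: carrier_fundamental_group)
  fix C assume "C \<in> carrier ?G"
  then obtain r where C: "C = path_class S r" and r: "loop_at S x r" by (auto simp: carrier_fundamental_group)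
  show "A \<otimes>\<^bsub>?G\<^esub> B \<otimes>\<^bsub>?G\<^esub> C = A \<otimes>\<^bsub>?G\<^esub> (B \<otimes>\<^bsub>?G\<^esub> C)"
    unfolding A B C mult_fundamental_group[OF p q] mult_fundamental_group[OF q r]
      mult_fundamental_group[OF loop_at_join[OF p q] r] mult_fundamental_group[OF p loop_at_join[OF q r]]
    by (rule path_class_eq, rule homotopic_paths_sym, rule homotopic_paths_assoc)
      (use p q r in \<open>simp_all add: loop_at_def\<close>)
qed

lemma pi1_induced_path_class:
  assumes f: "continuous_on S f" "f \<in> S \<rightarrow> T" and p: "path p" "path_image p \<subseteq> S"
  shows "pi1_induced T f (path_class S p) = path_class T (f \<circ> p)"
  unfolding pi1_induced_def
  by (rule path_class_image[where f = "\<lambda>p. f \<circ> p", OF _ p]) (rule homotopic_paths_continuous_image[OF _ f])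

lemma pi1_change_base_path_class:
  assumes g: "path \<gamma>" "path_image \<gamma> \<subseteq> S" and p: "loop_at S (pathfinish \<gamma>) p"
  shows "pi1_change_base S \<gamma> (path_class S p) = path_class S (\<gamma> +++ p +++ reversepath \<gamma>)"
  unfolding pi1_change_base_def
proof (rule path_class_image[where f = "\<lambda>p. \<gamma> +++ p +++ reversepath \<gamma>"])
  show "homotopic_paths S (\<gamma> +++ p +++ reversepath \<gamma>) (\<gamma> +++ p' +++ reversepath \<gamma>)"
    if "homotopic_paths S p p'" for p'
    by (intro homotopic_paths_join that homotopic_paths_refl[THEN iffD2])
      (use g p in \<open>simp_all add: loop_at_def\<close>)
qed (use p in \<open>simp_all add: loop_at_def\<close>)

subsection \<open>Degrees of homotopy classes\<close>

text \<open>Homotopy invariance makes the chosen representative immaterial, and degrees of loops are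
  integral, so the floors only change the type. The map \<open>h\<close> will be a projection of
  \<open>conf2_torus\<close> or an inclusion into the torus.\<close>

definition cdeg :: "('a \<Rightarrow> C2) \<Rightarrow> (real \<Rightarrow> 'a) set \<Rightarrow> int \<times> int" where
  "cdeg h A = (let d = tdeg (h \<circ> (SOME p. p \<in> A)) in (\<lfloor>fst d\<rfloor>, \<lfloor>snd d\<rfloor>))"

definition rpair :: "int \<times> int \<Rightarrow> real \<times> real" where
  "rpair z = (of_int (fst z), of_int (snd z))"

lemma rpair_inj: "rpair x = rpair y \<longleftrightarrow> x = y"
  by (auto simp: rpair_def prod_eq_iff)

lemma rpair_cdeg:
  assumes h: "continuous_on S h" "h \<in> S \<rightarrow> torus" and p: "loop_at S x p"
  shows "rpair (cdeg h (path_class S p)) = tdeg (h \<circ> p)"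
proof -
  note p' = p[unfolded loop_at_def]
  define q where "q = (SOME q. q \<in> path_class S p)"
  have "q \<in> path_class S p"
    unfolding q_def by (rule someI[of "\<lambda>q. q \<in> path_class S p" p], rule path_class_self) (use p' in auto)
  then have "homotopic_paths S p q" by (simp add: path_class_def)
  then have "tdeg (h \<circ> q) = tdeg (h \<circ> p)"
    using tdeg_homotopic[OF homotopic_paths_continuous_image[OF _ h]] by metis
  moreover have "path (h \<circ> p)" "path_image (h \<circ> p) \<subseteq> torus"
    using path_image_compose_subset[OF h, of p] p' by auto
  ultimately have "tdeg (h \<circ> p) \<in> lat" "tdeg (h \<circ> q) = tdeg (h \<circ> p)"
    using p' by (auto intro!: tdeg_in_lat simp: pathfinish_compose pathstart_compose)
  then show ?thesis
    unfolding cdeg_def q_def[symmetric] Let_def rpair_def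
    by (cases "tdeg (h \<circ> p)") (auto simp: mem_lat elim!: Ints_cases)
qed

lemma cdeg_hom:
  fixes S :: "'a::topological_space set"
  assumes h: "continuous_on S h" "h \<in> S \<rightarrow> torus"
  shows "cdeg h \<in> hom (fundamental_group S x) Z2"
proof (rule homI)
  let ?G = "fundamental_group S x"
  fix A B assume "A \<in> carrier ?G" "B \<in> carrier ?G"
  then obtain p q where A: "A = path_class S p" and p: "loop_at S x p"
    and B: "B = path_class S q" and q: "loop_at S x q" by (auto simp: carrier_fundamental_group)
  have hp: "path (h \<circ> p)" "path_image (h \<circ> p) \<subseteq> torus" if "loop_at S x p" for p
    using path_image_compose_subset[OF h, of p] that unfolding loop_at_def by auto
  have "rpair (cdeg h (A \<otimes>\<^bsub>?G\<^esub> B)) = tdeg (h \<circ> (p +++ q))"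
    unfolding A B mult_fundamental_group[OF p q] by (rule rpair_cdeg[OF h loop_at_join[OF p q]])
  also have "\<dots> = tdeg (h \<circ> p) + tdeg (h \<circ> q)"
    unfolding path_compose_join
    by (rule tdeg_join) (use hp p q in \<open>auto simp: loop_at_def pathfinish_compose pathstart_compose\<close>)
  also have "\<dots> = rpair (cdeg h A) + rpair (cdeg h B)"
    unfolding A B rpair_cdeg[OF h p] rpair_cdeg[OF h q] ..
  also have "\<dots> = rpair (cdeg h A \<otimes>\<^bsub>Z2\<^esub> cdeg h B)"
    by (cases "cdeg h A"; cases "cdeg h B") (simp add: rpair_def)
  finally show "cdeg h (A \<otimes>\<^bsub>?G\<^esub> B) = cdeg h A \<otimes>\<^bsub>Z2\<^esub> cdeg h B" by (simp only: rpair_inj)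
qed auto

lemma mult_Z2: "x \<otimes>\<^bsub>Z2\<^esub> y = (fst x + fst y, snd x + snd y)"
  by (cases x; cases y) simp

lemma group_Z2: "group Z2"
  by (intro DirProd_group) auto

lemma hom_eq_on_generate:
  assumes "group G" "group H" "f \<in> hom G H" "g \<in> hom G H" and S: "S \<subseteq> carrier G" "\<And>x. x \<in> S \<Longrightarrow> f x = g x"
    and "x \<in> generate G S"
  shows "f x = g x"
proof -
  interpret f: group_hom G H f using assms by (simp add: group_hom_def group_hom_axioms_def)
  interpret g: group_hom G H g using assms by (simp add: group_hom_def group_hom_axioms_def)
  show ?thesis using assms(7)
  proof (induction rule: generate.induct)
    case (inv h)
    then show ?case using S by (metis f.hom_inv g.hom_inv subsetD)
  next
    case (eng h1 h2)
    then show ?case using group.generate_in_carrier[OF assms(1) S(1)] by simp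
  qed (use S in auto)
qed

section \<open>Degrees in the pure braid group of the torus\<close>

lemma conf2_torus_projections:
  assumes "\<pi> = fst \<or> \<pi> = snd"
  shows "continuous_on conf2_torus \<pi>" "\<pi> \<in> conf2_torus \<rightarrow> torus"
  using assms by (auto simp: conf2_torus_def intro: continuous_intros)

lemma tdeg_meridian_longitude:
  assumes "z \<in> torus"
  shows "tdeg (meridian z) = (1, 0)" "tdeg (longitude z) = (0, 1)"
proof -
  have z: "z = tor (tang z)" using tor_tang_torus[OF assms] by simp
  show "tdeg (meridian z) = (1, 0)" "tdeg (longitude z) = (0, 1)"
    using tdeg_image_meridian_longitude[of id id "tang z"] by (subst z; simp)+
qed

lemma tdeg_const: "z \<in> torus \<Longrightarrow> tdeg (\<lambda>_. z) = 0"
  using tdeg_lift[of "\<lambda>_. tang z" "\<lambda>_. z"] tor_tang_torus[of z] by (simp add: path_def)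

lemma central_degrees:
  assumes x: "(x1, x2) \<in> conf2_torus" and \<pi>: "\<pi> = fst \<or> \<pi> = snd"
  shows "central_x x1 x2 \<in> carrier (P2 x1 x2)" "central_y x1 x2 \<in> carrier (P2 x1 x2)"
    "cdeg \<pi> (central_x x1 x2) = (1, 0)" "cdeg \<pi> (central_y x1 x2) = (0, 1)"
proof -
  have x': "x1 \<in> torus" "x2 \<in> torus" "x1 \<noteq> x2" using x by (auto simp: conf2_torus_def)
  note l1 = meridian_longitude_loop[OF x'(1)] and l2 = meridian_longitude_loop[OF x'(2)]
  have ne: "meridian x1 t \<noteq> meridian x2 t" "longitude x1 t \<noteq> longitude x2 t" for t
    using x'(3) by (auto simp: meridian_def longitude_def prod_eq_iff)
  have "loop_at conf2_torus (x1, x2) (\<lambda>t. (meridian x1 t, meridian x2 t))"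
    "loop_at conf2_torus (x1, x2) (\<lambda>t. (longitude x1 t, longitude x2 t))"
    using l1 l2 ne ne[symmetric] unfolding loop_at_def path_def path_image_def pathstart_def pathfinish_def conf2_torus_def
    by (auto intro!: continuous_on_Pair)
  note loops = this
  then show "central_x x1 x2 \<in> carrier (P2 x1 x2)" "central_y x1 x2 \<in> carrier (P2 x1 x2)"
    by (auto simp: central_x_def central_y_def carrier_fundamental_group)
  have "\<pi> \<circ> (\<lambda>t. (meridian x1 t, meridian x2 t)) = meridian (\<pi> (x1, x2))"
    "\<pi> \<circ> (\<lambda>t. (longitude x1 t, longitude x2 t)) = longitude (\<pi> (x1, x2))"
    using \<pi> by auto
  moreover have "\<pi> (x1, x2) \<in> torus" using x' \<pi> by auto
  ultimately have "rpair (cdeg \<pi> (central_x x1 x2)) = rpair (1, 0)" "rpair (cdeg \<pi> (central_y x1 x2)) = rpair (0, 1)"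
    unfolding central_x_def central_y_def
      rpair_cdeg[OF conf2_torus_projections[OF \<pi>] loops(1)] rpair_cdeg[OF conf2_torus_projections[OF \<pi>] loops(2)]
    by (simp_all add: tdeg_meridian_longitude rpair_def)
  then show "cdeg \<pi> (central_x x1 x2) = (1, 0)" "cdeg \<pi> (central_y x1 x2) = (0, 1)"
    by (simp_all only: rpair_inj)
qed

lemma fibre_incl_path_class:
  assumes x: "(x1, x2) \<in> conf2_torus" and p: "loop_at (torus - {x2}) x1 p"
  shows "fibre_incl x2 (path_class (torus - {x2}) p) = path_class conf2_torus (\<lambda>t. (p t, x2))"
    "loop_at conf2_torus (x1, x2) (\<lambda>t. (p t, x2))"
proof -
  have f: "continuous_on (torus - {x2}) (\<lambda>z. (z, x2))" "(\<lambda>z. (z, x2)) \<in> torus - {x2} \<rightarrow> conf2_torus"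
    using x by (auto simp: conf2_torus_def intro!: continuous_intros)
  have "path p" "path_image p \<subseteq> torus - {x2}" using p by (simp_all add: loop_at_def)
  from pi1_induced_path_class[OF f this]
  show "fibre_incl x2 (path_class (torus - {x2}) p) = path_class conf2_torus (\<lambda>t. (p t, x2))"
    by (simp add: fibre_incl_def o_def)
  show "loop_at conf2_torus (x1, x2) (\<lambda>t. (p t, x2))"
    using loop_at_compose[OF f p] by (simp add: o_def)
qed

text \<open>In the fibre the second point stands still, so only the first projection sees the
  loop.\<close>

lemma fibre_incl_degrees:
  assumes x: "(x1, x2) \<in> conf2_torus" and A: "A \<in> carrier (fibre_group x1 x2)"
  shows "fibre_incl x2 A \<in> carrier (P2 x1 x2)"
    "cdeg fst (fibre_incl x2 A) = cdeg id A" "cdeg snd (fibre_incl x2 A) = (0, 0)"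
proof -
  have x': "x1 \<in> torus" "x2 \<in> torus" "x1 \<noteq> x2" using x by (auto simp: conf2_torus_def)
  obtain p where A: "A = path_class (torus - {x2}) p" and p: "loop_at (torus - {x2}) x1 p"
    using A by (auto simp: carrier_fundamental_group)
  note loop = fibre_incl_path_class(2)[OF x p]
  have incl: "fibre_incl x2 A = path_class conf2_torus (\<lambda>t. (p t, x2))"
    unfolding A by (rule fibre_incl_path_class(1)[OF x p])
  show "fibre_incl x2 A \<in> carrier (P2 x1 x2)"
    unfolding incl using loop by (auto simp: carrier_fundamental_group)
  have id: "continuous_on (torus - {x2}) id" "id \<in> torus - {x2} \<rightarrow> torus"
    by (auto intro: continuous_intros)
  have "rpair (cdeg fst (fibre_incl x2 A)) = rpair (cdeg id A)"
    unfolding incl rpair_cdeg[OF conf2_torus_projections[OF disjI1[OF refl]] loop]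
    unfolding A rpair_cdeg[OF id p] by (simp add: o_def)
  then show "cdeg fst (fibre_incl x2 A) = cdeg id A" by (simp only: rpair_inj)
  have "rpair (cdeg snd (fibre_incl x2 A)) = rpair (0, 0)"
    unfolding incl rpair_cdeg[OF conf2_torus_projections[OF disjI2[OF refl]] loop]
    by (simp add: o_def tdeg_const[OF x'(2)] rpair_def zero_prod_def)
  then show "cdeg snd (fibre_incl x2 A) = (0, 0)" by (simp only: rpair_inj)
qed

text \<open>Two homomorphisms to an abelian group that agree on the generators \<open>u\<close> and
  \<open>v\<close>. Their degrees are known because the images in the torus are the meridian and the
  longitude.\<close>

lemma cdeg_fibre_eq_abelianisation:
  assumes x: "(x1, x2) \<in> conf2_torus" and basis: "fibre_basis x1 x2 u v"
    and Ab: "abelianisation x1 x2 u v Ab" and w: "w \<in> carrier (fibre_group x1 x2)"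
  shows "cdeg id w = Ab w"
proof (rule hom_eq_on_generate[where G = "fibre_group x1 x2" and H = Z2 and S = "{u, v}"])
  have x': "x1 \<in> torus" "x2 \<in> torus" "x1 \<noteq> x2" using x by (auto simp: conf2_torus_def)
  have free: "group (fibre_group x1 x2)" "{u, v} \<subseteq> carrier (fibre_group x1 x2)"
    "generate (fibre_group x1 x2) {u, v} = carrier (fibre_group x1 x2)"
    using basis by (auto simp: fibre_basis_def free_on_def)
  show "group (fibre_group x1 x2)" "{u, v} \<subseteq> carrier (fibre_group x1 x2)" "group Z2"
    by (fact free(1), fact free(2), fact group_Z2)
  show "w \<in> generate (fibre_group x1 x2) {u, v}" using w free(3) by simp
  have id: "continuous_on (torus - {x2}) id" "id \<in> torus - {x2} \<rightarrow> torus"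
    by (auto intro: continuous_intros)
  show "cdeg id \<in> hom (fibre_group x1 x2) Z2" by (rule cdeg_hom[OF id])
  show "Ab \<in> hom (fibre_group x1 x2) Z2" using Ab by (simp add: abelianisation_def)
  \<comment> \<open>Equality of classes in the torus allows homotopies across the puncture
    \<open>x2\<close>, which leave the degree in the torus unchanged.\<close>
  have deg: "rpair (cdeg id A) = tdeg l"
    if A: "A \<in> carrier (fibre_group x1 x2)" and eq: "pi1_induced torus fst (fibre_incl x2 A) = path_class torus l"
      and l: "path l" "path_image l \<subseteq> torus" for A l
  proof -
    obtain p where A: "A = path_class (torus - {x2}) p" and p: "loop_at (torus - {x2}) x1 p"
      using A by (auto simp: carrier_fundamental_group)
    have "path (\<lambda>t. (p t, x2))" "path_image (\<lambda>t. (p t, x2)) \<subseteq> conf2_torus"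
      using fibre_incl_path_class(2)[OF x p] by (simp_all add: loop_at_def)
    then have "pi1_induced torus fst (fibre_incl x2 A) = path_class torus (fst \<circ> (\<lambda>t. (p t, x2)))"
      unfolding A fibre_incl_path_class(1)[OF x p]
      by (rule pi1_induced_path_class[OF conf2_torus_projections[OF disjI1[OF refl]]])
    then have "path_class torus p = path_class torus l" using eq by (simp add: o_def)
    then have "homotopic_paths torus p l" by (rule path_class_eqD[OF _ l])
    then have "tdeg p = tdeg l" by (rule tdeg_homotopic)
    then show ?thesis unfolding A rpair_cdeg[OF id p] by simp
  qed
  note l1 = meridian_longitude_loop[OF x'(1)]
  have "rpair (cdeg id u) = rpair (Ab u)" "rpair (cdeg id v) = rpair (Ab v)"
    using deg[of u "meridian x1"] deg[of v "longitude x1"] free(2) basis Ab l1 tdeg_meridian_longitude[OF x'(1)]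
    by (simp_all add: fibre_basis_def abelianisation_def rpair_def)
  then show "\<And>x. x \<in> {u, v} \<Longrightarrow> cdeg id x = Ab x" by (auto simp: rpair_inj)
qed

lemma cdeg_P2_elem:
  assumes x: "(x1, x2) \<in> conf2_torus" and A: "A \<in> carrier (fibre_group x1 x2)"
  shows "cdeg fst (P2_elem x1 x2 A (a, b)) = (fst (cdeg id A) + a, snd (cdeg id A) + b)"
    "cdeg snd (P2_elem x1 x2 A (a, b)) = (a, b)"
proof -
  interpret P: group "P2 x1 x2" by (rule group_fundamental_group[OF x])
  have "cdeg \<pi> (P2_elem x1 x2 A (a, b)) =
      (fst (cdeg \<pi> (fibre_incl x2 A)) + a, snd (cdeg \<pi> (fibre_incl x2 A)) + b)"
    if \<pi>: "\<pi> = fst \<or> \<pi> = snd" for \<pi>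
  proof -
    have hom: "cdeg \<pi> \<in> hom (P2 x1 x2) Z2" by (rule cdeg_hom[OF conf2_torus_projections[OF \<pi>]])
    note c = central_degrees[OF x \<pi>]
    have c': "fibre_incl x2 A \<in> carrier (P2 x1 x2)" by (rule fibre_incl_degrees(1)[OF x A])
    show ?thesis
      using c c' unfolding P2_elem_def
      by (simp add: hom_mult[OF hom] hom_int_pow[OF hom _ P.group_axioms group_Z2] Z2_int_pow mult_Z2)
  qed
  from this[of fst] this[of snd] show
    "cdeg fst (P2_elem x1 x2 A (a, b)) = (fst (cdeg id A) + a, snd (cdeg id A) + b)"
    "cdeg snd (P2_elem x1 x2 A (a, b)) = (a, b)"
    using fibre_incl_degrees(2,3)[OF x A] by simp_all
qed

text \<open>Degrees are insensitive to the base point path, so projecting the braid gives the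
  degrees of \<open>f1\<close> and \<open>f2\<close> on the loop. It serves for the meridian with
  \<open>(r, a, b)\<close> and for the longitude with \<open>(s, c, d)\<close>.\<close>

lemma lift_degrees:
  assumes \<Phi>: "continuous_on torus (\<lambda>x. (f1 x, f2 x))" "(\<lambda>x. (f1 x, f2 x)) ` torus \<subseteq> conf2_torus"
    and x: "(x1, x2) \<in> conf2_torus"
    and \<gamma>: "path \<gamma>" "path_image \<gamma> \<subseteq> conf2_torus" "pathstart \<gamma> = (x1, x2)" "pathfinish \<gamma> = (f1 t0, f2 t0)"
    and basis: "fibre_basis x1 x2 u v" and Ab: "abelianisation x1 x2 u v Ab"
    and w: "w \<in> carrier (fibre_group x1 x2)" "Ab w = (m, n)"
    and l: "loop_at torus t0 l"
    and eq: "pi1_change_base conf2_torus \<gamma> (pi1_induced conf2_torus (\<lambda>x. (f1 x, f2 x)) (path_class torus l)) =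
      P2_elem x1 x2 (w [^]\<^bsub>fibre_group x1 x2\<^esub> r) (a, b)"
  shows "tdeg (f1 \<circ> l) = (of_int (r * m + a), of_int (r * n + b))" "tdeg (f2 \<circ> l) = (of_int a, of_int b)"
proof -
  let ?\<Phi> = "\<lambda>x. (f1 x, f2 x)"
  let ?F = "fibre_group x1 x2"
  have gF: "group ?F" using basis by (simp add: fibre_basis_def free_on_def)
  have wr: "w [^]\<^bsub>?F\<^esub> r \<in> carrier ?F" by (rule group.int_pow_closed[OF gF w(1)])
  have id: "continuous_on (torus - {x2}) id" "id \<in> torus - {x2} \<rightarrow> torus"
    by (auto intro: continuous_intros)
  have "cdeg id (w [^]\<^bsub>?F\<^esub> r) = cdeg id w [^]\<^bsub>Z2\<^esub> r"
    by (rule hom_int_pow[OF cdeg_hom[OF id] w(1) gF group_Z2])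
  then have wdeg: "cdeg id (w [^]\<^bsub>?F\<^esub> r) = (r * m, r * n)"
    by (simp add: Z2_int_pow cdeg_fibre_eq_abelianisation[OF x basis Ab w(1)] w(2))
  note l' = l[unfolded loop_at_def]
  have \<Phi>l: "loop_at conf2_torus (pathfinish \<gamma>) (?\<Phi> \<circ> l)"
    using loop_at_compose[OF \<Phi>(1) _ l] \<Phi>(2) by (simp add: \<gamma>(4) image_subset_iff_funcset)
  have "pi1_induced conf2_torus ?\<Phi> (path_class torus l) = path_class conf2_torus (?\<Phi> \<circ> l)"
    by (rule pi1_induced_path_class) (use \<Phi> l' in auto)
  then have cls: "P2_elem x1 x2 (w [^]\<^bsub>?F\<^esub> r) (a, b) = path_class conf2_torus (\<gamma> +++ (?\<Phi> \<circ> l) +++ reversepath \<gamma>)"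
    using eq pi1_change_base_path_class[OF \<gamma>(1,2) \<Phi>l] by simp
  have loop: "loop_at conf2_torus (x1, x2) (\<gamma> +++ (?\<Phi> \<circ> l) +++ reversepath \<gamma>)"
    using \<gamma> \<Phi>l by (auto simp: loop_at_def path_image_join)
  have tdeg: "tdeg (\<pi> \<circ> (?\<Phi> \<circ> l)) = rpair (cdeg \<pi> (P2_elem x1 x2 (w [^]\<^bsub>?F\<^esub> r) (a, b)))"
    if \<pi>: "\<pi> = fst \<or> \<pi> = snd" for \<pi>
  proof -
    have pth: "path (\<pi> \<circ> p)" "path_image (\<pi> \<circ> p) \<subseteq> torus" if "path p" "path_image p \<subseteq> conf2_torus" for p
      using path_image_compose_subset[OF conf2_torus_projections[OF \<pi>] that] .
    have "rpair (cdeg \<pi> (P2_elem x1 x2 (w [^]\<^bsub>?F\<^esub> r) (a, b))) = tdeg (\<pi> \<circ> (\<gamma> +++ (?\<Phi> \<circ> l) +++ reversepath \<gamma>))"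
      unfolding cls by (rule rpair_cdeg[OF conf2_torus_projections[OF \<pi>] loop])
    also have "\<dots> = tdeg ((\<pi> \<circ> \<gamma>) +++ (\<pi> \<circ> (?\<Phi> \<circ> l)) +++ reversepath (\<pi> \<circ> \<gamma>))"
      by (simp only: path_compose_join path_compose_reversepath)
    \<comment> \<open>The path \<open>\<gamma>\<close> need not be closed, but \<open>tdeg\<close>
      is additive on all paths, and the contributions of \<open>\<gamma>\<close> and its reverse
      cancel.\<close>
    also have "\<dots> = tdeg (\<pi> \<circ> \<gamma>) + (tdeg (\<pi> \<circ> (?\<Phi> \<circ> l)) + tdeg (reversepath (\<pi> \<circ> \<gamma>)))"
      using pth[OF \<gamma>(1,2)] pth[of "?\<Phi> \<circ> l"] \<Phi>l
      by (subst tdeg_join, simp_all add: loop_at_def pathfinish_compose pathstart_compose path_image_join,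
          subst tdeg_join, simp_all add: pathfinish_compose pathstart_compose)
    also have "\<dots> = tdeg (\<pi> \<circ> (?\<Phi> \<circ> l))"
      using tdeg_reversepath[OF pth[OF \<gamma>(1,2)]] by simp
    finally show ?thesis by simp
  qed
  have c: "fst \<circ> (?\<Phi> \<circ> l) = f1 \<circ> l" "snd \<circ> (?\<Phi> \<circ> l) = f2 \<circ> l" by auto
  show "tdeg (f1 \<circ> l) = (of_int (r * m + a), of_int (r * n + b))"
    using tdeg[of fst] unfolding c cdeg_P2_elem[OF x wr] wdeg by (simp add: rpair_def)
  show "tdeg (f2 \<circ> l) = (of_int a, of_int b)"
    using tdeg[of snd] unfolding c cdeg_P2_elem[OF x wr] by (simp add: rpair_def)
qed

subsection \<open>Two-valued maps\<close>

text \<open>Two values, at least one in each of the disjoint sets \<open>U\<close> and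
  \<open>V\<close>, leave exactly one in \<open>U\<close>. This selection \<open>\<sigma>\<close> is
  continuous by lower semicontinuity: its value lies in \<open>W\<close> iff the set of values meets
  \<open>U \<inter> W\<close>.\<close>

lemma two_valued_sheet:
  fixes H :: "'a::t2_space \<Rightarrow> 'b::t2_space set"
  assumes H: "two_valued_map S Y H" and UV: "open U" "open V" "U \<inter> V = {}"
    and N: "N \<subseteq> S" "\<And>y. y \<in> N \<Longrightarrow> H y \<inter> U \<noteq> {}" "\<And>y. y \<in> N \<Longrightarrow> H y \<inter> V \<noteq> {}"
  shows "\<exists>q. homeomorphism ({(y, z). y \<in> S \<and> z \<in> H y} \<inter> N \<times> U) N fst q"
proof -
  define \<sigma> where "\<sigma> y = (SOME z. z \<in> H y \<inter> U)" for y
  have \<sigma>: "\<sigma> y \<in> H y \<inter> U" if "y \<in> N" for y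
    unfolding \<sigma>_def by (rule someI_ex) (use N(2)[OF that] in blast)
  have uniq: "z = \<sigma> y" if y: "y \<in> N" and z: "z \<in> H y" "z \<in> U" for y z
  proof (rule ccontr)
    assume ne: "z \<noteq> \<sigma> y"
    obtain w where w: "w \<in> H y" "w \<in> V" using N(3)[OF y] by blast
    have sub: "{z, \<sigma> y, w} \<subseteq> H y" using \<sigma>[OF y] z w by simp
    have H2: "card (H y) = 2" using H y N(1) by (auto simp: two_valued_map_def)
    have "z \<noteq> w" "\<sigma> y \<noteq> w" using UV(3) z w \<sigma>[OF y] by auto
    then have "card {z, \<sigma> y, w} = 3" using ne by simp
    moreover have "finite (H y)" using H2 by (metis card.infinite zero_neq_numeral)
    then have "card {z, \<sigma> y, w} \<le> card (H y)" using sub by (rule card_mono)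
    ultimately show False using H2 by simp
  qed
  have "continuous_on N \<sigma>"
    unfolding continuous_openin_preimage_eq
  proof (intro allI impI)
    fix W :: "'b set" assume "open W"
    define E where "E = {y \<in> S. H y \<inter> (Y \<inter> (U \<inter> W)) \<noteq> {}}"
    have "openin (top_of_set Y) (Y \<inter> (U \<inter> W))"
      using UV(1) \<open>open W\<close> by (simp add: openin_open_Int open_Int)
    then have "openin (top_of_set S) E"
      using H unfolding two_valued_map_def E_def by blast
    then obtain T where T: "open T" "E = S \<inter> T" by (auto simp: openin_open)
    then have "openin (top_of_set N) (N \<inter> E)"
      using N(1) by (simp add: Int_assoc[symmetric] Int_absorb2 openin_open_Int)
    moreover have "y \<in> E \<longleftrightarrow> \<sigma> y \<in> W" if y: "y \<in> N" for y
    proof -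
      have "y \<in> S" "H y \<subseteq> Y" using H y N(1) by (auto simp: two_valued_map_def)
      then have "y \<in> E \<longleftrightarrow> (\<exists>z\<in>H y. z \<in> U \<and> z \<in> W)" by (auto simp: E_def)
      also have "\<dots> \<longleftrightarrow> \<sigma> y \<in> W" using uniq[OF y] \<sigma>[OF y] by blast
      finally show ?thesis .
    qed
    then have "N \<inter> E = N \<inter> \<sigma> -` W" by blast
    ultimately show "openin (top_of_set N) (N \<inter> \<sigma> -` W)" by simp
  qed
  then have "homeomorphism ({(y, z). y \<in> S \<and> z \<in> H y} \<inter> N \<times> U) N fst (\<lambda>y. (y, \<sigma> y))"
    unfolding homeomorphism_def using \<sigma> uniq N(1)
    by (auto intro!: continuous_intros image_eqI[of _ fst "(_, \<sigma> _)"])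
  then show ?thesis by blast
qed

text \<open>The graph is evenly covered where the two values are separated by disjoint open sets.
  Upper semicontinuity keeps all values in the union of these sets, lower semicontinuity keeps one
  in each.\<close>

lemma two_valued_covering_space:
  fixes H :: "'a::t2_space \<Rightarrow> 'b::t2_space set"
  assumes H: "two_valued_map S Y H"
  shows "covering_space {(y, z). y \<in> S \<and> z \<in> H y} fst S"
proof
  let ?C = "{(y, z). y \<in> S \<and> z \<in> H y}"
  have H2: "card (H y) = 2" "H y \<subseteq> Y" if "y \<in> S" for y using H that by (auto simp: two_valued_map_def)
  show "continuous_on ?C fst" by (intro continuous_intros)
  show "fst ` ?C = S"
  proof (rule equalityI; rule subsetI)
    fix y assume "y \<in> S"
    then have "H y \<noteq> {}" using H2 by fastforce
    then obtain z where "z \<in> H y" by blast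
    then show "y \<in> fst ` ?C" using \<open>y \<in> S\<close> by (intro image_eqI[of _ _ "(y, z)"]) auto
  qed auto
  fix x assume x: "x \<in> S"
  obtain a b where ab: "H x = {a, b}" "a \<noteq> b" using H2[OF x] by (meson card_2_iff)
  obtain U V where UV: "open U" "open V" "a \<in> U" "b \<in> V" "U \<inter> V = {}" using hausdorff[OF ab(2)] by blast
  let ?U = "Y \<inter> U" and ?V = "Y \<inter> V"
  have open_UV: "openin (top_of_set Y) ?U" "openin (top_of_set Y) ?V" "openin (top_of_set Y) (?U \<union> ?V)"
    using UV by (auto simp: openin_open_Int)
  define N where "N = {y \<in> S. H y \<subseteq> ?U \<union> ?V} \<inter> {y \<in> S. H y \<inter> ?U \<noteq> {}} \<inter> {y \<in> S. H y \<inter> ?V \<noteq> {}}"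
  have N: "openin (top_of_set S) N"
    unfolding N_def using H open_UV by (intro openin_Int) (auto simp: two_valued_map_def)
  then obtain N' where N': "open N'" "N = S \<inter> N'" by (auto simp: openin_open)
  have "x \<in> N" using x ab UV H2[OF x] by (auto simp: N_def)
  have NH: "N \<subseteq> S" "\<And>y. y \<in> N \<Longrightarrow> H y \<inter> U \<noteq> {}" "\<And>y. y \<in> N \<Longrightarrow> H y \<inter> V \<noteq> {}"
    "\<And>y. y \<in> N \<Longrightarrow> H y \<subseteq> U \<union> V"
    by (auto simp: N_def)
  let ?v = "{?C \<inter> N \<times> U, ?C \<inter> N \<times> V}"
  have "\<Union>?v = ?C \<inter> fst -` N" using NH(4) by auto blast
  moreover have "openin (top_of_set ?C) (?C \<inter> N \<times> W)" if "open W" for W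
  proof -
    have "?C \<inter> N \<times> W = ?C \<inter> N' \<times> W" using N'(2) by auto
    then show ?thesis using that N'(1) by (simp add: openin_open_Int open_Times)
  qed
  moreover have "pairwise disjnt ?v" using UV(5) by (auto simp: pairwise_def disjnt_def)
  moreover have "\<exists>q. homeomorphism (?C \<inter> N \<times> U) N fst q" "\<exists>q. homeomorphism (?C \<inter> N \<times> V) N fst q"
    using two_valued_sheet[OF H UV(1,2,5) NH(1-3)] two_valued_sheet[OF H UV(2,1) _ NH(1,3,2)] UV(5) by blast+
  ultimately show "\<exists>T. x \<in> T \<and> openin (top_of_set S) T \<and>
      (\<exists>v. \<Union>v = ?C \<inter> fst -` T \<and> (\<forall>u\<in>v. openin (top_of_set ?C) u) \<and> pairwise disjnt v \<and>
        (\<forall>u\<in>v. \<exists>q. homeomorphism u T fst q))"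
    using N \<open>x \<in> N\<close> UV(1,2) by (intro exI[of _ N] conjI exI[of _ ?v]) simp_all
qed

text \<open>The cylinder is lifted to the graph of the deformation, starting at the graph of
  \<open>f\<close>. The value coordinate of the lift is a homotopy of \<open>f\<close> that ends in
  a selection of \<open>\<psi>\<close>, hence without fixed points.\<close>

lemma deforms_to_fpf_selection:
  fixes \<phi> :: "'a::real_normed_vector \<Rightarrow> 'a set"
  assumes "deforms_to_fpf_two_valued X \<phi>" and f: "continuous_on X f" "\<And>x. x \<in> X \<Longrightarrow> f x \<in> \<phi> x"
  shows "deforms_to_fpf X f"
proof -
  obtain \<psi> H where H: "two_valued_map (X \<times> {0..1::real}) X H"
    and ends: "\<And>x. x \<in> X \<Longrightarrow> H (x, 0) = \<phi> x" "\<And>x. x \<in> X \<Longrightarrow> H (x, 1) = \<psi> x"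
    and fpf: "\<And>x. x \<in> X \<Longrightarrow> x \<notin> \<psi> x"
    using assms(1) unfolding deforms_to_fpf_two_valued_def homotopic_two_valued_def by metis
  let ?C = "{(y, z). y \<in> X \<times> {0..1::real} \<and> z \<in> H y}"
  \<comment> \<open>Homotopies carry the time as first coordinate, while \<open>H\<close> has it
    second; hence the swap.\<close>
  obtain k where k: "continuous_on ({0..1} \<times> X) k" "k \<in> {0..1} \<times> X \<rightarrow> ?C"
    "\<And>x. x \<in> X \<Longrightarrow> k (0, x) = ((x, 0), f x)"
    "\<And>z. z \<in> {0..1} \<times> X \<Longrightarrow> (snd z, fst z) = fst (k z)"
  proof (rule covering_space_lift_homotopy[OF two_valued_covering_space[OF H], of X "\<lambda>z. (snd z, fst z)" "\<lambda>x. ((x, 0), f x)"])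
    show "continuous_on ({0..1::real} \<times> X) (\<lambda>z. (snd z, fst z))" by (intro continuous_intros)
    show "continuous_on X (\<lambda>x. ((x, 0::real), f x))" by (intro continuous_intros f(1))
    show "(\<lambda>x. ((x, 0), f x)) \<in> X \<rightarrow> ?C" using f(2) ends(1) by auto
  qed auto
  define g where "g = (\<lambda>x. snd (k (1, x)))"
  have kH: "snd (k (t, x)) \<in> H (x, t)" if "t \<in> {0..1}" "x \<in> X" for t x
  proof -
    have "k (t, x) \<in> ?C" by (rule funcset_mem[OF k(2)]) (use that in simp)
    moreover have "fst (k (t, x)) = (x, t)" using k(4)[of "(t, x)"] that by simp
    ultimately show ?thesis by (simp add: case_prod_unfold)
  qed
  have sub: "H (x, t) \<subseteq> X" if "t \<in> {0..1}" "x \<in> X" for x t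
    using H that by (auto simp: two_valued_map_def)
  have "homotopic_with_canon (\<lambda>_. True) X X f g"
  proof (subst homotopic_with, simp, intro exI[of _ "\<lambda>z. snd (k z)"] conjI allI ballI)
    have "continuous_on ({0..1} \<times> X) (\<lambda>z. snd (k z))" by (intro continuous_intros k(1))
    moreover have "(\<lambda>z. snd (k z)) \<in> {0..1} \<times> X \<rightarrow> X" using kH sub by fastforce
    ultimately show "continuous_map (prod_topology (top_of_set {0..1}) (top_of_set X)) (top_of_set X) (\<lambda>z. snd (k z))"
      by simp
  qed (use k(3) in \<open>auto simp: g_def\<close>)
  moreover have "g x \<noteq> x" if "x \<in> X" for x
    using kH[of 1 x] ends(2)[OF that] fpf[OF that] that by (auto simp: g_def)
  ultimately show ?thesis unfolding deforms_to_fpf_def by blast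
qed
  
text \<open>The sets where \<open>g1\<close> equals \<open>a1\<close> and where it equals
  \<open>a2\<close> are closed, disjoint and cover \<open>S\<close>, so one of them is empty.
  Applied to the torus it makes a splitting unique up to order; applied to the unit interval it
  identifies the two branches along a path.\<close>

lemma components_agree:
  fixes g1 g2 a1 a2 :: "'a::topological_space \<Rightarrow> 'b::real_normed_vector"
  assumes "connected S" "continuous_on S g1" "continuous_on S g2" "continuous_on S a1" "continuous_on S a2"
    and eq: "\<And>t. t \<in> S \<Longrightarrow> {g1 t, g2 t} = {a1 t, a2 t}" and ne: "\<And>t. t \<in> S \<Longrightarrow> a1 t \<noteq> a2 t"
  shows "(\<forall>t\<in>S. g1 t = a1 t \<and> g2 t = a2 t) \<or> (\<forall>t\<in>S. g1 t = a2 t \<and> g2 t = a1 t)"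
proof -
  have cl: "closedin (top_of_set S) {t \<in> S. g1 t = a t}" if "continuous_on S a" for a
    using continuous_closedin_preimage_constant[OF continuous_on_diff[OF assms(2) that], of 0] by simp
  let ?A = "{t \<in> S. g1 t = a1 t}" and ?B = "{t \<in> S. g1 t = a2 t}"
  have cover: "?A \<union> ?B = S" using eq by (auto simp: doubleton_eq_iff)
  have "?A \<inter> ?B = {}"
  proof -
    have False if "t \<in> S" "g1 t = a1 t" "g1 t = a2 t" for t using ne[OF that(1)] that by simp
    then show ?thesis by blast
  qed
  with cover have "?A = {} \<or> ?B = {}"
    using assms(1) cl[OF assms(4)] cl[OF assms(5)] unfolding connected_closedin_eq by metis
  then have "(\<forall>t\<in>S. g1 t = a2 t) \<or> (\<forall>t\<in>S. g1 t = a1 t)" using cover by blast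
  then show ?thesis using eq by (metis doubleton_eq_iff)
qed

subsection \<open>Nielsen numbers of split two-valued maps\<close>

lemma connected_torus: "connected torus"
  by (simp add: torus_def connected_Times connected_sphere)

lemma (in lattice_linear) fpc_lat_iff: "x \<in> fpc F lat \<longleftrightarrow> (\<exists>q\<in>lat. x \<in> fpc F (coset q))"
proof
  assume "x \<in> fpc F lat"
  then show "\<exists>q\<in>lat. x \<in> fpc F (coset q)"
    using coset_self by (intro bexI[of _ "F (tang x) - tang x"]) (simp_all add: fpc_def)
next
  assume "\<exists>q\<in>lat. x \<in> fpc F (coset q)"
  then obtain q where "q \<in> lat" "x \<in> fpc F (coset q)" by blast
  then show "x \<in> fpc F lat" using subsetD[OF coset_lat] by (simp add: fpc_def)
qed

text \<open>Any other splitting is the same up to order, and the exchanged order is excluded by a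
  point of \<open>C\<close>: the maps have no coincidence, so only one of them fixes it.
  Nonemptiness of \<open>C\<close> is essential here.\<close>

lemma split_class_index_eq:
  assumes f: "continuous_on torus f" "f ` torus \<subseteq> torus" "continuous_on torus f'" "f' ` torus \<subseteq> torus"
    and \<phi>: "\<And>x. x \<in> torus \<Longrightarrow> \<phi> x = {f x, f' x}" "\<And>x. x \<in> torus \<Longrightarrow> f x \<noteq> f' x"
    and C: "C \<noteq> {}" "C \<subseteq> {x \<in> torus. f x = x}"
  shows "split_class_index \<phi> C = torus_fixpoint_index f C"
  unfolding split_class_index_def
proof (rule the_equality)
  have "splitting torus torus \<phi> f f'" using f \<phi> by (simp add: splitting_def)
  then show "\<exists>h h'. splitting torus torus \<phi> h h' \<and> C \<subseteq> {x \<in> torus. h x = x} \<and>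
      torus_fixpoint_index f C = torus_fixpoint_index h C" using C by blast
next
  fix k assume "\<exists>h h'. splitting torus torus \<phi> h h' \<and> C \<subseteq> {x \<in> torus. h x = x} \<and> k = torus_fixpoint_index h C"
  then obtain h h' where h: "splitting torus torus \<phi> h h'" "C \<subseteq> {x \<in> torus. h x = x}" "k = torus_fixpoint_index h C"
    by blast
  have "(\<forall>t\<in>torus. h t = f t \<and> h' t = f' t) \<or> (\<forall>t\<in>torus. h t = f' t \<and> h' t = f t)"
    by (rule components_agree[OF connected_torus]) (use h(1) f \<phi> in \<open>auto simp: splitting_def\<close>)
  moreover obtain x where "x \<in> C" using C(1) by blast
  then have "x \<in> torus" "h x = f x" using subsetD[OF C(2)] subsetD[OF h(2)] by auto
  ultimately have "\<And>t. t \<in> torus \<Longrightarrow> h t = f t" using \<phi>(2) by metis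
  then show "k = torus_fixpoint_index f C" unfolding h(3) by (rule torus_fixpoint_index_cong)
qed

text \<open>The continuous branches of \<open>\<phi>\<close> along \<open>p\<close> are
  \<open>f1 \<circ> p\<close> and \<open>f2 \<circ> p\<close> in some order, so the relation reduces
  to that of a single map.\<close>

lemma fixpoint_class_rel_iff:
  assumes f: "continuous_on torus f1" "f1 ` torus \<subseteq> torus" "continuous_on torus f2" "f2 ` torus \<subseteq> torus"
    and \<phi>: "\<And>x. x \<in> torus \<Longrightarrow> \<phi> x = {f1 x, f2 x}" "\<And>x. x \<in> torus \<Longrightarrow> f1 x \<noteq> f2 x"
  shows "(x0, x1) \<in> fixpoint_class_rel torus \<phi> \<longleftrightarrow>
    (\<exists>f\<in>{f1, f2}. \<exists>p. homotopic_to_image f x0 x1 p)" (is "_ \<longleftrightarrow> ?R")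
proof
  assume "(x0, x1) \<in> fixpoint_class_rel torus \<phi>"
  then obtain p g1 g2 g where p: "path p" "path_image p \<subseteq> torus" "pathstart p = x0" "pathfinish p = x1"
    and g: "path g1" "path g2" "\<forall>t\<in>{0..1}. \<phi> (p t) = {g1 t, g2 t}" "g \<in> {g1, g2}" "homotopic_paths torus g p"
    unfolding fixpoint_class_rel_def by blast
  have pt: "p t \<in> torus" if "t \<in> {0..1}" for t using p(2) that by (auto simp: path_image_def)
  have "continuous_on {0..1} (f1 \<circ> p)" "continuous_on {0..1} (f2 \<circ> p)"
    using path_continuous_image[OF p(1) continuous_on_subset[OF f(1) p(2)]]
      path_continuous_image[OF p(1) continuous_on_subset[OF f(3) p(2)]] by (simp_all add: path_def)
  then have "(\<forall>t\<in>{0..1}. g1 t = (f1 \<circ> p) t \<and> g2 t = (f2 \<circ> p) t) \<or> (\<forall>t\<in>{0..1}. g1 t = (f2 \<circ> p) t \<and> g2 t = (f1 \<circ> p) t)"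
    by (intro components_agree) (use g pt \<phi> in \<open>auto simp: path_def\<close>)
  then obtain f where f: "f \<in> {f1, f2}" "\<And>t. t \<in> {0..1} \<Longrightarrow> g t = (f \<circ> p) t" using g(4) by blast
  have "homotopic_paths torus g (f \<circ> p)"
    by (rule homotopic_paths_eq)
      (use f(2) homotopic_paths_imp_path[OF g(5)] homotopic_paths_imp_subset[OF g(5)] in auto)
  then have "homotopic_paths torus (f \<circ> p) p"
    using g(5) homotopic_paths_trans homotopic_paths_sym by blast
  then show ?R using f(1) p unfolding homotopic_to_image_def by blast
next
  assume ?R
  then obtain f p where f': "f \<in> {f1, f2}" and p: "path p" "path_image p \<subseteq> torus" "pathstart p = x0" "pathfinish p = x1"
    and hom: "homotopic_paths torus (f \<circ> p) p" unfolding homotopic_to_image_def by blast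
  have comp: "path (h \<circ> p)" "path_image (h \<circ> p) \<subseteq> torus" if "h \<in> {f1, f2}" for h
    using that path_image_compose_subset[of torus h torus p] f p by auto
  have ends: "f x0 = x0" "f x1 = x1" "x0 \<in> torus" "x1 \<in> torus"
    using homotopic_paths_imp_pathstart[OF hom] homotopic_paths_imp_pathfinish[OF hom] p
    by (auto simp: pathstart_compose pathfinish_compose)
  have pt: "p t \<in> torus" if "t \<in> {0..1}" for t using p(2) that by (auto simp: path_image_def)
  have "x0 \<in> two_valued_fixpoints torus \<phi>" "x1 \<in> two_valued_fixpoints torus \<phi>"
    using ends f' \<phi>(1) by (auto simp: two_valued_fixpoints_def)
  moreover have "path p \<and> path_image p \<subseteq> torus \<and> pathstart p = x0 \<and> pathfinish p = x1 \<and>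
      path (f1 \<circ> p) \<and> path_image (f1 \<circ> p) \<subseteq> torus \<and> path (f2 \<circ> p) \<and> path_image (f2 \<circ> p) \<subseteq> torus \<and>
      (\<forall>t\<in>{0..1}. \<phi> (p t) = {(f1 \<circ> p) t, (f2 \<circ> p) t}) \<and>
      (\<exists>g\<in>{f1 \<circ> p, f2 \<circ> p}. pathstart g = x0 \<and> pathfinish g = x1 \<and> homotopic_paths torus g p)"
    using p comp[of f1] comp[of f2] \<phi>(1)[OF pt] f' hom ends
    by (auto simp: pathstart_compose pathfinish_compose)
  ultimately show "(x0, x1) \<in> fixpoint_class_rel torus \<phi>"
    unfolding fixpoint_class_rel_def by blast
qed

context lattice_linear
begin

lemma split_class_fpc:
  assumes f: "continuous_on torus f" "f ` torus \<subseteq> torus" "continuous_on torus f'" "f' ` torus \<subseteq> torus"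
    and \<phi>: "\<And>x. x \<in> torus \<Longrightarrow> \<phi> x = {f x, f' x}" "\<And>x. x \<in> torus \<Longrightarrow> f x \<noteq> f' x"
    and F: "equivariant F" "\<And>x. x \<in> torus \<Longrightarrow> f x = descend F x" and q: "q \<in> lat"
  shows "x \<in> fpc F (coset q) \<Longrightarrow> fixpoint_class_rel torus \<phi> `` {x} = fpc F (coset q)"
    and "fpc F (coset q) \<noteq> {} \<Longrightarrow>
      split_class_index \<phi> (fpc F (coset q)) = torus_fixpoint_index (descend F) (fpc F (coset q))"
proof -
  have fixed: "fpc F (coset q) \<subseteq> {x \<in> torus. f x = x}"
  proof
    fix x assume "x \<in> fpc F (coset q)"
    then have "x \<in> {x \<in> torus. descend F x = x}"
      unfolding descend_fixed fpc_lat_iff using q by blast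
    then show "x \<in> {x \<in> torus. f x = x}" using F(2) by simp
  qed
  show "fixpoint_class_rel torus \<phi> `` {x} = fpc F (coset q)" if x: "x \<in> fpc F (coset q)"
  proof (rule Set.set_eqI)
    fix y
    \<comment> \<open>The other map does not fix \<open>x\<close>, so it relates \<open>x\<close> to
      no point; the class is that of \<open>f\<close> alone.\<close>
    have "f' x \<noteq> x" using subsetD[OF fixed x] \<phi>(2)[of x] by auto
    then have "\<not> (\<exists>p. homotopic_to_image f' x y p)"
      using homotopic_paths_imp_pathstart[of torus "f' \<circ> _"]
      by (fastforce simp: pathstart_compose homotopic_to_image_def)
    then have "y \<in> fixpoint_class_rel torus \<phi> `` {x} \<longleftrightarrow> (\<exists>r\<in>lat. x \<in> fpc F (coset r) \<and> y \<in> fpc F (coset r))"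
      using fixpoint_class_rel_iff[OF f \<phi>, of x y] same_class_iff[OF F, of x y]
      by (simp only: Image_singleton_iff bex_simps simp_thms)
    also have "\<dots> \<longleftrightarrow> y \<in> fpc F (coset q)"
      using q x fpc_coset_unique by metis
    finally show "y \<in> fixpoint_class_rel torus \<phi> `` {x} \<longleftrightarrow> y \<in> fpc F (coset q)" .
  qed
  assume ne: "fpc F (coset q) \<noteq> {}"
  have "split_class_index \<phi> (fpc F (coset q)) = torus_fixpoint_index f (fpc F (coset q))"
    by (rule split_class_index_eq[OF f \<phi> ne fixed])
  also have "\<dots> = torus_fixpoint_index (descend F) (fpc F (coset q))"
    by (rule torus_fixpoint_index_cong) (rule F(2))
  finally show "split_class_index \<phi> (fpc F (coset q)) = torus_fixpoint_index (descend F) (fpc F (coset q))" .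
qed

end

text \<open>The nonempty sets \<open>fpc\<close> of both lifts are exactly the classes of
  \<open>\<phi>\<close>, and the essential ones among them form the two families already
  counted.\<close>

lemma Nielsen_number_split:
  assumes f: "continuous_on torus f1" "f1 ` torus \<subseteq> torus" "continuous_on torus f2" "f2 ` torus \<subseteq> torus"
    and \<phi>: "\<And>x. x \<in> torus \<Longrightarrow> \<phi> x = {f1 x, f2 x}" "\<And>x. x \<in> torus \<Longrightarrow> f1 x \<noteq> f2 x"
    and z: "z \<in> torus"
    and 1: "tdeg (f1 \<circ> meridian z) = (of_int a1, of_int c1)" "tdeg (f1 \<circ> longitude z) = (of_int b1, of_int d1)"
    and 2: "tdeg (f2 \<circ> meridian z) = (of_int a2, of_int c2)" "tdeg (f2 \<circ> longitude z) = (of_int b2, of_int d2)"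
  shows "int (Nielsen_number \<phi>) =
    \<bar>(a1 - 1) * (d1 - 1) - b1 * c1\<bar> + \<bar>(a2 - 1) * (d2 - 1) - b2 * c2\<bar>"
proof -
  interpret L1: lattice_linear "lin2 a1 b1 c1 d1" by (rule lattice_linear_lin2)
  interpret L2: lattice_linear "lin2 a2 b2 c2 d2" by (rule lattice_linear_lin2)
  obtain F1 where F1: "L1.equivariant F1" "\<And>x. x \<in> torus \<Longrightarrow> f1 x = descend F1 x"
    using degree_lift[OF f(1,2) z 1] by blast
  obtain F2 where F2: "L2.equivariant F2" "\<And>x. x \<in> torus \<Longrightarrow> f2 x = descend F2 x"
    using degree_lift[OF f(3,4) z 2] by blast
  let ?K1 = "\<lambda>q. fpc F1 (L1.coset q)" and ?K2 = "\<lambda>q. fpc F2 (L2.coset q)"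
  have fix1: "{x \<in> torus. f1 x = x} = fpc F1 lat"
    unfolding descend_fixed[symmetric] using F1(2) by auto
  have fix2: "{x \<in> torus. f2 x = x} = fpc F2 lat"
    unfolding descend_fixed[symmetric] using F2(2) by auto
  \<comment> \<open>A common fixed point would be a coincidence of \<open>f1\<close> and
    \<open>f2\<close>.\<close>
  have disj: "fpc F1 lat \<inter> fpc F2 lat = {}"
    unfolding fix1[symmetric] fix2[symmetric] using \<phi>(2) by fastforce
  have sub1: "?K1 q \<subseteq> fpc F1 lat" if "q \<in> lat" for q
    using L1.coset_lat[OF that] by (auto simp: fpc_def)
  have sub2: "?K2 q \<subseteq> fpc F2 lat" if "q \<in> lat" for q
    using L2.coset_lat[OF that] by (auto simp: fpc_def)
  have \<phi>': "\<And>x. x \<in> torus \<Longrightarrow> \<phi> x = {f2 x, f1 x}" "\<And>x. x \<in> torus \<Longrightarrow> f2 x \<noteq> f1 x"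
    using \<phi>(1) \<phi>(2)[symmetric] by (auto simp only: insert_commute)
  have cls1: "fixpoint_class_rel torus \<phi> `` {x} = ?K1 q" if "q \<in> lat" "x \<in> ?K1 q" for x q
    by (rule L1.split_class_fpc(1)[OF f \<phi> F1 that])
  have idx1: "split_class_index \<phi> (?K1 q) = torus_fixpoint_index (descend F1) (?K1 q)" if "q \<in> lat" "?K1 q \<noteq> {}" for q
    by (rule L1.split_class_fpc(2)[OF f \<phi> F1 that])
  have cls2: "fixpoint_class_rel torus \<phi> `` {x} = ?K2 q" if "q \<in> lat" "x \<in> ?K2 q" for x q
    by (rule L2.split_class_fpc(1)[OF f(3,4,1,2) \<phi>' F2 that])
  have idx2: "split_class_index \<phi> (?K2 q) = torus_fixpoint_index (descend F2) (?K2 q)" if "q \<in> lat" "?K2 q \<noteq> {}" for q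
    by (rule L2.split_class_fpc(2)[OF f(3,4,1,2) \<phi>' F2 that])
  have fixpoints: "x \<in> two_valued_fixpoints torus \<phi> \<longleftrightarrow> (\<exists>q\<in>lat. x \<in> ?K1 q) \<or> (\<exists>q\<in>lat. x \<in> ?K2 q)" for x
  proof -
    have "x \<in> two_valued_fixpoints torus \<phi> \<longleftrightarrow> x \<in> torus \<and> (f1 x = x \<or> f2 x = x)"
    proof -
      have "x \<in> \<phi> x \<longleftrightarrow> f1 x = x \<or> f2 x = x" if "x \<in> torus"
        unfolding \<phi>(1)[OF that] by (simp only: insert_iff empty_iff simp_thms) (simp only: eq_commute[of x])
      then show ?thesis unfolding two_valued_fixpoints_def by blast
    qed
    also have "\<dots> \<longleftrightarrow> x \<in> fpc F1 lat \<or> x \<in> fpc F2 lat"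
      unfolding fix1[symmetric] fix2[symmetric] by blast
    also have "x \<in> fpc F1 lat \<longleftrightarrow> (\<exists>q\<in>lat. x \<in> ?K1 q)"
      by (rule L1.fpc_lat_iff)
    also have "x \<in> fpc F2 lat \<longleftrightarrow> (\<exists>q\<in>lat. x \<in> ?K2 q)"
      by (rule L2.fpc_lat_iff)
    finally show ?thesis .
  qed
  have classes: "C \<in> fixpoint_classes torus \<phi> \<longleftrightarrow> C \<noteq> {} \<and> (\<exists>q\<in>lat. C = ?K1 q \<or> C = ?K2 q)" for C
  proof
    assume "C \<in> fixpoint_classes torus \<phi>"
    then obtain x where x: "x \<in> two_valued_fixpoints torus \<phi>" "C = fixpoint_class_rel torus \<phi> `` {x}"
      by (auto simp: fixpoint_classes_def elim: quotientE)
    then consider q where "q \<in> lat" "x \<in> ?K1 q" | q where "q \<in> lat" "x \<in> ?K2 q"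
      using fixpoints by blast
    then show "C \<noteq> {} \<and> (\<exists>q\<in>lat. C = ?K1 q \<or> C = ?K2 q)"
    proof cases
      case 1
      then show ?thesis using cls1[OF 1] x(2) by blast
    next
      case 2
      then show ?thesis using cls2[OF 2] x(2) by blast
    qed
  next
    assume "C \<noteq> {} \<and> (\<exists>q\<in>lat. C = ?K1 q \<or> C = ?K2 q)"
    then obtain q x where q: "q \<in> lat" "C = ?K1 q \<or> C = ?K2 q" "x \<in> C" by blast
    then have "x \<in> two_valued_fixpoints torus \<phi>" "C = fixpoint_class_rel torus \<phi> `` {x}"
      using fixpoints cls1[OF q(1)] cls2[OF q(1)] by blast+
    then show "C \<in> fixpoint_classes torus \<phi>" by (auto simp: fixpoint_classes_def quotient_def)
  qed
  define E1 where "E1 = {C. (\<exists>q\<in>lat. C = fpc F1 (L1.coset q)) \<and> torus_fixpoint_index (descend F1) C \<noteq> 0}"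
  define E2 where "E2 = {C. (\<exists>q\<in>lat. C = fpc F2 (L2.coset q)) \<and> torus_fixpoint_index (descend F2) C \<noteq> 0}"
  note E1 = card_essential_classes[OF F1(1), folded E1_def]
  note E2 = card_essential_classes[OF F2(1), folded E2_def]
  have E1_iff: "C \<in> E1 \<longleftrightarrow> (\<exists>q\<in>lat. C = ?K1 q \<and> torus_fixpoint_index (descend F1) C \<noteq> 0)" for C
    by (auto simp: E1_def)
  have E2_iff: "C \<in> E2 \<longleftrightarrow> (\<exists>q\<in>lat. C = ?K2 q \<and> torus_fixpoint_index (descend F2) C \<noteq> 0)" for C
    by (auto simp: E2_def)
  have "C \<in> fixpoint_classes torus \<phi> \<and> split_class_index \<phi> C \<noteq> 0 \<longleftrightarrow> C \<in> E1 \<or> C \<in> E2" for C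
  proof (cases "C = {}")
    case True
    then show ?thesis using classes[of C] E1(3) E2(3) by blast
  next
    case False
    then show ?thesis
      unfolding classes[of C] E1_iff E2_iff using idx1 idx2 False by metis
  qed
  then have "{C \<in> fixpoint_classes torus \<phi>. split_class_index \<phi> C \<noteq> 0} = E1 \<union> E2" by blast
  \<comment> \<open>No class is counted twice: members are nonempty subsets of disjoint fixed point
    sets.\<close>
  moreover have "E1 \<inter> E2 = {}"
  proof -
    have False if C: "C \<in> E1" "C \<in> E2" for C
    proof -
      have "C \<subseteq> fpc F1 lat" "C \<subseteq> fpc F2 lat"
        using C sub1 sub2 unfolding E1_iff E2_iff by blast+
      then have "C = {}" using disj by blast
      then show False using C(1) E1(3) by simp
    qed
    then show ?thesis by blast
  qed
  ultimately have "Nielsen_number \<phi> = card E1 + card E2"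
    unfolding Nielsen_number_def using E1(1) E2(1) by (simp add: card_Un_disjoint)
  then show ?thesis using E1(2) E2(2) by simp
qed

theorem proposition5:
  fixes \<phi> :: "C2 \<Rightarrow> C2 set" and f1 f2 :: "C2 \<Rightarrow> C2"
    and t0 x1 x2 :: C2 and \<gamma> :: "real \<Rightarrow> C2 \<times> C2"
    and u v w :: "(real \<Rightarrow> C2) set" and Ab :: "(real \<Rightarrow> C2) set \<Rightarrow> int \<times> int"
    and r s a b c d m n :: int
  assumes split: "split_two_valued_map torus torus \<phi>"
    and lift: "is_lift \<phi> (\<lambda>x. (f1 x, f2 x))"
    and base: "t0 \<in> torus" "(x1, x2) \<in> conf2_torus"
    and base_path: "path \<gamma>" "path_image \<gamma> \<subseteq> conf2_torus"
      "pathstart \<gamma> = (x1, x2)" "pathfinish \<gamma> = (f1 t0, f2 t0)"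
    and basis: "fibre_basis x1 x2 u v"
    and Ab: "abelianisation x1 x2 u v Ab"
    and w: "w \<in> carrier (fibre_group x1 x2)" "Ab w = (m, n)"
    and rs: "(r, s) \<noteq> (0, 0)"
    and lift_e1:
      "pi1_change_base conf2_torus \<gamma> (pi1_induced conf2_torus (\<lambda>x. (f1 x, f2 x)) (e1 t0)) =
         P2_elem x1 x2 (w [^]\<^bsub>fibre_group x1 x2\<^esub> r) (a, b)"
    and lift_e2:
      "pi1_change_base conf2_torus \<gamma> (pi1_induced conf2_torus (\<lambda>x. (f1 x, f2 x)) (e2 t0)) =
         P2_elem x1 x2 (w [^]\<^bsub>fibre_group x1 x2\<^esub> s) (c, d)"
  shows
    "int (Nielsen_number \<phi>) =
       \<bar>det (vector [vector [a - 1, c],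
                     vector [b, d - 1]] :: int ^ 2 ^ 2)\<bar> +
       \<bar>det (vector [vector [r * m + a - 1, s * m + c],
                     vector [r * n + b, s * n + d - 1]] :: int ^ 2 ^ 2)\<bar>
     \<and> (deforms_to_fpf_two_valued torus \<phi> \<longrightarrow>
          deforms_to_fpf torus f1 \<and> deforms_to_fpf torus f2)
     \<and> (deforms_to_fpf torus f1 \<and> deforms_to_fpf torus f2 \<longleftrightarrow>
          (\<exists>g. {(a - 1, b), (c, d - 1), (m, n)} \<subseteq> carrier (subgroup_generated Z2 {g})) \<or>
          (s * (a - 1), s * b) = (r * c, r * (d - 1)))"
proof -
  have conf: "(f1 x, f2 x) \<in> conf2_torus" if "x \<in> torus" for x
    using lift that by (auto simp: is_lift_def)
  have \<Phi>: "continuous_on torus (\<lambda>x. (f1 x, f2 x))" "(\<lambda>x. (f1 x, f2 x)) ` torus \<subseteq> conf2_torus"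
    using lift by (auto simp: is_lift_def)
  have f: "continuous_on torus f1" "f1 ` torus \<subseteq> torus" "continuous_on torus f2" "f2 ` torus \<subseteq> torus"
    using continuous_on_fst[OF \<Phi>(1)] continuous_on_snd[OF \<Phi>(1)] conf by (auto simp: conf2_torus_def)
  have \<phi>: "\<And>x. x \<in> torus \<Longrightarrow> \<phi> x = {f1 x, f2 x}" "\<And>x. x \<in> torus \<Longrightarrow> f1 x \<noteq> f2 x"
    using lift conf by (auto simp: is_lift_def conf2_torus_def)
  have loops: "loop_at torus t0 (meridian t0)" "loop_at torus t0 (longitude t0)"
    using meridian_longitude_loop[OF base(1)] by (auto simp: loop_at_def)
  note deg1 = lift_degrees[OF \<Phi> base(2) base_path basis Ab w loops(1) lift_e1]
  note deg2 = lift_degrees[OF \<Phi> base(2) base_path basis Ab w loops(2) lift_e2]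
  \<comment> \<open>The determinant \<open>?D1\<close> belongs to \<open>f1\<close>, whose matrix
    has columns \<open>(r * m + a, r * n + b)\<close> and \<open>(s * m + c, s * n + d)\<close>;
    \<open>?D2\<close> belongs to \<open>f2\<close>, with columns \<open>(a, b)\<close> and
    \<open>(c, d)\<close>.\<close>
  let ?D1 = "(r * m + a - 1) * (s * n + d - 1) - (s * m + c) * (r * n + b)"
  let ?D2 = "(a - 1) * (d - 1) - c * b"
  have "int (Nielsen_number \<phi>) = \<bar>?D1\<bar> + \<bar>?D2\<bar>"
    by (rule Nielsen_number_split[OF f \<phi> base(1) deg1(1) deg2(1) deg1(2) deg2(2)])
  moreover have fpf: "deforms_to_fpf torus f1 \<longleftrightarrow> ?D1 = 0" "deforms_to_fpf torus f2 \<longleftrightarrow> ?D2 = 0"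
    by (rule deforms_to_fpf_iff[OF f(1,2) base(1) deg1(1) deg2(1)],
        rule deforms_to_fpf_iff[OF f(3,4) base(1) deg1(2) deg2(2)])
  moreover have "deforms_to_fpf torus f1" "deforms_to_fpf torus f2" if "deforms_to_fpf_two_valued torus \<phi>"
    using deforms_to_fpf_selection[OF that f(1)] deforms_to_fpf_selection[OF that f(3)] \<phi>(1) by auto
  ultimately show ?thesis
    using fixed_point_free_conditions[OF rs, of a d c b m n] by (auto simp: det2)
qed

end
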